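(* Let $k$ be a field of characteristic $0$, let $R=k[x_1,\ldots,x_n]$ be a polynomial ring with its standard grading, let $I$ be a homogeneous ideal of $R$, and let $\operatorname{Gin}(I)$ be the generic initial ideal of $I$ with respect to the reverse lexicographic order. Then (a) $\operatorname{reg}(I)=\max\{\deg(x^A)\mid x^A\in\operatorname{Min}(\operatorname{Gin}(I))\}$; (b) $a^*(I)=\max\{\deg(x^A)+m(x^A)\mid x^A\in\operatorname{Min}(\operatorname{Gin}(I))\}-n-1$.
   Context: The order is the graded reverse lexicographic order with $x_1>\cdots>x_n$; $\operatorname{Gin}(I)$ is the common initial ideal of $g(I)$ for $g$ in a nonempty Zariski-open subset of $\mathrm{GL}(n,k)$ acting by linear changes of coordinates. For $A=(p_1,\ldots,p_n)$, $x^A=x_1^{p_1}\cdots x_n^{p_n}$ and $m(x^A)=\max\{i\mid p_i\ne0\}$. $\operatorname{Min}(J)$ is the set of minimal monomial generators of a monomial ideal $J$. With $R_+=(x_1,\ldots,x_n)$ and $M$ a finitely generated graded $R$-module, $a_i(M)=\sup\{r\mid H^i_{R_+}(M)_r\neq0\}$ (value $-\infty$ if $H^i_{R_+}(M)=0$), where $H^i_{R_+}(M)$ is the $i$-th (graded) local cohomology module; $\operatorname{reg}(M)=\max\{a_i(M)+i\mid i\ge0\}$ and $a^*(M)=\max\{a_i(M)\mid i\ge 0\}$. The ideal $I$ is regarded as a graded $R$-module. *)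

theory Defs
  imports
    "HOL-Library.Poly_Mapping"
    "HOL-Library.Extended_Real"
    "HOL-Library.FuncSet"
    "HOL-Algebra.Coset"
    "HOL-Algebra.Ideal"
    "HOL-Algebra.Module"
    "Jordan_Normal_Form.Matrix"
begin

section \<open>Polynomial rings and homogeneous ideals\<close>

text \<open>
  The power product \<open>x\<^sub>1^(p\<^sub>1) \<cdots> x\<^sub>n^(p\<^sub>n)\<close> is represented by its exponent vector, the finitely
  supported function sending \<open>i\<close> to \<open>p\<^sub>i\<close>.  The variables are numbered from 1, and
  \<open>poly_ring n\<close> is the ring of those polynomials which involve the variables
  \<open>x\<^sub>1, \<dots>, x\<^sub>n\<close> only.
\<close>

type_synonym pprod = "nat \<Rightarrow>\<^sub>0 nat"
type_synonym 'k mpoly = "pprod \<Rightarrow>\<^sub>0 'k"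

abbreviation mono :: "pprod \<Rightarrow> 'k::comm_ring_1 mpoly" where
  "mono t \<equiv> Poly_Mapping.single t 1"

definition pvar :: "nat \<Rightarrow> 'k::comm_ring_1 mpoly" where
  "pvar i = mono (Poly_Mapping.single i 1)"

definition pprods :: "nat \<Rightarrow> pprod set" where
  "pprods n = {t. Poly_Mapping.keys t \<subseteq> {1..n}}"

definition poly_ring :: "nat \<Rightarrow> 'k::comm_ring_1 mpoly ring" where
  "poly_ring n = \<lparr>carrier = {f. Poly_Mapping.keys f \<subseteq> pprods n},
     monoid.mult = (*), one = 1, zero = 0, add = (+)\<rparr>"

definition pdeg :: "pprod \<Rightarrow> nat" where
  "pdeg t = (\<Sum>i\<in>Poly_Mapping.keys t. Poly_Mapping.lookup t i)"

text \<open>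
  Degrees are integers; the zero polynomial is homogeneous of every degree, and it is the only
  polynomial that is homogeneous of a negative degree.
\<close>

definition homogeneous :: "int \<Rightarrow> 'k::comm_ring_1 mpoly \<Rightarrow> bool" where
  "homogeneous d f \<longleftrightarrow> (\<forall>t\<in>Poly_Mapping.keys f. int (pdeg t) = d)"

definition homogeneous_ideal :: "nat \<Rightarrow> 'k::comm_ring_1 mpoly set \<Rightarrow> bool" where
  "homogeneous_ideal n I \<longleftrightarrow>
     (\<exists>B \<subseteq> carrier (poly_ring n). (\<forall>f\<in>B. \<exists>d. homogeneous d f) \<and> I = Idl\<^bsub>poly_ring n\<^esub> B)"


section \<open>Initial ideals for the graded reverse lexicographic order\<close>

text \<open>With \<open>x\<^sub>1 > x\<^sub>2 > \<cdots>\<close>: for equal degrees, \<open>s < t\<close> iff the last nonzero entry of \<open>t - s\<close> is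
  negative.\<close>

definition revlex_less :: "pprod \<Rightarrow> pprod \<Rightarrow> bool" where
  "revlex_less s t \<longleftrightarrow> pdeg s < pdeg t \<or>
     (pdeg s = pdeg t \<and>
      (\<exists>i. Poly_Mapping.lookup t i < Poly_Mapping.lookup s i \<and>
           (\<forall>j>i. Poly_Mapping.lookup t j = Poly_Mapping.lookup s j)))"

definition is_lead :: "pprod \<Rightarrow> 'k::comm_ring_1 mpoly \<Rightarrow> bool" where
  "is_lead t f \<longleftrightarrow> t \<in> Poly_Mapping.keys f \<and>
     (\<forall>s\<in>Poly_Mapping.keys f. s \<noteq> t \<longrightarrow> revlex_less s t)"

definition initial_ideal :: "nat \<Rightarrow> 'k::comm_ring_1 mpoly set \<Rightarrow> 'k mpoly set" where
  "initial_ideal n I = Idl\<^bsub>poly_ring n\<^esub> {mono t | t. \<exists>f\<in>I. is_lead t f}"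

definition Min_gens :: "nat \<Rightarrow> 'k::comm_ring_1 mpoly set \<Rightarrow> pprod set" where
  "Min_gens n J = {t \<in> pprods n. mono t \<in> J \<and>
     (\<forall>s\<in>pprods n. mono s \<in> J \<longrightarrow> (\<exists>u. t = s + u) \<longrightarrow> s = t)}"

text \<open>
  The power product 1 involves no variable, so that the maximum defining \<open>m(1)\<close> is taken over the
  empty set.  It matters only for the unit ideal; the value 1 is the one for which
  \<open>deg(1) + m(1) - n - 1 = -n\<close> is the largest degree of a nonzero local cohomology class of
  the polynomial ring itself.
\<close>

definition max_var :: "pprod \<Rightarrow> nat" where
  "max_var t = (if t = 0 then 1 else Max (Poly_Mapping.keys t))"


section \<open>Generic initial ideals\<close>

text \<open>Evaluation at \<open>\<sigma>\<close>, with the coefficients mapped by \<open>\<phi>\<close>.\<close>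

definition poly_eval ::
  "('a::zero \<Rightarrow> 'b::comm_ring_1) \<Rightarrow> ('v \<Rightarrow> 'b) \<Rightarrow> (('v \<Rightarrow>\<^sub>0 nat) \<Rightarrow>\<^sub>0 'a) \<Rightarrow> 'b" where
  "poly_eval \<phi> \<sigma> f = (\<Sum>t\<in>Poly_Mapping.keys f. \<phi> (Poly_Mapping.lookup f t) *
     (\<Prod>v\<in>Poly_Mapping.keys t. \<sigma> v ^ Poly_Mapping.lookup t v))"

definition GL :: "nat \<Rightarrow> 'k::field mat set" where
  "GL n = {g \<in> carrier_mat n n. invertible_mat g}"

text \<open>
  The linear change of coordinates \<open>x\<^sub>j \<mapsto> \<Sum>\<^sub>i g\<^sub>i\<^sub>j x\<^sub>i\<close>; matrix indices start from 0.
\<close>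

definition GL_act :: "nat \<Rightarrow> 'k::field mat \<Rightarrow> 'k mpoly \<Rightarrow> 'k mpoly" where
  "GL_act n g = poly_eval (Poly_Mapping.single 0)
     (\<lambda>j. \<Sum>i\<in>{1..n}. Poly_Mapping.single 0 (g $$ (i - 1, j - 1)) * pvar i)"

text \<open>
  A Zariski-open subset of \<open>GL n\<close> is the complement in \<open>GL n\<close> of the common zeros of a set of
  polynomials in the matrix entries.
\<close>

definition zariski_open :: "nat \<Rightarrow> 'k::field mat set \<Rightarrow> bool" where
  "zariski_open n U \<longleftrightarrow>
     (\<exists>F :: ((nat \<times> nat \<Rightarrow>\<^sub>0 nat) \<Rightarrow>\<^sub>0 'k) set.
        (\<forall>f\<in>F. \<forall>t\<in>Poly_Mapping.keys f. Poly_Mapping.keys t \<subseteq> {..<n} \<times> {..<n}) \<and>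
        U = {g \<in> GL n. \<exists>f\<in>F. poly_eval id (\<lambda>v. g $$ v) f \<noteq> 0})"

definition Gin :: "nat \<Rightarrow> 'k::field mpoly set \<Rightarrow> 'k mpoly set" where
  "Gin n I = (THE J. \<exists>U. zariski_open n U \<and> U \<noteq> {} \<and>
     (\<forall>g\<in>U. initial_ideal n (GL_act n g ` I) = J))"


section \<open>Localisation of a module at the powers of a ring element\<close>

text \<open>A pair \<open>(a, s)\<close> stands for the fraction \<open>a / f^s\<close>.\<close>

definition loc_rel ::
  "('a, 'r) ring_scheme \<Rightarrow> ('a, 'm, 'x) module_scheme \<Rightarrow> 'a \<Rightarrow> (('m \<times> nat) \<times> ('m \<times> nat)) set" where
  "loc_rel R M f = {((a, s), (b, t)) | a s b t. a \<in> carrier M \<and> b \<in> carrier M \<and>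
     (\<exists>u::nat. (f [^]\<^bsub>R\<^esub> (u + t)) \<odot>\<^bsub>M\<^esub> a = (f [^]\<^bsub>R\<^esub> (u + s)) \<odot>\<^bsub>M\<^esub> b)}"

definition frac ::
  "('a, 'r) ring_scheme \<Rightarrow> ('a, 'm, 'x) module_scheme \<Rightarrow> 'a \<Rightarrow> 'm \<Rightarrow> nat \<Rightarrow> ('m \<times> nat) set" where
  "frac R M f a s = loc_rel R M f `` {(a, s)}"

text \<open>
  Modules are records extending rings; the unused multiplicative fields are left undefined.
\<close>

definition localise ::
  "('a, 'r) ring_scheme \<Rightarrow> ('a, 'm, 'x) module_scheme \<Rightarrow> 'a \<Rightarrow> ('a, ('m \<times> nat) set) module" where
  "localise R M f =
     \<lparr>carrier = (carrier M \<times> UNIV) // loc_rel R M f,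
      monoid.mult = undefined, one = undefined,
      zero = frac R M f \<zero>\<^bsub>M\<^esub> 0,
      add = (\<lambda>X Y. \<Union>(a, s)\<in>X. \<Union>(b, t)\<in>Y.
        frac R M f (((f [^]\<^bsub>R\<^esub> t) \<odot>\<^bsub>M\<^esub> a) \<oplus>\<^bsub>M\<^esub> ((f [^]\<^bsub>R\<^esub> s) \<odot>\<^bsub>M\<^esub> b)) (s + t)),
      smult = (\<lambda>r X. \<Union>(a, s)\<in>X. frac R M f (r \<odot>\<^bsub>M\<^esub> a) s)\<rparr>"

text \<open>The natural map from the localisation at \<open>f\<close> to the one at \<open>f g\<close>, sending \<open>a / f^s\<close> to
  \<open>g^s a / (f g)^s\<close>.\<close>

definition loc_map ::
  "('a, 'r) ring_scheme \<Rightarrow> ('a, 'm, 'x) module_scheme \<Rightarrow> 'a \<Rightarrow> 'a \<Rightarrow> ('m \<times> nat) set \<Rightarrow> ('m \<times> nat) set" where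
  "loc_map R M f g X = (\<Union>(a, s)\<in>X. frac R M (f \<otimes>\<^bsub>R\<^esub> g) ((g [^]\<^bsub>R\<^esub> s) \<odot>\<^bsub>M\<^esub> a) s)"


section \<open>Graded local cohomology with support in the irrelevant ideal\<close>

text \<open>
  Local cohomology with support in \<open>(x\<^sub>1, \<dots>, x\<^sub>n)\<close> is the cohomology of the Cech complex on
  \<open>x\<^sub>1, \<dots>, x\<^sub>n\<close>, whose term in cohomological degree \<open>p\<close> is the direct sum, over the subsets \<open>S\<close> of
  \<open>{1..n}\<close> with \<open>p\<close> elements, of the localisations of \<open>M\<close> at the product \<open>x_S\<close> of the \<open>x\<^sub>i\<close>
  with \<open>i \<in> S\<close>.

  \<open>M\<close> is a module over \<open>poly_ring n\<close> with grading \<open>G\<close>: the homogeneous component of degree \<open>r\<close> is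
  \<open>G r\<close>.  The component of degree \<open>r\<close> of the localisation at \<open>x_S\<close> consists of the fractions
  \<open>a / x_S^s\<close> with \<open>a\<close> of degree \<open>r + s |S|\<close>.  As the differential preserves degrees, the
  component of degree \<open>r\<close> of the cohomology is the cohomology of the complex of the components of
  degree \<open>r\<close>.
\<close>

definition xprod :: "nat set \<Rightarrow> 'k::comm_ring_1 mpoly" where
  "xprod S = (\<Prod>i\<in>S. pvar i)"

abbreviation cech_loc ::
  "nat \<Rightarrow> ('k::comm_ring_1 mpoly, 'm, 'x) module_scheme \<Rightarrow> nat set \<Rightarrow> ('k mpoly, ('m \<times> nat) set) module" where
  "cech_loc n M S \<equiv> localise (poly_ring n) M (xprod S)"

definition cech_idx :: "nat \<Rightarrow> nat \<Rightarrow> nat set set" where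
  "cech_idx n p = {S. S \<subseteq> {1..n} \<and> card S = p}"

definition cech_group ::
  "nat \<Rightarrow> ('k::comm_ring_1 mpoly, 'm, 'x) module_scheme \<Rightarrow> (int \<Rightarrow> 'm set) \<Rightarrow> nat \<Rightarrow> int \<Rightarrow>
   (nat set \<Rightarrow> ('m \<times> nat) set) monoid" where
  "cech_group n M G p r =
     \<lparr>carrier = (\<Pi>\<^sub>E S\<in>cech_idx n p.
        {frac (poly_ring n) M (xprod S) a s | a s. a \<in> G (r + int s * int (card S))}),
      monoid.mult = (\<lambda>c d. \<lambda>S\<in>cech_idx n p. c S \<oplus>\<^bsub>cech_loc n M S\<^esub> d S),
      one = (\<lambda>S\<in>cech_idx n p. \<zero>\<^bsub>cech_loc n M S\<^esub>)\<rparr>"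

definition cech_diff ::
  "nat \<Rightarrow> ('k::comm_ring_1 mpoly, 'm, 'x) module_scheme \<Rightarrow> nat \<Rightarrow>
   (nat set \<Rightarrow> ('m \<times> nat) set) \<Rightarrow> (nat set \<Rightarrow> ('m \<times> nat) set)" where
  "cech_diff n M p c = (\<lambda>T\<in>cech_idx n (Suc p).
     \<Oplus>\<^bsub>cech_loc n M T\<^esub> i\<in>T.
       (let y = loc_map (poly_ring n) M (xprod (T - {i})) (pvar i) (c (T - {i}))
        in if even (card {j\<in>T. j < i}) then y else \<ominus>\<^bsub>cech_loc n M T\<^esub> y))"

definition cech_cocycles where
  "cech_cocycles n M G p r =
     kernel (cech_group n M G p r) (cech_group n M G (Suc p) r) (cech_diff n M p)"

definition cech_coboundaries where
  "cech_coboundaries n M G p r =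
     (case p of 0 \<Rightarrow> {\<one>\<^bsub>cech_group n M G 0 r\<^esub>}
              | Suc q \<Rightarrow> cech_diff n M q ` carrier (cech_group n M G q r))"

definition local_cohomology ::
  "nat \<Rightarrow> ('k::comm_ring_1 mpoly, 'm, 'x) module_scheme \<Rightarrow> (int \<Rightarrow> 'm set) \<Rightarrow> nat \<Rightarrow> int \<Rightarrow>
   (nat set \<Rightarrow> ('m \<times> nat) set) set monoid" where
  "local_cohomology n M G i r =
     (cech_group n M G i r)\<lparr>carrier := cech_cocycles n M G i r\<rparr> Mod cech_coboundaries n M G i r"

text \<open>In \<open>ereal\<close> the supremum of the empty set is \<open>-\<infinity>\<close>.\<close>

definition top_degree ::
  "nat \<Rightarrow> ('k::comm_ring_1 mpoly, 'm, 'x) module_scheme \<Rightarrow> (int \<Rightarrow> 'm set) \<Rightarrow> nat \<Rightarrow> ereal" where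
  "top_degree n M G i =
     (SUP r\<in>{r. carrier (local_cohomology n M G i r) \<noteq> {\<one>\<^bsub>local_cohomology n M G i r\<^esub>}}.
        ereal (real_of_int r))"

definition regularity ::
  "nat \<Rightarrow> ('k::comm_ring_1 mpoly, 'm, 'x) module_scheme \<Rightarrow> (int \<Rightarrow> 'm set) \<Rightarrow> ereal" where
  "regularity n M G = (SUP i. top_degree n M G i + ereal (real i))"

definition a_star ::
  "nat \<Rightarrow> ('k::comm_ring_1 mpoly, 'm, 'x) module_scheme \<Rightarrow> (int \<Rightarrow> 'm set) \<Rightarrow> ereal" where
  "a_star n M G = (SUP i. top_degree n M G i)"

definition ideal_module :: "'k::comm_ring_1 mpoly set \<Rightarrow> ('k mpoly, 'k mpoly) module" where
  "ideal_module I = \<lparr>carrier = I, monoid.mult = (*), one = 1, zero = 0, add = (+), smult = (*)\<rparr>"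

definition ideal_grading :: "'k::comm_ring_1 mpoly set \<Rightarrow> int \<Rightarrow> 'k mpoly set" where
  "ideal_grading I r = {f \<in> I. homogeneous r f}"

end

theory Submission
  imports Defs "Jordan_Normal_Form.Determinant"
begin

text \<open>
  Identify the localisations of the ideals of \<open>R\<close> with subgroups of the Laurent polynomials, so that
  the local cohomology of \<open>R / B\<close> in one degree becomes a question about cochains which are cocycles
  modulo \<open>B\<close>.  If the linear form \<open>l\<close> is not a zero divisor modulo \<open>B\<close> in high degrees, then for
  \<open>e \<le> 1\<close> the bounds \<open>r + e p \<le> \<rho>\<close> on the pairs \<open>(p, r)\<close> with \<open>H\<^sup>p(R / B)\<^sub>r \<noteq> 0\<close> are
  controlled by those of \<open>R / (B, l)\<close> and the degrees of \<open>(B : l) / B\<close>.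

  In generic coordinates the last variables can be divided out one after the other.  By the
  characteristic property of the reverse lexicographic order, the degrees of the successive colon
  quotients can be read off the initial ideal.  As the generic initial ideal is stable in
  characteristic 0 (it is fixed by the Borel group, whose infinitesimal elements replace a variable by
  an earlier one), the quotient belonging to \<open>x\<^sub>i\<close> lives exactly in the degrees \<open>deg m - 1\<close> of the
  minimal generators \<open>m\<close> whose last variable is \<open>x\<^sub>i\<close>.  Hence \<open>r + e p\<close> attains the maximum of
  \<open>deg m + (1 - e) (max_var m - n - 1)\<close> on the local cohomology of \<open>I\<close>; the cases \<open>e = 1\<close> and
  \<open>e = 0\<close> are the two formulas.
\<close>

text \<open>A form \<open>l\<close> that is a nonzerodivisor in high degrees cancels on every
  localisation at a nonempty set of variables, since a larger denominator moves the numerator to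
  high degree. So multiplication by \<open>l\<close> behaves as in a short exact sequence except in
  cohomological degree 0, and only \<open>H^0\<close> sees the colon. The bound on
  \<open>r + e p\<close> moves by the same \<open>1 - e\<close> in both directions; hence one
  induction serves both formulas. Passing from \<open>R / I\<close> to \<open>I\<close> needs the
  local cohomology of \<open>R\<close> and the vanishing of that of \<open>R / I\<close> from
  cohomological degree \<open>n\<close> on. Both come out of the same induction, for the zero ideal
  or with an extreme \<open>e\<close>. The Cech complex is tied to the variables, so comparing
  \<open>I\<close> with \<open>g I\<close> would require its independence of coordinates. Instead
  the hyperplanes move: ideals are pulled back along \<open>g\<close>, and \<open>x_i\<close>
  becomes \<open>g' x_i\<close>. The generic initial ideal is found without exterior powers:
  families in \<open>g I\<close> depending polynomially on \<open>g\<close> are reduced by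
  fraction-free cancellation, and Dickson's lemma leaves finitely many leading coefficients to keep
  nonzero.\<close>

abbreviation (input) "lookup \<equiv> Poly_Mapping.lookup"
abbreviation (input) "single \<equiv> Poly_Mapping.single"
abbreviation (input) "keys \<equiv> Poly_Mapping.keys"

section \<open>Power products and polynomials\<close>

abbreviation PR :: "nat \<Rightarrow> 'k::comm_ring_1 mpoly set" where
  "PR n \<equiv> carrier (poly_ring n)"

lemma PR_iff: "f \<in> PR n \<longleftrightarrow> keys f \<subseteq> pprods n"
  by (simp add: poly_ring_def)

lemma poly_ring_simps [simp]:
  "x \<otimes>\<^bsub>poly_ring n\<^esub> y = x * y" "x \<oplus>\<^bsub>poly_ring n\<^esub> y = x + y"
  "\<one>\<^bsub>poly_ring n\<^esub> = 1" "\<zero>\<^bsub>poly_ring n\<^esub> = 0"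
  by (simp_all add: poly_ring_def)

lemma keys_add_nat: "keys (s + t) = keys s \<union> keys (t :: 'a \<Rightarrow>\<^sub>0 nat)"
  by (auto simp: in_keys_iff lookup_add)

lemma pprods_add: "s + t \<in> pprods n \<longleftrightarrow> s \<in> pprods n \<and> t \<in> pprods n"
  by (auto simp: pprods_def keys_add_nat)

lemma pprods_zero [simp]: "0 \<in> pprods n"
  by (simp add: pprods_def)

lemma pprods_single: "single i k \<in> pprods n \<longleftrightarrow> k = 0 \<or> i \<in> {1..n}"
  by (auto simp: pprods_def)

lemma PR_zero [simp]: "0 \<in> PR n"
  and PR_one [simp]: "1 \<in> PR n"
  by (simp_all add: PR_iff)

lemma PR_add: "f \<in> PR n \<Longrightarrow> g \<in> PR n \<Longrightarrow> f + g \<in> PR n"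
  using keys_add[of f g] by (auto simp: PR_iff)

lemma PR_diff: "f \<in> PR n \<Longrightarrow> g \<in> PR n \<Longrightarrow> f - g \<in> PR n"
  by (auto simp: PR_iff in_keys_iff lookup_minus) (metis diff_zero in_keys_iff subsetD)

lemma PR_uminus: "f \<in> PR n \<Longrightarrow> - f \<in> PR n"
  by (auto simp: PR_iff in_keys_iff)

lemma PR_mult: "f \<in> PR n \<Longrightarrow> g \<in> PR n \<Longrightarrow> f * g \<in> PR n"
  using keys_mult[of f g] by (fastforce simp: PR_iff pprods_add)

lemma PR_single: "t \<in> pprods n \<Longrightarrow> single t c \<in> PR n"
  by (simp add: PR_iff)

lemma PR_sum: "(\<And>i. i \<in> A \<Longrightarrow> f i \<in> PR n) \<Longrightarrow> sum f A \<in> PR n"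
  by (induction A rule: infinite_finite_induct) (auto intro: PR_add)

lemma PR_prod: "(\<And>i. i \<in> A \<Longrightarrow> f i \<in> PR n) \<Longrightarrow> prod f A \<in> PR n"
  by (induction A rule: infinite_finite_induct) (auto intro: PR_mult)

lemma PR_power: "f \<in> PR n \<Longrightarrow> f ^ k \<in> PR n"
  by (induction k) (auto intro: PR_mult)

lemma PR_pvar: "i \<in> {1..n} \<Longrightarrow> pvar i \<in> PR n"
  by (simp add: pvar_def PR_single pprods_single)

lemma poly_ring_cring: "cring (poly_ring n :: 'k::comm_ring_1 mpoly ring)"
proof (rule cringI)
  show "abelian_group (poly_ring n :: 'k mpoly ring)"
  proof (rule abelian_groupI)
    fix f :: "'k mpoly" assume "f \<in> PR n"
    then show "\<exists>g\<in>PR n. g \<oplus>\<^bsub>poly_ring n\<^esub> f = \<zero>\<^bsub>poly_ring n\<^esub>"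
      by (intro bexI[of _ "- f"]) (auto intro: PR_uminus)
  qed (auto intro: PR_add simp: algebra_simps)
  show "Group.comm_monoid (poly_ring n :: 'k mpoly ring)"
    by (rule comm_monoidI) (auto intro: PR_mult simp: algebra_simps)
qed (auto simp: algebra_simps)

lemma pdeg_eq_sum: "keys t \<subseteq> S \<Longrightarrow> finite S \<Longrightarrow> pdeg t = (\<Sum>i\<in>S. lookup t i)"
  unfolding pdeg_def by (rule sum.mono_neutral_left) (auto simp: in_keys_iff)

lemma pdeg_add [simp]: "pdeg (s + t) = pdeg s + pdeg t"
proof -
  let ?S = "keys s \<union> keys t"
  have "pdeg (s + t) = (\<Sum>i\<in>?S. lookup s i + lookup t i)"
    by (subst pdeg_eq_sum[of _ ?S]) (auto simp: keys_add_nat lookup_add)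
  then show ?thesis
    by (simp add: sum.distrib pdeg_eq_sum[of s ?S] pdeg_eq_sum[of t ?S])
qed

lemma pdeg_zero [simp]: "pdeg 0 = 0"
  by (simp add: pdeg_def)

lemma pdeg_single [simp]: "pdeg (single i k) = k"
  by (cases "k = 0") (auto simp: pdeg_def)

lemma lookup_le_pdeg: "lookup t i \<le> pdeg t"
proof (cases "i \<in> keys t")
  case True
  then show ?thesis unfolding pdeg_def by (intro member_le_sum) auto
qed (simp add: in_keys_iff)

lemma pdeg_eq_0_iff: "pdeg t = 0 \<longleftrightarrow> t = 0"
proof
  assume "pdeg t = 0"
  then show "t = 0" using lookup_le_pdeg[of t] by (intro poly_mapping_eqI) simp
qed simp

lemma finite_pprods_pdeg: "finite {t \<in> pprods n. pdeg t \<le> d}"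
proof -
  let ?F = "{f::nat \<Rightarrow> nat. \<forall>i. (i \<in> {1..n} \<longrightarrow> f i \<in> {..d}) \<and> (i \<notin> {1..n} \<longrightarrow> f i = 0)}"
  have "lookup ` {t \<in> pprods n. pdeg t \<le> d} \<subseteq> ?F"
    using lookup_le_pdeg by (auto simp: pprods_def in_keys_iff subset_iff intro: order_trans)
  moreover have "finite ?F" by (rule finite_set_of_finite_funs) auto
  ultimately have "finite (lookup ` {t \<in> pprods n. pdeg t \<le> d})" by (rule finite_subset)
  then show ?thesis by (rule finite_imageD) (auto intro: inj_onI poly_mapping_eqI)
qed

lemma homogeneous_zero [simp]: "homogeneous d 0"
  by (simp add: homogeneous_def)

lemma homogeneous_add: "homogeneous d f \<Longrightarrow> homogeneous d g \<Longrightarrow> homogeneous d (f + g)"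
  using keys_add[of f g] by (auto simp: homogeneous_def)

lemma homogeneous_uminus: "homogeneous d f \<Longrightarrow> homogeneous d (- f)"
  by (auto simp: homogeneous_def in_keys_iff)

lemma homogeneous_diff: "homogeneous d f \<Longrightarrow> homogeneous d g \<Longrightarrow> homogeneous d (f - g)"
  using homogeneous_add[OF _ homogeneous_uminus, of d f g] by simp

lemma homogeneous_mult: "homogeneous d f \<Longrightarrow> homogeneous e g \<Longrightarrow> homogeneous (d + e) (f * g)"
  using keys_mult[of f g] by (fastforce simp: homogeneous_def)

lemma homogeneous_sum: "(\<And>i. i \<in> A \<Longrightarrow> homogeneous d (f i)) \<Longrightarrow> homogeneous d (sum f A)"
  by (induction A rule: infinite_finite_induct) (auto intro: homogeneous_add)

lemma homogeneous_single: "homogeneous d (single t c) \<longleftrightarrow> c = 0 \<or> int (pdeg t) = d"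
  by (auto simp: homogeneous_def)

lemma homogeneous_one [simp]: "homogeneous 0 1"
  by (simp add: homogeneous_def)

lemma homogeneous_pvar [simp]: "homogeneous 1 (pvar i)"
  by (simp add: pvar_def homogeneous_single)

lemma homogeneous_power: "homogeneous d f \<Longrightarrow> homogeneous (d * int k) (f ^ k)"
proof (induction k)
  case (Suc k)
  then show ?case using homogeneous_mult[of d f "d * int k" "f ^ k"] by (simp add: algebra_simps)
qed simp

lemma keys_eq_empty' [simp]: "keys (f :: 'a \<Rightarrow>\<^sub>0 'b::zero) = {} \<longleftrightarrow> f = 0"
  by (metis all_not_in_conv keys_zero lookup_zero in_keys_iff poly_mapping_eqI)

lemma poly_mapping_sum_single:
  "finite S \<Longrightarrow> keys f \<subseteq> S \<Longrightarrow> f = (\<Sum>t\<in>S. single t (lookup f t))"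
  by (rule poly_mapping_eqI) (auto simp: lookup_sum lookup_single when_def in_keys_iff)

lemma lookup_mult_mono:
  "lookup (mono u * f) t =
     (if \<exists>s. t = u + s then lookup f (t - u) else 0)"
  for u :: pprod and f :: "'k::comm_ring_1 mpoly"
proof -
  have "mono u * f = (\<Sum>s\<in>keys f. single (u + s) (lookup f s))"
    by (subst poly_mapping_sum_single[of "keys f" f]) (auto simp: sum_distrib_left mult_single)
  then have "lookup (mono u * f) t = (\<Sum>s\<in>keys f. (lookup f s when u + s = t))"
    by (simp add: lookup_sum lookup_single)
  also have "\<dots> = (if \<exists>s. t = u + s then lookup f (t - u) else 0)"
  proof (cases "\<exists>s. t = u + s")
    case True
    then obtain s where s: "t = u + s" by blast
    have "u + s' = t \<longleftrightarrow> s' = s" for s' by (auto simp: s)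
    then show ?thesis by (auto simp: when_def s in_keys_iff)
  qed (auto simp: when_def intro!: sum.neutral)
  finally show ?thesis .
qed

lemma lookup_mult_mono_add [simp]: "lookup (mono u * f) (u + s) = lookup f s"
  for u :: pprod and f :: "'k::comm_ring_1 mpoly"
  by (auto simp: lookup_mult_mono)

lemma keys_mult_mono: "keys (mono u * f) = (+) u ` keys f"
  for u :: pprod and f :: "'k::comm_ring_1 mpoly"
  by (auto simp: in_keys_iff lookup_mult_mono split: if_splits)

lemma lookup_mult_const [simp]: "lookup (single 0 c * f) t = c * lookup f t"
  for f :: "'k::comm_ring_1 mpoly"
proof -
  have "single 0 c * f = (\<Sum>s\<in>keys f. single s (c * lookup f s))"
    by (subst poly_mapping_sum_single[of "keys f" f]) (auto simp: sum_distrib_left mult_single)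
  then show ?thesis
    by (auto simp: lookup_sum lookup_single when_def in_keys_iff)
qed

section \<open>Selecting terms, homogeneous components\<close>

text \<open>One operator serves both for homogeneous components and, later, for discarding the terms
  that contain the last variables.\<close>

definition keep :: "(pprod \<Rightarrow> bool) \<Rightarrow> 'k::comm_ring_1 mpoly \<Rightarrow> 'k mpoly" where
  "keep P f = (\<Sum>t\<in>keys f. if P t then single t (lookup f t) else 0)"

lemma lookup_keep: "lookup (keep P f) t = (if P t then lookup f t else 0)"
proof -
  have "lookup (keep P f) t = (\<Sum>s\<in>keys f. if s = t then (if P t then lookup f t else 0) else 0)"
    unfolding keep_def lookup_sum by (rule sum.cong) (auto simp: lookup_single when_def)
  then show ?thesis by (auto simp: in_keys_iff)
qed

lemma keys_keep: "keys (keep P f) = {t \<in> keys f. P t}"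
  by (auto simp: in_keys_iff lookup_keep split: if_splits)

lemma PR_keep: "f \<in> PR n \<Longrightarrow> keep P f \<in> PR n"
  by (auto simp: PR_iff keys_keep)

lemma keep_add: "keep P (f + g) = keep P f + keep P g"
  by (rule poly_mapping_eqI) (simp add: lookup_keep lookup_add)

lemma keep_diff: "keep P (f - g) = keep P f - keep P g"
  by (rule poly_mapping_eqI) (simp add: lookup_keep lookup_minus)

lemma keep_zero [simp]: "keep P 0 = 0"
  by (simp add: keep_def)

abbreviation hcomp :: "int \<Rightarrow> 'k::comm_ring_1 mpoly \<Rightarrow> 'k mpoly" where
  "hcomp d \<equiv> keep (\<lambda>t. int (pdeg t) = d)"

lemma homogeneous_hcomp: "homogeneous d (hcomp d f)"
  by (simp add: homogeneous_def keys_keep)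

lemma hcomp_homogeneous: "homogeneous e f \<Longrightarrow> hcomp d f = (if d = e then f else 0)"
  by (rule poly_mapping_eqI) (auto simp: lookup_keep homogeneous_def in_keys_iff)

lemma sum_hcomp: "finite D \<Longrightarrow> (\<And>t. t \<in> keys f \<Longrightarrow> int (pdeg t) \<in> D) \<Longrightarrow> (\<Sum>d\<in>D. hcomp d f) = f"
  by (rule poly_mapping_eqI) (auto simp: lookup_sum lookup_keep in_keys_iff)

lemma ex_sum_hcomp: "\<exists>D. finite D \<and> (\<Sum>d\<in>D. hcomp d f) = f"
  by (rule exI[of _ "(\<lambda>t. int (pdeg t)) ` keys f"]) (auto intro!: sum_hcomp)

lemma hcomp_mult_homogeneous:
  assumes "homogeneous e f"
  shows "hcomp d (f * g) = f * hcomp (d - e) g"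
proof -
  let ?D = "insert (d - e) ((\<lambda>t. int (pdeg t)) ` keys g)"
  have "f * g = (\<Sum>c\<in>?D. f * hcomp c g)"
    using sum_hcomp[of ?D g] by (simp add: sum_distrib_left[symmetric])
  moreover have "keep P (sum h A) = (\<Sum>i\<in>A. keep P (h i))" for P A and h :: "int \<Rightarrow> 'a mpoly"
    by (induction A rule: infinite_finite_induct) (auto simp: keep_add)
  ultimately have "hcomp d (f * g) = (\<Sum>c\<in>?D. hcomp d (f * hcomp c g))" by simp
  also have "\<dots> = (\<Sum>c\<in>?D. if c = d - e then f * hcomp c g else 0)"
  proof (rule sum.cong)
    fix c show "hcomp d (f * hcomp c g) = (if c = d - e then f * hcomp c g else 0)"
      using hcomp_homogeneous[OF homogeneous_mult[OF assms homogeneous_hcomp], of d c g] by auto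
  qed simp
  also have "\<dots> = f * hcomp (d - e) g"
    by (subst sum.delta) auto
  finally show ?thesis .
qed

text \<open>Closure under homogeneous components replaces the existence of homogeneous generators,
  so that each ideal constructed later can be checked elementwise.\<close>

definition graded_ideal :: "nat \<Rightarrow> 'k::comm_ring_1 mpoly set \<Rightarrow> bool" where
  "graded_ideal n A \<longleftrightarrow> A \<subseteq> PR n \<and> 0 \<in> A \<and> (\<forall>f\<in>A. \<forall>g\<in>A. f + g \<in> A) \<and>
     (\<forall>f\<in>A. \<forall>h\<in>PR n. h * f \<in> A) \<and> (\<forall>f\<in>A. \<forall>d. hcomp d f \<in> A)"

lemma graded_idealD:
  assumes "graded_ideal n A"
  shows "f \<in> A \<Longrightarrow> f \<in> PR n" "0 \<in> A" "f \<in> A \<Longrightarrow> g \<in> A \<Longrightarrow> f + g \<in> A"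
    "f \<in> A \<Longrightarrow> h \<in> PR n \<Longrightarrow> h * f \<in> A" "f \<in> A \<Longrightarrow> h \<in> PR n \<Longrightarrow> f * h \<in> A"
    "f \<in> A \<Longrightarrow> hcomp d f \<in> A" "f \<in> A \<Longrightarrow> - f \<in> A" "f \<in> A \<Longrightarrow> g \<in> A \<Longrightarrow> f - g \<in> A"
proof -
  show 1: "f \<in> A \<Longrightarrow> f \<in> PR n" "0 \<in> A" "f \<in> A \<Longrightarrow> g \<in> A \<Longrightarrow> f + g \<in> A"
    "f \<in> A \<Longrightarrow> h \<in> PR n \<Longrightarrow> h * f \<in> A" "f \<in> A \<Longrightarrow> hcomp d f \<in> A" for f g h d
    using assms by (auto simp: graded_ideal_def)
  show "f \<in> A \<Longrightarrow> h \<in> PR n \<Longrightarrow> f * h \<in> A"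
    using 1(4)[of f h] by (simp add: mult.commute)
  show neg: "f \<in> A \<Longrightarrow> - f \<in> A" for f
    using 1(4)[of f "- 1"] by (simp add: PR_uminus)
  show "f \<in> A \<Longrightarrow> g \<in> A \<Longrightarrow> f - g \<in> A"
    using 1(3)[of f "- g"] neg by simp
qed

lemma graded_ideal_PR: "graded_ideal n (PR n)"
  by (auto simp: graded_ideal_def intro: PR_add PR_mult PR_keep)

lemma graded_ideal_zero: "graded_ideal n {0}"
  by (auto simp: graded_ideal_def)

lemma graded_ideal_imp_ideal: "graded_ideal n A \<Longrightarrow> ideal A (poly_ring n)"
proof (rule idealI)
  assume A: "graded_ideal n A"
  interpret cring "poly_ring n :: 'a mpoly ring" by (rule poly_ring_cring)
  show "ring (poly_ring n :: 'a mpoly ring)" by (rule ring_axioms)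
  show "subgroup A (add_monoid (poly_ring n))"
  proof (rule add.subgroupI)
    fix a assume a: "a \<in> A"
    have "\<ominus>\<^bsub>poly_ring n\<^esub> a = - a"
      by (rule minus_equality) (use a A in \<open>auto intro: graded_idealD PR_uminus\<close>)
    then show "\<ominus>\<^bsub>poly_ring n\<^esub> a \<in> A" using a A by (auto intro: graded_idealD)
  qed (use A graded_idealD[OF A] in auto)
qed (auto intro: graded_idealD)

text \<open>The elements of \<open>I\<close> all of whose components lie in \<open>I\<close> form an
  ideal that contains the generators, so they are all of \<open>I\<close>.\<close>

lemma homogeneous_ideal_imp_graded:
  assumes "homogeneous_ideal n (I :: 'k::comm_ring_1 mpoly set)"
  shows "graded_ideal n I"
proof -
  interpret cring "poly_ring n :: 'k mpoly ring" by (rule poly_ring_cring)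
  obtain B where B: "B \<subseteq> PR n" "\<And>f. f \<in> B \<Longrightarrow> \<exists>d. homogeneous d f" and I: "I = Idl\<^bsub>poly_ring n\<^esub> B"
    using assms by (auto simp: homogeneous_ideal_def)
  have id: "ideal I (poly_ring n)" unfolding I by (rule genideal_ideal[OF B(1)])
  interpret I: ideal I "poly_ring n" by (rule id)
  have sub: "I \<subseteq> PR n" by (rule I.a_subset)
  have add: "f + g \<in> I" if "f \<in> I" "g \<in> I" for f g
    using I.a_closed[OF that] by simp
  have mult: "h * f \<in> I" if "f \<in> I" "h \<in> PR n" for f h
    using I.I_l_closed[OF that] by simp
  have zero: "0 \<in> I" using I.zero_closed by simp
  let ?A = "{f \<in> I. \<forall>d. hcomp d f \<in> I}"
  have sumI: "sum h S \<in> I" if "\<And>i. i \<in> S \<Longrightarrow> h i \<in> I" for h :: "int \<Rightarrow> 'k mpoly" and S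
    using that by (induction S rule: infinite_finite_induct) (auto intro: add zero)
  have A_mult: "h * f \<in> ?A" if f: "f \<in> ?A" and h: "h \<in> PR n" for f h
  proof -
    have "hcomp d (h * f) \<in> I" for d
    proof -
      obtain D where D: "finite D" "(\<Sum>e\<in>D. hcomp e h) = h" using ex_sum_hcomp by blast
      have kp: "keep P (sum h A) = (\<Sum>i\<in>A. keep P (h i))" for P A and h :: "int \<Rightarrow> 'k mpoly"
        by (induction A rule: infinite_finite_induct) (auto simp: keep_add)
      have "hcomp d (h * f) = hcomp d (\<Sum>e\<in>D. hcomp e h * f)"
        by (subst D(2)[symmetric]) (simp add: sum_distrib_right)
      also have "\<dots> = (\<Sum>e\<in>D. hcomp e h * hcomp (d - e) f)"
        unfolding kp by (simp add: hcomp_mult_homogeneous[OF homogeneous_hcomp])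
      also have "\<dots> \<in> I" using f h by (intro sumI mult) (auto intro: PR_keep)
      finally show ?thesis .
    qed
    then show ?thesis using f h mult by auto
  qed
  have "graded_ideal n ?A"
    unfolding graded_ideal_def
  proof (intro conjI ballI allI)
    show "?A \<subseteq> PR n" using sub by auto
    show "0 \<in> ?A" by (simp add: zero)
    show "f + g \<in> ?A" if "f \<in> ?A" "g \<in> ?A" for f g
      using that by (auto simp: keep_add intro: add)
    show "h * f \<in> ?A" if "f \<in> ?A" "h \<in> PR n" for f h using A_mult that .
    show "hcomp d f \<in> ?A" if "f \<in> ?A" for f d
      using that by (auto simp: hcomp_homogeneous[OF homogeneous_hcomp] zero)
  qed
  moreover have "B \<subseteq> ?A"
  proof
    fix f assume f: "f \<in> B"
    then have "f \<in> I" using genideal_self[OF B(1)] I by auto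
    moreover obtain d where "homogeneous d f" using B(2) f by blast
    ultimately show "f \<in> ?A" by (auto simp: hcomp_homogeneous zero)
  qed
  ultimately have "I \<subseteq> ?A" unfolding I by (intro genideal_minimal graded_ideal_imp_ideal)
  then have "?A = I" by blast
  with \<open>graded_ideal n ?A\<close> show ?thesis by simp
qed

section \<open>Localisations inside the Laurent polynomials\<close>

type_synonym 'k laurent = "(nat \<Rightarrow>\<^sub>0 int) \<Rightarrow>\<^sub>0 'k"

definition expo :: "pprod \<Rightarrow> (nat \<Rightarrow>\<^sub>0 int)" where
  "expo t = Poly_Mapping.map int t"

lemma lookup_expo: "lookup (expo t) i = int (lookup t i)"
  by (simp add: expo_def Poly_Mapping.map.rep_eq when_def)

lemma expo_add: "expo (s + t) = expo s + expo t"
  by (rule poly_mapping_eqI) (simp add: lookup_expo lookup_add)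

lemma expo_zero [simp]: "expo 0 = 0"
  by (rule poly_mapping_eqI) (simp add: lookup_expo)

lemma expo_eq_iff [simp]: "expo s = expo t \<longleftrightarrow> s = t"
  by (auto simp: poly_mapping_eq_iff fun_eq_iff lookup_expo)

definition laur :: "'k::comm_ring_1 mpoly \<Rightarrow> 'k laurent" where
  "laur f = (\<Sum>t\<in>keys f. single (expo t) (lookup f t))"

lemma lookup_laur [simp]: "lookup (laur f) (expo t) = lookup f t"
  by (auto simp: laur_def lookup_sum lookup_single when_def in_keys_iff)

lemma laur_eq_sum: "finite S \<Longrightarrow> keys f \<subseteq> S \<Longrightarrow>
    laur f = (\<Sum>t\<in>S. single (expo t) (lookup f t))"
  unfolding laur_def by (rule sum.mono_neutral_left) (auto simp: in_keys_iff)

lemma laur_inject [simp]: "laur f = laur g \<longleftrightarrow> f = g"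
  by (metis lookup_laur poly_mapping_eqI)

lemma laur_add: "laur (f + g) = laur f + laur g"
proof -
  let ?S = "keys f \<union> keys g"
  have "keys (f + g) \<subseteq> ?S" by (rule keys_add)
  then show ?thesis
    by (simp add: laur_eq_sum[of ?S] lookup_add single_add sum.distrib)
qed

lemma laur_zero [simp]: "laur 0 = 0"
  by (simp add: laur_def)

lemma laur_sum: "laur (sum f A) = (\<Sum>i\<in>A. laur (f i))"
  by (induction A rule: infinite_finite_induct) (auto simp: laur_add)

lemma laur_single: "laur (single t c) = single (expo t) c"
  by (simp add: laur_def)

lemma laur_mult: "laur (f * g) = laur f * laur g"
proof -
  let ?F = "keys f" and ?G = "keys g"
  have "f * g = (\<Sum>s\<in>?F. \<Sum>t\<in>?G. single (s + t) (lookup f s * lookup g t))"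
    by (subst poly_mapping_sum_single[of ?F f], simp, simp,
        subst poly_mapping_sum_single[of ?G g], simp, simp)
      (simp add: sum_product mult_single)
  then show ?thesis
    by (simp add: laur_sum laur_single expo_add) (simp add: laur_def sum_product mult_single)
qed

lemma laur_one [simp]: "laur 1 = 1"
  using laur_single[of 0 1] by simp

lemma laur_uminus: "laur (- f) = - laur f"
  using laur_add[of f "- f"] by (simp add: eq_neg_iff_add_eq_0 add.commute)

lemma laur_power: "laur (f ^ k) = laur f ^ k"
  by (induction k) (simp_all add: laur_mult)

text \<open>The monomial \<open>x_S^k\<close> with a possibly negative exponent. It is a unit, so
  that division by \<open>x_S\<close> is a multiplication.\<close>

definition xs :: "nat set \<Rightarrow> int \<Rightarrow> 'k::comm_ring_1 laurent" where
  "xs S k = single (\<Sum>i\<in>S. single i k) 1"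

lemma xs_mult: "xs S k * xs S l = xs S (k + l)"
  by (simp add: xs_def mult_single single_add sum.distrib)

lemma xs_zero [simp]: "xs S 0 = 1"
  by (simp add: xs_def)

lemma xs_empty [simp]: "xs {} k = 1"
  by (simp add: xs_def)

lemma xs_cancel [simp]: "xs S (- k) * (xs S k * y) = y" "xs S k * (xs S (- k) * y) = y"
  by (simp_all add: mult.assoc[symmetric] xs_mult)

lemma xs_insert: "finite S \<Longrightarrow> i \<notin> S \<Longrightarrow> xs (insert i S) k = xs {i} k * xs S k"
  by (simp add: xs_def mult_single)

lemma laur_pvar_power: "laur (pvar i ^ k) = xs {i} (int k)"
proof -
  have "expo (single i 1) = single i 1"
    by (rule poly_mapping_eqI) (auto simp: lookup_expo lookup_single when_def)
  then have 1: "laur (pvar i) = xs {i} 1"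
    by (simp add: pvar_def laur_single xs_def)
  have "(xs {i} 1 :: 'a laurent) ^ k = xs {i} (int k)"
    by (induction k) (simp_all add: xs_mult)
  then show ?thesis by (simp add: laur_power 1)
qed

lemma laur_xprod_power: "finite S \<Longrightarrow> laur (xprod S ^ k) = xs S (int k)"
proof (induction S rule: finite_induct)
  case (insert i S)
  then show ?case
    by (simp add: xprod_def power_mult_distrib laur_mult xs_insert[OF insert.hyps] laur_pvar_power)
qed (simp add: xprod_def)

lemma PR_xprod: "S \<subseteq> {1..n} \<Longrightarrow> xprod S \<in> PR n"
  unfolding xprod_def by (intro PR_prod PR_pvar) auto

lemma homogeneous_xprod: "finite S \<Longrightarrow> homogeneous (int (card S)) (xprod S)"
proof (induction S rule: finite_induct)
  case (insert i S)
  then show ?case using homogeneous_mult[OF homogeneous_pvar[of i] insert.IH] by (simp add: xprod_def)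
qed (simp add: xprod_def)

lemma homogeneous_xprod_power: "finite S \<Longrightarrow> homogeneous (int k * int (card S)) (xprod S ^ k)"
  using homogeneous_power[OF homogeneous_xprod, of S k] by (simp add: mult.commute)

text \<open>The degree \<open>r\<close> part of the localisation at \<open>x_S\<close>. Ideals are
  torsion free, so their localisations embed in the Laurent polynomials, and those of a quotient
  \<open>A / B\<close> are quotients of two such groups.\<close>

definition loc :: "'k::comm_ring_1 mpoly set \<Rightarrow> nat set \<Rightarrow> int \<Rightarrow> 'k laurent set" where
  "loc A S r = {xs S (- int s) * laur a | a s. a \<in> A \<and> homogeneous (r + int s * int (card S)) a}"

lemma locE:
  assumes "y \<in> loc A S r"
  obtains a s where "a \<in> A" "homogeneous (r + int s * int (card S)) a" "y = xs S (- int s) * laur a"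
  using assms by (auto simp: loc_def)

lemma locI: "a \<in> A \<Longrightarrow> homogeneous (r + int s * int (card S)) a \<Longrightarrow> xs S (- int s) * laur a \<in> loc A S r"
  by (auto simp: loc_def)

text \<open>Multiplying numerator and denominator by powers of \<open>x_S\<close> makes every large
  exponent available. This provides common denominators as well as numerators of high
  degree.\<close>

lemma loc_raise:
  assumes A: "graded_ideal n A" and S: "S \<subseteq> {1..n}" and "y \<in> loc A S r"
  shows "\<exists>s0. \<forall>s\<ge>s0. \<exists>a\<in>A. homogeneous (r + int s * int (card S)) a \<and> y = xs S (- int s) * laur a"
proof -
  have fin: "finite S" using S finite_subset by blast
  obtain a s0 where a: "a \<in> A" "homogeneous (r + int s0 * int (card S)) a" "y = xs S (- int s0) * laur a"
    using assms(3) by (rule locE)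
  show ?thesis
  proof (intro exI allI impI)
    fix s assume "s0 \<le> s"
    then obtain k where s: "s = s0 + k" using le_Suc_ex[of s0 s] by blast
    have "xprod S ^ k * a \<in> A" using A a(1) S by (intro graded_idealD(4)[OF A] PR_power PR_xprod)
    moreover have "homogeneous (r + int s * int (card S)) (xprod S ^ k * a)"
      using homogeneous_mult[OF homogeneous_xprod_power[OF fin] a(2), of k] by (simp add: s algebra_simps)
    moreover have "y = xs S (- int s) * laur (xprod S ^ k * a)"
      using fin by (simp add: laur_mult laur_xprod_power a(3) s mult.assoc[symmetric] xs_mult)
    ultimately show "\<exists>a\<in>A. homogeneous (r + int s * int (card S)) a \<and> y = xs S (- int s) * laur a" by blast
  qed
qed

lemma loc_zero: "graded_ideal n A \<Longrightarrow> 0 \<in> loc A S r"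
  using locI[of 0 A r 0 S] by (simp add: graded_idealD(2))

lemma loc_add:
  assumes A: "graded_ideal n A" and S: "S \<subseteq> {1..n}" and y: "y \<in> loc A S r" and z: "z \<in> loc A S r"
  shows "y + z \<in> loc A S r"
proof -
  obtain s0 where 1: "\<And>s. s \<ge> s0 \<Longrightarrow> \<exists>a\<in>A. homogeneous (r + int s * int (card S)) a \<and> y = xs S (- int s) * laur a"
    using loc_raise[OF A S y] by blast
  obtain s1 where 2: "\<And>s. s \<ge> s1 \<Longrightarrow> \<exists>a\<in>A. homogeneous (r + int s * int (card S)) a \<and> z = xs S (- int s) * laur a"
    using loc_raise[OF A S z] by blast
  obtain a b where "a \<in> A" "b \<in> A" "homogeneous (r + int (max s0 s1) * int (card S)) a"
    "homogeneous (r + int (max s0 s1) * int (card S)) b"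
    "y = xs S (- int (max s0 s1)) * laur a" "z = xs S (- int (max s0 s1)) * laur b"
    using 1[of "max s0 s1"] 2[of "max s0 s1"] by auto
  then show ?thesis
    using locI[of "a + b" A r "max s0 s1" S] graded_idealD(3)[OF A]
    by (simp add: homogeneous_add laur_add distrib_left)
qed

text \<open>The source and target ideals may differ, so that multiplication by \<open>l\<close> can
  lead from \<open>R\<close> into \<open>(B, l)\<close>.\<close>

lemma loc_mult_ideal:
  assumes y: "y \<in> loc B S r" and f: "homogeneous q f" and BA: "\<And>b. b \<in> B \<Longrightarrow> f * b \<in> A"
  shows "laur f * y \<in> loc A S (r + q)"
proof -
  obtain b s where b: "b \<in> B" "homogeneous (r + int s * int (card S)) b" "y = xs S (- int s) * laur b"
    using y by (rule locE)
  have "homogeneous (r + q + int s * int (card S)) (f * b)"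
    using homogeneous_mult[OF f b(2)] by (simp add: algebra_simps)
  from locI[OF BA[OF b(1)] this] show ?thesis
    by (simp add: b(3) laur_mult algebra_simps)
qed

lemma loc_mult:
  "graded_ideal n A \<Longrightarrow> y \<in> loc A S r \<Longrightarrow> f \<in> PR n \<Longrightarrow> homogeneous q f \<Longrightarrow> laur f * y \<in> loc A S (r + q)"
  by (rule loc_mult_ideal) (auto intro: graded_idealD)

lemma loc_uminus: "graded_ideal n A \<Longrightarrow> y \<in> loc A S r \<Longrightarrow> - y \<in> loc A S r"
  using loc_mult[of n A y S r "- 1" 0] by (simp add: laur_uminus PR_uminus homogeneous_uminus)

lemma loc_diff:
  "graded_ideal n A \<Longrightarrow> S \<subseteq> {1..n} \<Longrightarrow> y \<in> loc A S r \<Longrightarrow> z \<in> loc A S r \<Longrightarrow> y - z \<in> loc A S r"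
  using loc_add[of n A S y r "- z"] loc_uminus[of n A z S r] by simp

lemma loc_sum:
  "graded_ideal n A \<Longrightarrow> S \<subseteq> {1..n} \<Longrightarrow> (\<And>i. i \<in> F \<Longrightarrow> f i \<in> loc A S r) \<Longrightarrow> sum f F \<in> loc A S r"
  by (induction F rule: infinite_finite_induct) (simp_all add: loc_add loc_zero)

lemma loc_mono: "A \<subseteq> B \<Longrightarrow> loc A S r \<subseteq> loc B S r"
  by (auto simp: loc_def)

lemma loc_insert:
  assumes A: "graded_ideal n A" and S: "S \<subseteq> {1..n}" and i: "i \<in> {1..n}" and y: "y \<in> loc A S r"
  shows "y \<in> loc A (insert i S) r"
proof (cases "i \<in> S")
  case False
  have fin: "finite S" using S finite_subset by blast
  obtain a s where a: "a \<in> A" "homogeneous (r + int s * int (card S)) a" "y = xs S (- int s) * laur a"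
    using y by (rule locE)
  have "pvar i ^ s * a \<in> A" by (intro graded_idealD(4)[OF A] a PR_power PR_pvar i)
  moreover have "homogeneous (r + int s * int (card (insert i S))) (pvar i ^ s * a)"
    using homogeneous_mult[OF homogeneous_power[OF homogeneous_pvar[of i], of s] a(2)] fin False
    by (simp add: algebra_simps)
  moreover have "xs (insert i S) (- int s) * laur (pvar i ^ s * a) = y"
    by (simp add: xs_insert[OF fin False] laur_mult laur_pvar_power a(3) mult.assoc mult.left_commute[of "xs S _"])
  ultimately show ?thesis using locI by metis
qed (use y in \<open>simp add: insert_absorb\<close>)

text \<open>Stated for all large \<open>N\<close>, because one power of \<open>x_i\<close> will have
  to serve finitely many index sets at once.\<close>

lemma loc_insert_clear:
  assumes A: "graded_ideal n A" and S: "insert i S \<subseteq> {1..n}" and y: "y \<in> loc A (insert i S) r"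
  shows "\<forall>\<^sub>F N in sequentially. laur (pvar i ^ N) * y \<in> loc A S (r + int N)"
proof (cases "i \<in> S")
  case True
  then have "y \<in> loc A S r" "i \<in> {1..n}" using y S by (auto simp: insert_absorb)
  then show ?thesis using homogeneous_power[OF homogeneous_pvar[of i]]
    by (intro always_eventually allI loc_mult[OF A] PR_power PR_pvar) auto
next
  case False
  have fin: "finite S" by (rule finite_subset[of _ "{1..n}"]) (use S in auto)
  obtain a s where a: "a \<in> A" "homogeneous (r + int s * int (card (insert i S))) a"
    "y = xs (insert i S) (- int s) * laur a" using y by (rule locE)
  have "laur (pvar i ^ N) * y \<in> loc A S (r + int N)" if le: "s \<le> N" for N
  proof -
    obtain k where N: "N = s + k" using le_Suc_ex[OF le] by blast
    have "pvar i ^ k * a \<in> A" using S by (intro graded_idealD(4)[OF A] a PR_power PR_pvar) auto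
    moreover have "homogeneous (r + int N + int s * int (card S)) (pvar i ^ k * a)"
      using homogeneous_mult[OF homogeneous_power[OF homogeneous_pvar[of i], of k] a(2)] fin False
      by (simp add: algebra_simps N)
    moreover have "xs S (- int s) * laur (pvar i ^ k * a) = laur (pvar i ^ N) * y"
      unfolding N power_add
      by (simp add: xs_insert[OF fin False] laur_mult laur_pvar_power a(3) algebra_simps)
         (simp add: mult.assoc[symmetric] xs_mult)
    ultimately show ?thesis using locI by metis
  qed
  then show ?thesis by (auto simp: eventually_sequentially)
qed

lemma loc_empty_iff: "y \<in> loc A {} r \<longleftrightarrow> (\<exists>a\<in>A. homogeneous r a \<and> y = laur a)"
  by (auto simp: loc_def)

lemma loc_zero_ideal: "y \<in> loc {0} S r \<longleftrightarrow> y = 0"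
  by (auto simp: loc_def)

section \<open>The Cech complex\<close>

text \<open>Also used for \<open>i\<close> outside \<open>T\<close>, where it is the sign of
  inserting \<open>i\<close>.\<close>

definition csgn :: "nat \<Rightarrow> nat set \<Rightarrow> 'k::comm_ring_1 laurent" where
  "csgn i T = (- 1) ^ card {j \<in> T. j < i}"

definition cdiff :: "(nat set \<Rightarrow> 'k::comm_ring_1 laurent) \<Rightarrow> nat set \<Rightarrow> 'k laurent" where
  "cdiff c T = (\<Sum>i\<in>T. csgn i T * c (T - {i}))"

lemma csgn_insert:
  assumes "finite T" "m \<notin> T"
  shows "csgn i (insert m T) = (if m < i then - csgn i T else csgn i T)"
proof -
  have "{j \<in> insert m T. j < i} = (if m < i then insert m {j \<in> T. j < i} else {j \<in> T. j < i})" by auto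
  then show ?thesis using assms by (simp add: csgn_def)
qed

lemma csgn_remove:
  assumes "finite T" "m \<in> T"
  shows "csgn i (T - {m}) = (if m < i then - csgn i T else csgn i T :: 'a::comm_ring_1 laurent)"
  using csgn_insert[of "T - {m}" m i, where ?'a = 'a] assms by (auto simp: insert_absorb)

lemma csgn_square [simp]: "csgn i T * csgn i T = 1" "csgn i T * (csgn i T * y) = y"
proof -
  show sq: "csgn i T * csgn i T = 1" by (simp add: csgn_def power_mult_distrib[symmetric])
  show "csgn i T * (csgn i T * y) = y" by (subst mult.assoc[symmetric]) (simp only: sq mult_1)
qed

lemma csgn_self_insert: "csgn m (insert m T) = csgn m T" and csgn_self_remove: "csgn m (T - {m}) = csgn m T"
  unfolding csgn_def by (rule arg_cong[where f = "\<lambda>A. (- 1) ^ card A"]; auto)+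

lemma cdiff_add: "cdiff (\<lambda>S. c S + e S) T = cdiff c T + cdiff e T"
  by (simp add: cdiff_def distrib_left sum.distrib)

lemma cdiff_diff: "cdiff (\<lambda>S. c S - e S) T = cdiff c T - cdiff e T"
  by (simp add: cdiff_def right_diff_distrib sum_subtractf)

lemma cdiff_mult: "cdiff (\<lambda>S. y * c S) T = y * cdiff c T"
  by (simp add: cdiff_def sum_distrib_left mult.left_commute)

lemma cdiff_zero [simp]: "cdiff (\<lambda>S. 0) T = 0"
  by (simp add: cdiff_def)

text \<open>Removing two elements in the two possible orders gives opposite signs, so the double sum
  equals its own negative; in characteristic 0 it is then zero.\<close>

lemma cdiff_cdiff:
  fixes c :: "nat set \<Rightarrow> 'k::field_char_0 laurent"
  assumes T: "finite T"
  shows "cdiff (cdiff c) T = 0"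
proof -
  \<comment> \<open>Zero on the diagonal, so that the sum can run over the full square
    \<open>T x T\<close>, where the indices may be swapped.\<close>
  define g where "g i j = (if i = j then 0 else csgn i T * (csgn j (T - {i}) * c (T - {i} - {j})))" for i j
  have anti: "g i j = - g j i" if "i \<in> T" "j \<in> T" for i j
  proof (cases "i = j")
    case False
    have "csgn i T * csgn j (T - {i}) = - (csgn j T * csgn i (T - {j}) :: 'k laurent)"
      using False by (cases "i < j") (simp_all add: csgn_remove[OF T that(1)] csgn_remove[OF T that(2)] mult.commute)
    moreover have "T - {i} - {j} = T - {j} - {i}" by auto
    ultimately have "csgn i T * csgn j (T - {i}) * c (T - {i} - {j}) = - (csgn j T * csgn i (T - {j}) * c (T - {j} - {i}))"
      by simp
    then show ?thesis using False by (simp add: g_def mult.assoc)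
  qed (simp add: g_def)
  have "cdiff (cdiff c) T = (\<Sum>i\<in>T. \<Sum>j\<in>T - {i}. g i j)"
    unfolding cdiff_def sum_distrib_left by (intro sum.cong) (auto simp: g_def)
  also have "\<dots> = (\<Sum>i\<in>T. \<Sum>j\<in>T. g i j)"
    by (intro sum.cong sum.mono_neutral_left) (use T in \<open>auto simp: g_def\<close>)
  finally have 1: "cdiff (cdiff c) T = (\<Sum>i\<in>T. \<Sum>j\<in>T. g i j)" .
  also have "\<dots> = (\<Sum>i\<in>T. \<Sum>j\<in>T. - g j i)"
    by (intro sum.cong refl anti) auto
  also have "\<dots> = - (\<Sum>j\<in>T. \<Sum>i\<in>T. g j i)"
    by (subst sum.swap) (simp add: sum_negf)
  finally have neg: "cdiff (cdiff c) T = - cdiff (cdiff c) T" by (simp only: 1)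
  show ?thesis
  proof (rule poly_mapping_eqI)
    fix k
    show "lookup (cdiff (cdiff c) T) k = lookup 0 k"
      using arg_cong[OF neg, of "\<lambda>f. lookup f k"] by simp
  qed
qed

text \<open>The contraction towards \<open>x_m\<close>. The value \<open>c (insert m S)\<close> may
  have \<open>x_m\<close> in its denominator, so the result is a cochain of the Cech complex only
  after multiplication by a power of \<open>x_m\<close>.\<close>

definition chtpy :: "nat \<Rightarrow> (nat set \<Rightarrow> 'k::comm_ring_1 laurent) \<Rightarrow> nat set \<Rightarrow> 'k laurent" where
  "chtpy m c S = (if m \<in> S then 0 else csgn m S * c (insert m S))"

text \<open>If \<open>m\<close> lies in \<open>T\<close>, only the summand that removes
  \<open>m\<close> survives. Otherwise inserting and then removing \<open>m\<close> gives
  \<open>c T\<close>, and the remaining summands cancel in pairs.\<close>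

lemma cdiff_chtpy:
  assumes T: "finite T"
  shows "cdiff (chtpy m c) T + chtpy m (cdiff c) T = c T"
proof (cases "m \<in> T")
  case True
  have "cdiff (chtpy m c) T = (\<Sum>i\<in>T. if i = m then c T else 0)"
    unfolding cdiff_def
  proof (rule sum.cong)
    fix i assume "i \<in> T"
    then show "csgn i T * chtpy m c (T - {i}) = (if i = m then c T else 0)"
      using True by (auto simp: chtpy_def csgn_self_remove insert_absorb)
  qed simp
  then show ?thesis using True T by (simp add: chtpy_def)
next
  case False
  have "csgn m T * (csgn i (insert m T) * c (insert m T - {i})) = - (csgn i T * chtpy m c (T - {i}))" if i: "i \<in> T" for i
  proof -
    have "csgn m T * csgn i (insert m T) = - (csgn i T * csgn m (T - {i}) :: 'a laurent)"
      using i False by (cases m i rule: linorder_cases)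
        (auto simp: csgn_remove[OF T i] csgn_insert[OF T False] mult.commute)
    then have "csgn m T * csgn i (insert m T) * c (insert m T - {i}) = - (csgn i T * csgn m (T - {i}) * c (insert m T - {i}))"
      by simp
    moreover have "insert m T - {i} = insert m (T - {i})" using i False by auto
    ultimately show ?thesis using False i by (simp add: chtpy_def mult.assoc)
  qed
  then have "(\<Sum>i\<in>T. csgn m T * (csgn i (insert m T) * c (insert m T - {i}))) = - cdiff (chtpy m c) T"
    by (simp add: cdiff_def sum_negf)
  moreover have "chtpy m (cdiff c) T = c T + (\<Sum>i\<in>T. csgn m T * (csgn i (insert m T) * c (insert m T - {i})))"
    using False T
    by (simp add: chtpy_def cdiff_def[of c] csgn_self_insert distrib_left sum_distrib_left)
  ultimately show ?thesis by simp
qed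

text \<open>A cochain is a total function of which only the values on \<open>cech_idx n p\<close>
  are constrained. Hence \<open>cdiff\<close> carries no degree index, and cochains are compared by
  membership of a difference.\<close>

definition cochains :: "nat \<Rightarrow> 'k::comm_ring_1 mpoly set \<Rightarrow> nat \<Rightarrow> int \<Rightarrow> (nat set \<Rightarrow> 'k laurent) set" where
  "cochains n A p r = {c. \<forall>S\<in>cech_idx n p. c S \<in> loc A S r}"

definition cobounds :: "nat \<Rightarrow> 'k::comm_ring_1 mpoly set \<Rightarrow> nat \<Rightarrow> int \<Rightarrow> (nat set \<Rightarrow> 'k laurent) set" where
  "cobounds n A p r = (case p of 0 \<Rightarrow> {\<lambda>S. 0} | Suc q \<Rightarrow> cdiff ` cochains n A q r)"

text \<open>The vanishing of the degree \<open>r\<close> part of the \<open>p\<close>-th local cohomology of the quotient \<open>A / B\<close>.\<close>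

definition vanish :: "nat \<Rightarrow> 'k::comm_ring_1 mpoly set \<Rightarrow> 'k mpoly set \<Rightarrow> nat \<Rightarrow> int \<Rightarrow> bool" where
  "vanish n A B p r \<longleftrightarrow> (\<forall>z\<in>cochains n A p r. cdiff z \<in> cochains n B (Suc p) r \<longrightarrow>
     (\<exists>w\<in>cobounds n A p r. (\<lambda>S. z S - w S) \<in> cochains n B p r))"

lemma cech_idxD: "S \<in> cech_idx n p \<Longrightarrow> S \<subseteq> {1..n} \<and> finite S \<and> card S = p"
  by (auto simp: cech_idx_def intro: finite_subset[OF _ finite_atLeastAtMost])

lemma finite_cech_idx: "finite (cech_idx n p)"
  by (rule finite_subset[of _ "Pow {1..n}"]) (auto simp: cech_idx_def)

lemma cech_idx_0 [simp]: "cech_idx n 0 = {{}}"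
proof -
  have "S = {}" if "S \<in> cech_idx n 0" for S using cech_idxD[OF that] by auto
  then show ?thesis by (auto simp: cech_idx_def)
qed

lemma cech_idx_remove: "T \<in> cech_idx n (Suc p) \<Longrightarrow> i \<in> T \<Longrightarrow> T - {i} \<in> cech_idx n p"
  unfolding cech_idx_def mem_Collect_eq by (metis Diff_subset subset_trans card_Diff_singleton diff_Suc_1)

lemma cech_idx_insert: "S \<in> cech_idx n p \<Longrightarrow> i \<in> {1..n} \<Longrightarrow> i \<notin> S \<Longrightarrow> insert i S \<in> cech_idx n (Suc p)"
  using cech_idxD[of S n p] unfolding cech_idx_def mem_Collect_eq by (metis card_insert_disjoint insert_subset)

context
  fixes n :: nat and A :: "'k::field_char_0 mpoly set"
  assumes A: "graded_ideal n A"
begin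

lemma cochains_zero: "(\<lambda>S. 0) \<in> cochains n A p r"
  by (simp add: cochains_def loc_zero[OF A])

lemma cochains_add: "c \<in> cochains n A p r \<Longrightarrow> e \<in> cochains n A p r \<Longrightarrow> (\<lambda>S. c S + e S) \<in> cochains n A p r"
  by (auto simp: cochains_def intro!: loc_add[OF A] dest: cech_idxD)

lemma cochains_diff: "c \<in> cochains n A p r \<Longrightarrow> e \<in> cochains n A p r \<Longrightarrow> (\<lambda>S. c S - e S) \<in> cochains n A p r"
  by (auto simp: cochains_def intro!: loc_diff[OF A] dest: cech_idxD)

lemma cochains_mult:
  "c \<in> cochains n A p r \<Longrightarrow> f \<in> PR n \<Longrightarrow> homogeneous q f \<Longrightarrow> (\<lambda>S. laur f * c S) \<in> cochains n A p (r + q)"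
  by (auto simp: cochains_def intro: loc_mult[OF A])

lemma cochains_cdiff:
  assumes c: "c \<in> cochains n A p r"
  shows "cdiff c \<in> cochains n A (Suc p) r"
  unfolding cochains_def
proof (intro CollectI ballI)
  fix T assume T: "T \<in> cech_idx n (Suc p)"
  show "cdiff c T \<in> loc A T r"
    unfolding cdiff_def
  proof (rule loc_sum[OF A])
    fix i assume i: "i \<in> T"
    have "c (T - {i}) \<in> loc A (T - {i}) r" using c cech_idx_remove[OF T i] by (auto simp: cochains_def)
    then have "c (T - {i}) \<in> loc A (insert i (T - {i})) r"
      using cech_idxD[OF T] i by (intro loc_insert[OF A]) auto
    then have "c (T - {i}) \<in> loc A T r" using i by (simp add: insert_absorb)
    moreover have "csgn i T = (1 :: 'k laurent) \<or> csgn i T = (- 1 :: 'k laurent)"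
      unfolding csgn_def by (cases "even (card {j \<in> T. j < i})") auto
    ultimately show "csgn i T * c (T - {i}) \<in> loc A T r" using loc_uminus[OF A] by auto
  qed (use cech_idxD[OF T] in auto)
qed

lemma cobounds_sub: "w \<in> cobounds n A p r \<Longrightarrow> w \<in> cochains n A p r"
  by (auto simp: cobounds_def cochains_zero cochains_cdiff split: nat.splits)

lemma cobounds_zero: "(\<lambda>S. 0) \<in> cobounds n A p r"
  using cochains_zero cdiff_zero by (force simp: cobounds_def fun_eq_iff image_iff split: nat.splits)

lemma cobounds_add: "v \<in> cobounds n A p r \<Longrightarrow> w \<in> cobounds n A p r \<Longrightarrow> (\<lambda>S. v S + w S) \<in> cobounds n A p r"
proof (cases p)
  case (Suc q)
  assume "v \<in> cobounds n A p r" "w \<in> cobounds n A p r"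
  then obtain c e where "v = cdiff c" "w = cdiff e" "c \<in> cochains n A q r" "e \<in> cochains n A q r"
    by (auto simp: cobounds_def Suc)
  then show ?thesis unfolding cobounds_def Suc
    by (auto intro!: image_eqI[OF _ cochains_add] ext simp: cdiff_add)
qed (simp add: cobounds_def)

lemma cobounds_mult:
  "w \<in> cobounds n A p r \<Longrightarrow> f \<in> PR n \<Longrightarrow> homogeneous q f \<Longrightarrow> (\<lambda>S. laur f * w S) \<in> cobounds n A p (r + q)"
proof (cases p)
  case (Suc q')
  assume f: "f \<in> PR n" "homogeneous q f" and "w \<in> cobounds n A p r" 
  then obtain c where "w = cdiff c" "c \<in> cochains n A q' r"
    by (auto simp: cobounds_def Suc)
  then show ?thesis unfolding cobounds_def Suc using f
    by (auto intro!: image_eqI[OF _ cochains_mult] ext simp: cdiff_mult)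
qed (simp add: cobounds_def)

end

lemma cochains_mono: "A \<subseteq> B \<Longrightarrow> cochains n A p r \<subseteq> cochains n B p r"
  using loc_mono[of A B] unfolding cochains_def by blast

lemma cdiff_cobounds:
  fixes w :: "nat set \<Rightarrow> 'k::field_char_0 laurent"
  assumes "w \<in> cobounds n A p r" "finite T"
  shows "cdiff w T = 0"
  using assms by (auto simp: cobounds_def cdiff_cdiff split: nat.splits)

lemma cochains_cong: "(\<And>S. S \<in> cech_idx n p \<Longrightarrow> c S = e S) \<Longrightarrow> c \<in> cochains n A p r \<longleftrightarrow> e \<in> cochains n A p r"
  by (simp add: cochains_def)

section \<open>Filter-regular linear forms\<close>

lemma pvar_power: "pvar i ^ k = mono (single i k)"
  by (induction k) (simp_all add: pvar_def mult_single single_add[symmetric])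

lemma pprod_divides_power:
  fixes t :: pprod
  assumes "N \<le> lookup t i"
  shows "\<exists>u. t = single i N + u"
proof
  show "t = single i N + (t - single i N)"
    using assms by (intro poly_mapping_eqI) (auto simp: lookup_add lookup_minus lookup_single when_def)
qed

context
  fixes n :: nat and B :: "'k::field_char_0 mpoly set"
  assumes B: "graded_ideal n B"
begin

text \<open>The homotopy on the localisations at \<open>x\<^sub>i\<close>, with denominators cleared.\<close>

lemma torsion_pvar:
  assumes z: "z \<in> cochains n (PR n) p r" and dz: "cdiff z \<in> cochains n B (Suc p) r" and i: "i \<in> {1..n}"
  shows "\<forall>\<^sub>F N in sequentially. \<exists>w\<in>cobounds n (PR n) p (r + int N).
    (\<lambda>S. laur (pvar i ^ N) * z S - w S) \<in> cochains n B p (r + int N)"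
proof -
  \<comment> \<open>Needed twice: over \<open>R\<close> it yields the coboundary, over
    \<open>B\<close> the remainder.\<close>
  have chtpy_ev: "\<forall>\<^sub>F N in sequentially. (\<lambda>S. laur (pvar i ^ N) * chtpy i c S) \<in> cochains n A q (r + int N)"
    if c: "c \<in> cochains n A (Suc q) r" and A: "graded_ideal n A" for c q and A :: "'k mpoly set"
  proof -
    have "\<forall>S\<in>cech_idx n q. \<forall>\<^sub>F N in sequentially. laur (pvar i ^ N) * chtpy i c S \<in> loc A S (r + int N)"
    proof
      fix S assume S: "S \<in> cech_idx n q"
      show "\<forall>\<^sub>F N in sequentially. laur (pvar i ^ N) * chtpy i c S \<in> loc A S (r + int N)"
      proof (cases "i \<in> S")
        case True
        then show ?thesis by (simp add: chtpy_def loc_zero[OF A])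
      next
        case False
        have "c (insert i S) \<in> loc A (insert i S) r"
          using c cech_idx_insert[OF S i False] by (auto simp: cochains_def)
        moreover have "csgn i S = (1 :: 'k laurent) \<or> csgn i S = (- 1 :: 'k laurent)"
          unfolding csgn_def by (cases "even (card {j \<in> S. j < i})") auto
        ultimately have "chtpy i c S \<in> loc A (insert i S) r"
          using False loc_uminus[OF A] by (auto simp: chtpy_def)
        then show ?thesis using cech_idxD[OF S] i by (intro loc_insert_clear[OF A]) auto
      qed
    qed
    then have "\<forall>\<^sub>F N in sequentially. \<forall>S\<in>cech_idx n q. laur (pvar i ^ N) * chtpy i c S \<in> loc A S (r + int N)"
      by (intro eventually_ball_finite finite_cech_idx) auto
    then show ?thesis by eventually_elim (auto simp: cochains_def)
  qed
  have eq: "z S = cdiff (chtpy i z) S + chtpy i (cdiff z) S" if "S \<in> cech_idx n p" for S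
    using cdiff_chtpy[of S i z] cech_idxD[OF that] by simp
  \<comment> \<open>For \<open>p = 0\<close> the only index set is empty and \<open>cdiff\<close> is
    an empty sum there, which matches the convention in \<open>cobounds\<close>.\<close>
  define w where "w N = (case p of 0 \<Rightarrow> \<lambda>S. 0 | Suc q \<Rightarrow> cdiff (\<lambda>S. laur (pvar i ^ N) * chtpy i z S))" for N
  have w_eq: "w N S = laur (pvar i ^ N) * cdiff (chtpy i z) S" if "S \<in> cech_idx n p" for N S
    using that by (cases p) (auto simp: w_def cdiff_mult, simp add: cdiff_def)
  have ev: "\<forall>\<^sub>F N in sequentially. w N \<in> cobounds n (PR n) p (r + int N)"
  proof (cases p)
    case (Suc q)
    show ?thesis using chtpy_ev[OF z[unfolded Suc] graded_ideal_PR]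
      unfolding Suc cobounds_def w_def by eventually_elim auto
  qed (simp add: cobounds_def w_def)
  show ?thesis using ev chtpy_ev[OF dz B]
  proof eventually_elim
    case (elim N)
    have "(\<lambda>S. laur (pvar i ^ N) * z S - w N S) \<in> cochains n B p (r + int N)"
      by (subst cochains_cong[where e = "\<lambda>S. laur (pvar i ^ N) * chtpy i (cdiff z) S"])
         (use elim(2) in \<open>auto simp: eq w_eq distrib_left\<close>)
    then show ?case using elim(1) by blast
  qed
qed

text \<open>Local cohomology is torsion for the irrelevant ideal: a common power of each variable
  kills the class, and a monomial of large degree is divisible by one of these powers.\<close>

lemma torsion:
  assumes z: "z \<in> cochains n (PR n) p r" and dz: "cdiff z \<in> cochains n B (Suc p) r"
  shows "\<exists>N. \<forall>q>N. \<forall>f\<in>PR n. homogeneous q f \<longrightarrow> (\<exists>w\<in>cobounds n (PR n) p (r + q).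
    (\<lambda>S. laur f * z S - w S) \<in> cochains n B p (r + q))"
proof -
  define K where "K q f \<longleftrightarrow> (\<exists>w\<in>cobounds n (PR n) p (r + q).
    (\<lambda>S. laur f * z S - w S) \<in> cochains n B p (r + q))" for q and f :: "'k mpoly"
  have K_add: "K q (f + g)" if "K q f" "K q g" for q f g
  proof -
    obtain v w where "v \<in> cobounds n (PR n) p (r + q)" "w \<in> cobounds n (PR n) p (r + q)"
      "(\<lambda>S. laur f * z S - v S) \<in> cochains n B p (r + q)" "(\<lambda>S. laur g * z S - w S) \<in> cochains n B p (r + q)"
      using \<open>K q f\<close> \<open>K q g\<close> by (auto simp: K_def)
    then show ?thesis unfolding K_def
      using cochains_add[OF B] by (intro bexI[OF _ cobounds_add[OF graded_ideal_PR]])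
        (fastforce simp: laur_add algebra_simps)+
  qed
  have K_0: "K q 0" for q
    unfolding K_def using cobounds_zero[OF graded_ideal_PR] cochains_zero[OF B] by (intro bexI) auto
  have K_mult: "K (q + e) (h * f)" if "K q f" "h \<in> PR n" "homogeneous e h" for q e f h
  proof -
    obtain v where v: "v \<in> cobounds n (PR n) p (r + q)" "(\<lambda>S. laur f * z S - v S) \<in> cochains n B p (r + q)"
      using \<open>K q f\<close> by (auto simp: K_def)
    show ?thesis unfolding K_def
    proof (rule bexI)
      show "(\<lambda>S. laur h * v S) \<in> cobounds n (PR n) p (r + (q + e))"
        using cobounds_mult[OF graded_ideal_PR v(1) that(2,3)] by (simp add: add.assoc)
      show "(\<lambda>S. laur (h * f) * z S - laur h * v S) \<in> cochains n B p (r + (q + e))"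
        using cochains_mult[OF B v(2) that(2,3)] by (simp add: add.assoc laur_mult algebra_simps)
    qed
  qed
  have "\<forall>\<^sub>F N in sequentially. \<forall>i\<in>{1..n}. K (int N) (pvar i ^ N)"
    using torsion_pvar[OF z dz] unfolding K_def by (intro eventually_ball_finite) auto
  then obtain N where N: "\<And>i. i \<in> {1..n} \<Longrightarrow> K (int N) (pvar i ^ N)"
    unfolding eventually_sequentially by blast
  show ?thesis
  \<comment> \<open>A monomial in \<open>n\<close> variables all of whose exponents are at most
    \<open>N\<close> has degree at most \<open>n * N\<close>.\<close>
  proof (intro exI[of _ "int (n * N)"] allI impI ballI)
    fix q and f :: "'k mpoly" assume q: "int (n * N) < q" and f: "f \<in> PR n" "homogeneous q f"
    have "K q (single t c)" if t: "t \<in> keys f" for t c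
    proof -
      have tn: "t \<in> pprods n" using f t by (auto simp: PR_iff)
      have td: "int (pdeg t) = q" using f t by (auto simp: homogeneous_def)
      have "\<exists>i\<in>{1..n}. N \<le> lookup t i"
      proof (rule ccontr)
        assume "\<not> ?thesis"
        then have "\<forall>i\<in>{1..n}. lookup t i \<le> N" by force
        then have "(\<Sum>i\<in>{1..n}. lookup t i) \<le> n * N"
          using sum_bounded_above[of "{1..n}" "lookup t" N] by simp
        then have "pdeg t \<le> n * N" using tn by (subst pdeg_eq_sum[of t "{1..n}"]) (auto simp: pprods_def)
        then show False using q td by linarith
      qed
      then obtain i where i: "i \<in> {1..n}" "N \<le> lookup t i" by blast
      obtain u where u: "t = single i N + u" using pprod_divides_power[OF i(2)] by blast
      have "single t c = single u c * pvar i ^ N"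
        by (simp add: pvar_power mult_single u add.commute)
      moreover have "K (int N + int (pdeg u)) (single u c * pvar i ^ N)"
        using tn by (intro K_mult N i PR_single) (auto simp: u pprods_add homogeneous_single)
      ultimately show ?thesis using td by (simp add: u)
    qed
    then have "K q (\<Sum>t\<in>keys f. single t (lookup f t))"
    proof -
      have "K q (\<Sum>t\<in>F. single t (lookup f t))" if "finite F" "F \<subseteq> keys f" for F
        using that by (induction F rule: finite_induct)
          (auto intro!: K_add K_0 \<open>\<And>t c. t \<in> keys f \<Longrightarrow> K q (single t c)\<close>)
      then show ?thesis by simp
    qed
    then have "K q f" using poly_mapping_sum_single[of "keys f" f] by simp
    then show "\<exists>w\<in>cobounds n (PR n) p (r + q). (\<lambda>S. laur f * z S - w S) \<in> cochains n B p (r + q)"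
      by (simp add: K_def)
  qed
qed

end

section \<open>Passing to the quotient by one linear form\<close>

lemma cdiff_cong:
  assumes "\<And>S. S \<in> cech_idx n p \<Longrightarrow> c S = e S" "T \<in> cech_idx n (Suc p)"
  shows "cdiff c T = cdiff e T"
  unfolding cdiff_def using assms cech_idx_remove[OF assms(2)] by (intro sum.cong) auto

definition add_lin :: "nat \<Rightarrow> 'k::comm_ring_1 mpoly set \<Rightarrow> 'k mpoly \<Rightarrow> 'k mpoly set" where
  "add_lin n B l = {b + l * h | b h. b \<in> B \<and> h \<in> PR n}"

context
  fixes n :: nat and B :: "'k::field_char_0 mpoly set" and l :: "'k mpoly"
  assumes B: "graded_ideal n B" and l: "l \<in> PR n" "homogeneous 1 l"
    and colon: "\<exists>r1. \<forall>r\<ge>r1. \<forall>f\<in>PR n. homogeneous r f \<longrightarrow> l * f \<in> B \<longrightarrow> f \<in> B"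
begin

lemma graded_add_lin: "graded_ideal n (add_lin n B l)"
  unfolding graded_ideal_def
proof (intro conjI ballI allI)
  show "add_lin n B l \<subseteq> PR n" using graded_idealD(1)[OF B] l by (auto simp: add_lin_def intro!: PR_add PR_mult)
  show "0 \<in> add_lin n B l" using graded_idealD(2)[OF B] by (force simp: add_lin_def)
  fix f assume "f \<in> add_lin n B l"
  then obtain b h where f: "f = b + l * h" "b \<in> B" "h \<in> PR n" by (auto simp: add_lin_def)
  show "g * f \<in> add_lin n B l" if "g \<in> PR n" for g
    using f that unfolding add_lin_def
    by (intro CollectI exI[of _ "g * b"] exI[of _ "g * h"]) (auto simp: algebra_simps intro: graded_idealD[OF B] PR_mult)
  show "hcomp d f \<in> add_lin n B l" for d
    using f unfolding add_lin_def
    by (intro CollectI exI[of _ "hcomp d b"] exI[of _ "hcomp (d - 1) h"])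
       (auto simp: keep_add hcomp_mult_homogeneous[OF l(2)] intro: graded_idealD[OF B] PR_keep)
  fix g assume "g \<in> add_lin n B l"
  then obtain b' h' where "g = b' + l * h'" "b' \<in> B" "h' \<in> PR n" by (auto simp: add_lin_def)
  then show "f + g \<in> add_lin n B l"
    using f unfolding add_lin_def
    by (intro CollectI exI[of _ "b + b'"] exI[of _ "h + h'"]) (auto simp: algebra_simps intro: graded_idealD[OF B] PR_add)
qed

lemma B_sub_add_lin: "B \<subseteq> add_lin n B l"
  by (force simp: add_lin_def intro: exI[of _ 0])

lemma lin_mult_add_lin: "h \<in> PR n \<Longrightarrow> l * h \<in> add_lin n B l"
  using graded_idealD(2)[OF B] by (force simp: add_lin_def)

text \<open>The summands of a numerator \<open>b + l h\<close> need not be homogeneous, but their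
  components of the right degree add up to the same numerator.\<close>

lemma loc_add_lin:
  assumes "y \<in> loc (add_lin n B l) S r"
  shows "\<exists>b\<in>loc B S r. \<exists>h\<in>loc (PR n) S (r - 1). y = b + laur l * h"
proof -
  obtain a s where a: "a \<in> add_lin n B l" "homogeneous (r + int s * int (card S)) a" "y = xs S (- int s) * laur a"
    using assms by (rule locE)
  obtain b h where bh: "a = b + l * h" "b \<in> B" "h \<in> PR n" using a(1) by (auto simp: add_lin_def)
  let ?e = "r + int s * int (card S)"
  have "a = hcomp ?e a" using a(2) by (simp add: hcomp_homogeneous)
  also have "\<dots> = hcomp ?e b + l * hcomp (?e - 1) h"
    by (simp only: bh(1) keep_add hcomp_mult_homogeneous[OF l(2)])
  finally have "y = xs S (- int s) * laur (hcomp ?e b) + laur l * (xs S (- int s) * laur (hcomp (?e - 1) h))"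
    using a(3) by (simp add: laur_add laur_mult algebra_simps)
  moreover have "xs S (- int s) * laur (hcomp ?e b) \<in> loc B S r"
    by (intro locI graded_idealD(6)[OF B] bh homogeneous_hcomp)
  moreover have "homogeneous (r - 1 + int s * int (card S)) (hcomp (?e - 1) h)"
    using homogeneous_hcomp[of "?e - 1" h] by (simp add: algebra_simps)
  then have "xs S (- int s) * laur (hcomp (?e - 1) h) \<in> loc (PR n) S (r - 1)"
    by (intro locI PR_keep bh)
  ultimately show ?thesis by blast
qed

lemma cochains_add_lin:
  assumes "c \<in> cochains n (add_lin n B l) p r"
  shows "\<exists>b\<in>cochains n B p r. \<exists>h\<in>cochains n (PR n) p (r - 1). \<forall>S\<in>cech_idx n p. c S = b S + laur l * h S"
proof -
  have "\<forall>S\<in>cech_idx n p. \<exists>x. fst x \<in> loc B S r \<and> snd x \<in> loc (PR n) S (r - 1) \<and> c S = fst x + laur l * snd x"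
    using assms loc_add_lin unfolding cochains_def by fastforce
  then obtain x where x: "\<And>S. S \<in> cech_idx n p \<Longrightarrow> fst (x S) \<in> loc B S r \<and> snd (x S) \<in> loc (PR n) S (r - 1) \<and> c S = fst (x S) + laur l * snd (x S)"
    by metis
  then show ?thesis
    by (intro bexI[of _ "\<lambda>S. fst (x S)"] bexI[of _ "\<lambda>S. snd (x S)"]) (auto simp: cochains_def)
qed

text \<open>As \<open>S\<close> is nonempty, a larger denominator raises the degree of the numerator
  into the range where \<open>l\<close> is a nonzerodivisor modulo \<open>B\<close>. On the empty
  index set the cancellation may fail, and so \<open>H^0\<close> is treated apart.\<close>

lemma loc_colon:
  assumes S: "S \<noteq> {}" "S \<subseteq> {1..n}" and y: "y \<in> loc (PR n) S r" and ly: "laur l * y \<in> loc B S (r + 1)"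
  shows "y \<in> loc B S r"
proof -
  obtain r1 where r1: "\<And>r f. r1 \<le> r \<Longrightarrow> f \<in> PR n \<Longrightarrow> homogeneous r f \<Longrightarrow> l * f \<in> B \<Longrightarrow> f \<in> B"
    using colon by blast
  have fin: "finite S" using S(2) by (rule finite_subset) simp
  then have card: "int (card S) \<ge> 1" using S(1) by (simp add: Suc_le_eq card_gt_0_iff)
  obtain s0 where s0: "\<And>s. s0 \<le> s \<Longrightarrow> \<exists>a\<in>PR n. homogeneous (r + int s * int (card S)) a \<and> y = xs S (- int s) * laur a"
    using loc_raise[OF graded_ideal_PR S(2) y] by blast
  obtain s1 where s1: "\<And>s. s1 \<le> s \<Longrightarrow> \<exists>a\<in>B. homogeneous (r + 1 + int s * int (card S)) a \<and> laur l * y = xs S (- int s) * laur a"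
    using loc_raise[OF B S(2) ly] by blast
  \<comment> \<open>The last bound brings the numerator to degree at least \<open>r1\<close>, as
    each unit of \<open>s\<close> adds \<open>card S \<ge> 1\<close> to it.\<close>
  define s where "s = max (max s0 s1) (nat (r1 - r))"
  have ss: "s0 \<le> s" "s1 \<le> s" by (simp_all add: s_def le_max_iff_disj)
  obtain a where a: "a \<in> PR n" "homogeneous (r + int s * int (card S)) a" "y = xs S (- int s) * laur a"
    using s0[OF ss(1)] by blast
  obtain b where b: "b \<in> B" "laur l * y = xs S (- int s) * laur b"
    using s1[OF ss(2)] by blast
  have "xs S (int s) * (laur l * y) = laur b" unfolding b(2) by simp
  moreover have "xs S (int s) * (laur l * y) = laur (l * a)"
    unfolding a(3) by (simp add: laur_mult mult.left_commute[of "laur l"])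
  ultimately have "l * a = b" by (metis laur_inject)
  moreover have "r1 \<le> r + int s * int (card S)"
  proof -
    have "nat (r1 - r) \<le> s" by (simp add: s_def)
    then have "r1 - r \<le> int s" by simp
    moreover have "int s * 1 \<le> int s * int (card S)" using card by (intro mult_left_mono) auto
    ultimately show ?thesis by linarith
  qed
  ultimately have "a \<in> B" using r1 a b by blast
  then show ?thesis using a by (simp add: locI)
qed

text \<open>Classes killed by \<open>l\<close> come through the connecting map from
  \<open>R / (B, l)\<close>, one cohomological degree lower and one internal degree higher. Every
  class is killed by some power of \<open>l\<close>, and the exponent is lowered one by one;
  therefore the hypothesis ranges over all \<open>r' \<ge> r + 1\<close>.\<close>

lemma vanish_Suc_of_quotient:
  assumes van: "\<And>r'. r' \<ge> r + 1 \<Longrightarrow> vanish n (PR n) (add_lin n B l) q r'"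
  shows "vanish n (PR n) B (Suc q) r"
  unfolding vanish_def
proof (intro ballI impI)
  fix z assume z: "z \<in> cochains n (PR n) (Suc q) r" and dz: "cdiff z \<in> cochains n B (Suc (Suc q)) r"
  define P where "P N \<longleftrightarrow> (\<exists>c\<in>cochains n (PR n) q (r + int N).
    (\<lambda>T. laur (l ^ N) * z T - cdiff c T) \<in> cochains n B (Suc q) (r + int N))" for N
  have lN: "l ^ N \<in> PR n" "homogeneous (int N) (l ^ N)" for N
    using PR_power[OF l(1)] homogeneous_power[OF l(2), of N] by auto
  \<comment> \<open>If \<open>l ^ (N + 1) z\<close> is \<open>d w\<close> modulo \<open>B\<close>,
    then \<open>w\<close> is a cocycle modulo \<open>(B, l)\<close>. Writing it as a coboundary plus
    \<open>b + l y\<close> shows that \<open>l\<close> times \<open>l ^ N z - d y\<close> lies in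
    \<open>B\<close>, and \<open>l\<close> cancels.\<close>
  have step: "P N" if PS: "P (Suc N)" for N
  proof -
    let ?r = "r + int (Suc N)"
    obtain w where w: "w \<in> cochains n (PR n) q ?r"
      and E: "(\<lambda>T. laur (l ^ Suc N) * z T - cdiff w T) \<in> cochains n B (Suc q) ?r" (is "?E \<in> _")
      using PS by (auto simp: P_def)
    have "laur (l ^ Suc N) * z T \<in> loc (add_lin n B l) T ?r" if T: "T \<in> cech_idx n (Suc q)" for T
    proof (rule loc_mult_ideal)
      show "z T \<in> loc (PR n) T r" using z T by (auto simp: cochains_def)
      show "homogeneous (int (Suc N)) (l ^ Suc N)" by (rule lN)
      show "l ^ Suc N * b \<in> add_lin n B l" if "b \<in> PR n" for b
        using lin_mult_add_lin[OF PR_mult[OF lN(1)[of N] that]] by (simp add: mult.assoc)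
    qed
    then have "(\<lambda>T. laur (l ^ Suc N) * z T) \<in> cochains n (add_lin n B l) (Suc q) ?r"
      by (simp add: cochains_def)
    from cochains_diff[OF graded_add_lin this subsetD[OF cochains_mono[OF B_sub_add_lin] E]]
    have "cdiff w \<in> cochains n (add_lin n B l) (Suc q) ?r" by simp
    moreover have "vanish n (PR n) (add_lin n B l) q ?r" by (rule van) simp
    ultimately obtain v where v: "v \<in> cobounds n (PR n) q ?r" "(\<lambda>S. w S - v S) \<in> cochains n (add_lin n B l) q ?r"
      using w by (auto simp: vanish_def)
    obtain b y where b: "b \<in> cochains n B q ?r" and y: "y \<in> cochains n (PR n) q (?r - 1)"
      and wv: "\<And>S. S \<in> cech_idx n q \<Longrightarrow> w S - v S = b S + laur l * y S"
      using cochains_add_lin[OF v(2)] by blast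
    have y': "y \<in> cochains n (PR n) q (r + int N)" using y by simp
    show "P N" unfolding P_def
    proof (rule bexI[OF _ y'])
      let ?c = "\<lambda>T. laur (l ^ N) * z T - cdiff y T"
      have c: "?c \<in> cochains n (PR n) (Suc q) (r + int N)"
        by (intro cochains_diff[OF graded_ideal_PR] cochains_cdiff[OF graded_ideal_PR] y'
            cochains_mult[OF graded_ideal_PR z] lN)
      show "?c \<in> cochains n B (Suc q) (r + int N)"
        unfolding cochains_def
      proof (intro CollectI ballI)
        fix T assume T: "T \<in> cech_idx n (Suc q)"
        show "?c T \<in> loc B T (r + int N)"
        proof (rule loc_colon)
          show "T \<noteq> {}" "T \<subseteq> {1..n}" using cech_idxD[OF T] by auto
          show "?c T \<in> loc (PR n) T (r + int N)" using c T by (simp add: cochains_def)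
          have "cdiff (\<lambda>S. w S - v S) T = cdiff (\<lambda>S. b S + laur l * y S) T"
            by (rule cdiff_cong[OF wv T])
          then have "cdiff w T = cdiff b T + laur l * cdiff y T"
            using cdiff_cobounds[OF v(1), of T] cech_idxD[OF T] by (simp add: cdiff_diff cdiff_add cdiff_mult)
          then have "laur l * ?c T = ?E T + cdiff b T"
            by (simp add: laur_mult algebra_simps)
          moreover have "?E T + cdiff b T \<in> loc B T ?r"
            using E cochains_cdiff[OF B b] T cech_idxD[OF T] by (intro loc_add[OF B]) (auto simp: cochains_def)
          ultimately show "laur l * ?c T \<in> loc B T (r + int N + 1)" by (simp add: add_ac)
        qed
      qed
    qed
  qed
  have "\<exists>N. P N"
  proof -
    obtain N where N: "\<forall>q'>N. \<forall>f\<in>PR n. homogeneous q' f \<longrightarrow> (\<exists>w\<in>cobounds n (PR n) (Suc q) (r + q').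
        (\<lambda>S. laur f * z S - w S) \<in> cochains n B (Suc q) (r + q'))"
      using torsion[OF B z dz] ..
    \<comment> \<open>The bound from \<open>torsion\<close> is strict and is an integer that may be
      negative.\<close>
    define M where "M = nat N + 1"
    have "N < int M" by (simp add: M_def)
    from N[rule_format, OF this lN] have "P M" unfolding P_def cobounds_def by auto
    then show ?thesis ..
  qed
  then obtain N where "P N" by blast
  then have "P 0" by (induction N) (auto dest: step)
  then show "\<exists>w\<in>cobounds n (PR n) (Suc q) r. (\<lambda>S. z S - w S) \<in> cochains n B (Suc q) r"
    unfolding P_def cobounds_def by auto
qed

text \<open>Exactness of \<open>H^p(R/B)_r -> H^p(R/(B,l))_r -> H^(p+1)(R/B)_(r-1)\<close> at the
  middle term. With \<open>d z = b + l y\<close>, the cochain \<open>y\<close> is a cocycle modulo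
  \<open>B\<close> since \<open>l\<close> cancels, and killing its class allows \<open>z\<close> to
  be corrected.\<close>

lemma vanish_quotient:
  assumes van: "vanish n (PR n) B p r" "vanish n (PR n) B (Suc p) (r - 1)"
  shows "vanish n (PR n) (add_lin n B l) p r"
  unfolding vanish_def
proof (intro ballI impI)
  fix z assume z: "z \<in> cochains n (PR n) p r" and dz: "cdiff z \<in> cochains n (add_lin n B l) (Suc p) r"
  obtain b y where b: "b \<in> cochains n B (Suc p) r" and y: "y \<in> cochains n (PR n) (Suc p) (r - 1)"
    and dz_eq: "\<And>T. T \<in> cech_idx n (Suc p) \<Longrightarrow> cdiff z T = b T + laur l * y T"
    using cochains_add_lin[OF dz] by blast
  have dy: "cdiff y \<in> cochains n B (Suc (Suc p)) (r - 1)"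
    unfolding cochains_def
  proof (intro CollectI ballI)
    fix T assume T: "T \<in> cech_idx n (Suc (Suc p))"
    show "cdiff y T \<in> loc B T (r - 1)"
    proof (rule loc_colon)
      show "T \<noteq> {}" "T \<subseteq> {1..n}" using cech_idxD[OF T] by auto
      show "cdiff y T \<in> loc (PR n) T (r - 1)" using cochains_cdiff[OF graded_ideal_PR y] T by (simp add: cochains_def)
      have "cdiff (cdiff z) T = cdiff (\<lambda>S. b S + laur l * y S) T" by (rule cdiff_cong[OF dz_eq T])
      then have "laur l * cdiff y T = - cdiff b T"
        using cech_idxD[OF T] by (simp add: cdiff_cdiff cdiff_add cdiff_mult eq_neg_iff_add_eq_0 add.commute)
      moreover have "- cdiff b T \<in> loc B T r"
        using cochains_cdiff[OF B b] T by (intro loc_uminus[OF B]) (simp add: cochains_def)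
      ultimately show "laur l * cdiff y T \<in> loc B T (r - 1 + 1)" by simp
    qed
  qed
  then obtain v where v: "v \<in> cochains n (PR n) p (r - 1)" and yv: "(\<lambda>T. y T - cdiff v T) \<in> cochains n B (Suc p) (r - 1)"
    using van(2) y unfolding vanish_def cobounds_def by fastforce
  \<comment> \<open>A correction by a multiple of \<open>l\<close> leaves the class modulo
    \<open>(B, l)\<close> unchanged and makes \<open>z\<close> a cocycle modulo
    \<open>B\<close>.\<close>
  let ?z = "\<lambda>S. z S - laur l * v S"
  have lv: "(\<lambda>S. laur l * v S) \<in> cochains n (PR n) p r"
    using cochains_mult[OF graded_ideal_PR v l] by simp
  have z': "?z \<in> cochains n (PR n) p r" by (rule cochains_diff[OF graded_ideal_PR z lv])
  have "(\<lambda>T. b T + laur l * (y T - cdiff v T)) \<in> cochains n B (Suc p) r"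
    using cochains_add[OF B b] cochains_mult[OF B yv l] by simp
  then have "cdiff ?z \<in> cochains n B (Suc p) r"
    by (subst cochains_cong[where e = "\<lambda>T. b T + laur l * (y T - cdiff v T)"])
      (simp_all add: cdiff_diff cdiff_mult dz_eq algebra_simps)
  then obtain u where u: "u \<in> cobounds n (PR n) p r" and zu: "(\<lambda>S. ?z S - u S) \<in> cochains n B p r"
    using van(1) z' unfolding vanish_def by blast
  have "laur l * v S \<in> loc (add_lin n B l) S r" if "S \<in> cech_idx n p" for S
    using loc_mult_ideal[where y = "v S" and r = "r - 1" and B = "PR n" and S = S, OF _ l(2) lin_mult_add_lin] v that by (simp add: cochains_def)
  then have "(\<lambda>S. laur l * v S) \<in> cochains n (add_lin n B l) p r" by (simp add: cochains_def)
  from cochains_add[OF graded_add_lin this subsetD[OF cochains_mono[OF B_sub_add_lin] zu]]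
  have "(\<lambda>S. z S - u S) \<in> cochains n (add_lin n B l) p r" by simp
  then show "\<exists>w\<in>cobounds n (PR n) p r. (\<lambda>S. z S - w S) \<in> cochains n (add_lin n B l) p r"
    using u by blast
qed

text \<open>An element of \<open>(B : l)\<close> lies in \<open>B\<close> after localising at any
  variable, by \<open>loc_colon\<close>, and so represents a class in \<open>H^0\<close>.\<close>

lemma vanish_0_imp_colon:
  assumes van: "vanish n (PR n) B 0 r" and f: "f \<in> PR n" "homogeneous r f" "l * f \<in> B"
  shows "f \<in> B"
proof -
  let ?z = "\<lambda>S. laur f"
  have z: "?z \<in> cochains n (PR n) 0 r" using f by (auto simp: cochains_def loc_empty_iff)
  have "cdiff ?z T \<in> loc B T r" if T: "T \<in> cech_idx n (Suc 0)" for T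
  proof (rule loc_colon)
    show "T \<noteq> {}" "T \<subseteq> {1..n}" using cech_idxD[OF T] by auto
    show "cdiff ?z T \<in> loc (PR n) T r" using cochains_cdiff[OF graded_ideal_PR z] T by (simp add: cochains_def)
    have "(\<lambda>S. laur (l * f)) \<in> cochains n B 0 (r + 1)"
      using f homogeneous_mult[OF l(2) f(2)] by (auto simp: cochains_def loc_empty_iff add.commute)
    from cochains_cdiff[OF B this] T show "laur l * cdiff ?z T \<in> loc B T (r + 1)"
      by (simp add: cochains_def laur_mult cdiff_mult)
  qed
  then have "cdiff ?z \<in> cochains n B (Suc 0) r" by (simp add: cochains_def)
  then have "?z \<in> cochains n B 0 r" using van z by (auto simp: vanish_def cobounds_def)
  then show ?thesis by (auto simp: cochains_def loc_empty_iff)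
qed

text \<open>A class in \<open>H^0\<close> is killed by a power of \<open>l\<close>. The factors are
  stripped off one at a time, in degrees that never drop below \<open>r\<close>.\<close>

lemma colon_imp_vanish_0:
  assumes col: "\<And>r' f. r' \<ge> r \<Longrightarrow> f \<in> PR n \<Longrightarrow> homogeneous r' f \<Longrightarrow> l * f \<in> B \<Longrightarrow> f \<in> B"
  shows "vanish n (PR n) B 0 r"
  unfolding vanish_def
proof (intro ballI impI)
  fix z assume z: "z \<in> cochains n (PR n) 0 r" and dz: "cdiff z \<in> cochains n B (Suc 0) r"
  obtain f where f: "f \<in> PR n" "homogeneous r f" "z {} = laur f" using z by (auto simp: cochains_def loc_empty_iff)
  have lN: "l ^ N \<in> PR n" "homogeneous (int N) (l ^ N)" for N
    using PR_power[OF l(1)] homogeneous_power[OF l(2), of N] by auto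
  obtain N where N: "\<forall>q'>N. \<forall>f\<in>PR n. homogeneous q' f \<longrightarrow> (\<exists>w\<in>cobounds n (PR n) 0 (r + q').
      (\<lambda>S. laur f * z S - w S) \<in> cochains n B 0 (r + q'))"
    using torsion[OF B z dz] ..
  define M where "M = nat N + 1"
  have "N < int M" by (simp add: M_def)
  from N[rule_format, OF this lN] have "laur (l ^ M * f) \<in> loc B {} (r + int M)"
    using f(3) by (auto simp: cobounds_def cochains_def laur_mult)
  then have "l ^ M * f \<in> B" by (auto simp: loc_empty_iff)
  moreover have "f \<in> B" if "l ^ M * f \<in> B" for M
    using that
  proof (induction M)
    case (Suc M)
    have "l * (l ^ M * f) \<in> B" using Suc.prems by (simp add: mult.assoc)
    then have "l ^ M * f \<in> B"
      by (intro col[OF _ PR_mult[OF lN(1) f(1)] homogeneous_mult[OF lN(2) f(2)]]) auto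
    then show ?case by (rule Suc.IH)
  qed simp
  ultimately have "f \<in> B" by blast
  then show "\<exists>w\<in>cobounds n (PR n) 0 r. (\<lambda>S. z S - w S) \<in> cochains n B 0 r"
    using f by (auto simp: cobounds_def cochains_def loc_empty_iff)
qed

end

text \<open>For \<open>e = 1\<close> and \<open>e = 0\<close> this bounds the regularity and the invariant \<open>a\<^sup>*\<close> of \<open>R / B\<close> by \<open>\<rho>\<close>.
  Very negative and very large values of \<open>e\<close> isolate a cohomological degree.\<close>

definition vanish_above :: "nat \<Rightarrow> 'k::comm_ring_1 mpoly set \<Rightarrow> int \<Rightarrow> int \<Rightarrow> bool" where
  "vanish_above n B e \<rho> \<longleftrightarrow> (\<forall>p r. \<rho> < r + e * int p \<longrightarrow> vanish n (PR n) B p r)"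

context
  fixes n :: nat and B :: "'k::field_char_0 mpoly set" and l :: "'k mpoly"
  assumes B: "graded_ideal n B" and l: "l \<in> PR n" "homogeneous 1 l"
    and colon: "\<exists>r1. \<forall>r\<ge>r1. \<forall>f\<in>PR n. homogeneous r f \<longrightarrow> l * f \<in> B \<longrightarrow> f \<in> B"
begin

text \<open>The pair \<open>(p, r)\<close> of the quotient is controlled by \<open>(p, r)\<close>
  and \<open>(p + 1, r - 1)\<close>. The second has a value of \<open>r + e p\<close> smaller by
  \<open>1 - e\<close>, which is the loss in the bound; for \<open>e \<le> 1\<close> the first is no
  worse.\<close>

lemma vanish_above_quotient:
  assumes "vanish_above n B e \<rho>" "e \<le> 1"
  shows "vanish_above n (add_lin n B l) e (\<rho> + 1 - e)"
  unfolding vanish_above_def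
proof (intro allI impI)
  fix p r assume pr: "\<rho> + 1 - e < r + e * int p"
  have V: "\<rho> < r + e * int p \<Longrightarrow> vanish n (PR n) B p r" for p r
    using assms(1) by (simp add: vanish_above_def)
  show "vanish n (PR n) (add_lin n B l) p r"
    by (rule vanish_quotient[OF B l colon V V]) (use pr assms(2) in \<open>simp_all add: algebra_simps\<close>)
qed

lemma vanish_above_colon:
  assumes "vanish_above n B e \<rho>" "\<rho> < r" "f \<in> PR n" "homogeneous r f" "l * f \<in> B"
  shows "f \<in> B"
proof (rule vanish_0_imp_colon[OF B l colon _ assms(3-5)])
  show "vanish n (PR n) B 0 r" using assms(1,2) by (simp add: vanish_above_def)
qed

text \<open>The pair \<open>(q + 1, r)\<close> is controlled by the pairs \<open>(q, r')\<close>
  with \<open>r' \<ge> r + 1\<close>, whose value is larger by at least \<open>1 - e\<close>. This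
  holds for every \<open>e\<close>, and \<open>vanish_dimension\<close> relies on it with a large
  one.\<close>

lemma vanish_above_of_quotient:
  assumes "vanish_above n (add_lin n B l) e (\<rho> + 1 - e)"
    and "\<And>r f. \<rho> < r \<Longrightarrow> f \<in> PR n \<Longrightarrow> homogeneous r f \<Longrightarrow> l * f \<in> B \<Longrightarrow> f \<in> B"
  shows "vanish_above n B e \<rho>"
  unfolding vanish_above_def
proof (intro allI impI)
  fix p r assume pr: "\<rho> < r + e * int p"
  show "vanish n (PR n) B p r"
  proof (cases p)
    case 0
    have "vanish n (PR n) B 0 r"
    proof (rule colon_imp_vanish_0[OF B l colon])
      fix r' and f :: "'k mpoly"
      assume "r \<le> r'" "f \<in> PR n" "homogeneous r' f" "l * f \<in> B"
      then show "f \<in> B" using pr assms(2)[of r' f] by (simp add: 0)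
    qed
    then show ?thesis by (simp add: 0)
  next
    case (Suc q)
    have "vanish n (PR n) B (Suc q) r"
    proof (rule vanish_Suc_of_quotient[OF B l colon])
      fix r' assume "r + 1 \<le> r'"
      then have "\<rho> + 1 - e < r' + e * int q" using pr by (simp add: Suc algebra_simps)
      then show "vanish n (PR n) (add_lin n B l) q r'" using assms(1) by (simp add: vanish_above_def)
    qed
    then show ?thesis by (simp add: Suc)
  qed
qed

end

section \<open>Ideals containing all forms of large degree\<close>

context
  fixes n :: nat and B :: "'k::field_char_0 mpoly set"
  assumes B: "graded_ideal n B" and primary: "\<exists>D. \<forall>r\<ge>D. \<forall>f\<in>PR n. homogeneous r f \<longrightarrow> f \<in> B"
begin

text \<open>Raising the denominator moves the numerator into the degrees contained in
  \<open>B\<close>, so all localisations of \<open>R / B\<close> at nonempty sets are zero.\<close>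

lemma loc_primary:
  assumes S: "S \<noteq> {}" "S \<subseteq> {1..n}" and y: "y \<in> loc (PR n) S r"
  shows "y \<in> loc B S r"
proof -
  obtain D where D: "\<And>r f. D \<le> r \<Longrightarrow> f \<in> PR n \<Longrightarrow> homogeneous r f \<Longrightarrow> f \<in> B"
    using primary by blast
  have fin: "finite S" using S(2) by (rule finite_subset) simp
  then have card: "int (card S) \<ge> 1" using S(1) by (simp add: Suc_le_eq card_gt_0_iff)
  obtain s0 where s0: "\<And>s. s0 \<le> s \<Longrightarrow> \<exists>a\<in>PR n. homogeneous (r + int s * int (card S)) a \<and> y = xs S (- int s) * laur a"
    using loc_raise[OF graded_ideal_PR S(2) y] by blast
  define s where "s = max s0 (nat (D - r))"
  have ss: "s0 \<le> s" by (simp add: s_def)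
  obtain a where a: "a \<in> PR n" "homogeneous (r + int s * int (card S)) a" "y = xs S (- int s) * laur a"
    using s0[OF ss] by blast
  have "nat (D - r) \<le> s" by (simp add: s_def)
  then have "D - r \<le> int s" by simp
  moreover have "int s * 1 \<le> int s * int (card S)" using card by (intro mult_left_mono) auto
  ultimately have "D \<le> r + int s * int (card S)" by linarith
  then have "a \<in> B" using D a by blast
  then show ?thesis using a by (simp add: locI)
qed

lemma vanish_Suc_primary: "vanish n (PR n) B (Suc p) r"
  unfolding vanish_def
proof (intro ballI impI)
  fix z :: "nat set \<Rightarrow> 'k laurent" assume z: "z \<in> cochains n (PR n) (Suc p) r"
  have "z S \<in> loc B S r" if "S \<in> cech_idx n (Suc p)" for S
    using that z cech_idxD[OF that] by (intro loc_primary) (auto simp: cochains_def)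
  then show "\<exists>w\<in>cobounds n (PR n) (Suc p) r. (\<lambda>S. z S - w S) \<in> cochains n B (Suc p) r"
    using cobounds_zero[OF graded_ideal_PR] by (intro bexI) (auto simp: cochains_def)
qed

lemma vanish_0_primary_iff:
  "vanish n (PR n) B 0 r \<longleftrightarrow> (\<forall>f\<in>PR n. homogeneous r f \<longrightarrow> f \<in> B)"
proof
  assume van: "vanish n (PR n) B 0 r"
  show "\<forall>f\<in>PR n. homogeneous r f \<longrightarrow> f \<in> B"
  proof (intro ballI impI)
    fix f :: "'k mpoly" assume f: "f \<in> PR n" "homogeneous r f"
    have z: "(\<lambda>S. laur f) \<in> cochains n (PR n) 0 r" using f by (auto simp: cochains_def loc_empty_iff)
    have "cdiff (\<lambda>S. laur f) S \<in> loc B S r" if "S \<in> cech_idx n (Suc 0)" for S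
      using that cech_idxD[OF that] cochains_cdiff[OF graded_ideal_PR z]
      by (intro loc_primary) (auto simp: cochains_def)
    then have "cdiff (\<lambda>S. laur f) \<in> cochains n B (Suc 0) r" by (simp add: cochains_def)
    then have "(\<lambda>S. laur f) \<in> cochains n B 0 r" using van z by (auto simp: vanish_def cobounds_def)
    then show "f \<in> B" by (auto simp: cochains_def loc_empty_iff)
  qed
next
  assume "\<forall>f\<in>PR n. homogeneous r f \<longrightarrow> f \<in> B"
  then show "vanish n (PR n) B 0 r"
    by (auto simp: vanish_def cobounds_def cochains_def loc_empty_iff)
qed

text \<open>\<open>R / B\<close> is its own zeroth local cohomology and the higher ones vanish. Only
  pairs with \<open>p = 0\<close> contribute, so the condition is the same for every
  \<open>e\<close>.\<close>

lemma vanish_above_primary_iff: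
  "vanish_above n B e \<rho> \<longleftrightarrow> (\<forall>r>\<rho>. \<forall>f\<in>PR n. homogeneous r f \<longrightarrow> f \<in> B)"
proof
  assume "vanish_above n B e \<rho>"
  then have "vanish n (PR n) B 0 r" if "r > \<rho>" for r using that by (simp add: vanish_above_def)
  then show "\<forall>r>\<rho>. \<forall>f\<in>PR n. homogeneous r f \<longrightarrow> f \<in> B" using vanish_0_primary_iff by blast
next
  assume *: "\<forall>r>\<rho>. \<forall>f\<in>PR n. homogeneous r f \<longrightarrow> f \<in> B"
  show "vanish_above n B e \<rho>"
    unfolding vanish_above_def
  proof (intro allI impI)
    fix p r assume "\<rho> < r + e * int p"
    then show "vanish n (PR n) B p r"
      using * vanish_0_primary_iff vanish_Suc_primary by (cases p) auto
  qed
qed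

end

section \<open>The long exact sequence of an ideal\<close>

context
  fixes n :: nat and I :: "'k::field_char_0 mpoly set"
  assumes I: "graded_ideal n I"
begin

lemma cochains_zero_ideal: "c \<in> cochains n {0} p r \<longleftrightarrow> (\<forall>S\<in>cech_idx n p. c S = 0)"
  by (simp add: cochains_def loc_zero_ideal)

lemma I_sub: "cochains n I p r \<subseteq> cochains n (PR n) p r"
  using graded_idealD(1)[OF I] by (intro cochains_mono) blast

text \<open>Left exactness of \<open>H^0\<close> for the inclusion of \<open>I\<close> in
  \<open>R\<close>.\<close>

lemma vanish_ideal_0: "vanish n (PR n) {0 :: 'k mpoly} 0 r \<Longrightarrow> vanish n I {0} 0 r"
  using I_sub[of 0 r] unfolding vanish_def cobounds_def by auto

text \<open>Exactness of \<open>H^p(R/I) -> H^(p+1)(I) -> H^(p+1)(R)\<close>.\<close>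

lemma vanish_ideal_Suc:
  assumes "vanish n (PR n) {0 :: 'k mpoly} (Suc p) r" "vanish n (PR n) I p r"
  shows "vanish n I {0} (Suc p) r"
  unfolding vanish_def
proof (intro ballI impI)
  fix z assume z: "z \<in> cochains n I (Suc p) r" and dz: "cdiff z \<in> cochains n {0} (Suc (Suc p)) r"
  obtain w where w: "w \<in> cochains n (PR n) p r" "(\<lambda>S. z S - cdiff w S) \<in> cochains n {0} (Suc p) r"
    using assms(1) dz I_sub z unfolding vanish_def cobounds_def by fastforce
  have zw: "z S = cdiff w S" if "S \<in> cech_idx n (Suc p)" for S using w(2) that by (simp add: cochains_zero_ideal)
  have "cdiff w \<in> cochains n I (Suc p) r" using z by (subst cochains_cong[of _ _ _ z]) (simp_all add: zw)
  then obtain u where u: "u \<in> cobounds n (PR n) p r" "(\<lambda>S. w S - u S) \<in> cochains n I p r"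
    using assms(2) w(1) unfolding vanish_def by blast
  show "\<exists>w\<in>cobounds n I (Suc p) r. (\<lambda>S. z S - w S) \<in> cochains n {0} (Suc p) r"
  proof (rule bexI)
    show "cdiff (\<lambda>S. w S - u S) \<in> cobounds n I (Suc p) r" using u(2) by (simp add: cobounds_def)
    show "(\<lambda>S. z S - cdiff (\<lambda>S. w S - u S) S) \<in> cochains n {0} (Suc p) r"
      using cdiff_cobounds[OF u(1)] cech_idxD by (fastforce simp: cochains_zero_ideal cdiff_diff zw)
  qed
qed

text \<open>Exactness of \<open>H^p(R) -> H^p(R/I) -> H^(p+1)(I)\<close>.\<close>

lemma vanish_mod_ideal:
  assumes "vanish n (PR n) {0 :: 'k mpoly} p r" "vanish n I {0} (Suc p) r"
  shows "vanish n (PR n) I p r"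
  unfolding vanish_def
proof (intro ballI impI)
  fix z assume z: "z \<in> cochains n (PR n) p r" and dz: "cdiff z \<in> cochains n I (Suc p) r"
  have "cdiff (cdiff z) \<in> cochains n {0} (Suc (Suc p)) r"
    using cdiff_cdiff[of _ z] cech_idxD by (fastforce simp: cochains_zero_ideal)
  then obtain w where w: "w \<in> cochains n I p r" "(\<lambda>S. cdiff z S - cdiff w S) \<in> cochains n {0} (Suc p) r"
    using assms(2) dz unfolding vanish_def cobounds_def by fastforce
  have "(\<lambda>S. z S - w S) \<in> cochains n (PR n) p r"
    using z w(1) I_sub by (intro cochains_diff[OF graded_ideal_PR]) auto
  moreover have "cdiff (\<lambda>S. z S - w S) \<in> cochains n {0} (Suc p) r"
    using w(2) by (simp add: cochains_zero_ideal cdiff_diff)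
  ultimately obtain u where u: "u \<in> cobounds n (PR n) p r" "(\<lambda>S. z S - w S - u S) \<in> cochains n {0} p r"
    using assms(1) unfolding vanish_def by blast
  have "z S - u S = w S" if "S \<in> cech_idx n p" for S
  proof -
    have "z S - w S - u S = 0" using u(2) that by (simp add: cochains_zero_ideal)
    then show ?thesis by (simp add: algebra_simps)
  qed
  then have "(\<lambda>S. z S - u S) \<in> cochains n I p r" using w(1) by (subst cochains_cong[of _ _ _ w]) simp_all
  then show "\<exists>w\<in>cobounds n (PR n) p r. (\<lambda>S. z S - w S) \<in> cochains n I p r" using u(1) by blast
qed

end

section \<open>Fractions as Laurent polynomials\<close>

lemma poly_ring_nat_pow: "f [^]\<^bsub>poly_ring n\<^esub> (k :: nat) = f ^ k"
  by (induction k) (simp_all add: nat_pow_def mult.commute)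

lemma ideal_module_simps [simp]:
  "carrier (ideal_module I) = I" "x \<oplus>\<^bsub>ideal_module I\<^esub> y = x + y" "\<zero>\<^bsub>ideal_module I\<^esub> = 0"
  "a \<odot>\<^bsub>ideal_module I\<^esub> x = a * x"
  by (simp_all add: ideal_module_def)

text \<open>The class of the fractions \<open>b / x\<^sub>S\<^sup>t\<close> which are equal to the Laurent polynomial \<open>y\<close>.\<close>

definition fracs :: "'k::comm_ring_1 mpoly set \<Rightarrow> nat set \<Rightarrow> 'k laurent \<Rightarrow> ('k mpoly \<times> nat) set" where
  "fracs I S y = {(b, t). b \<in> I \<and> xs S (- int t) * laur b = y}"

text \<open>The ungraded localisation, since the operations of \<open>localise\<close> and the
  finite sums of the differential live on all fractions.\<close>

definition loc_all :: "'k::comm_ring_1 mpoly set \<Rightarrow> nat set \<Rightarrow> 'k laurent set" where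
  "loc_all I S = {xs S (- int s) * laur a | a s. a \<in> I}"

lemma loc_all_of_loc: "y \<in> loc I S r \<Longrightarrow> y \<in> loc_all I S"
  by (auto simp: loc_def loc_all_def)

lemma fracs_inject: "y \<in> loc_all I S \<Longrightarrow> fracs I S y = fracs I S z \<longleftrightarrow> y = z"
  by (auto simp: loc_all_def fracs_def set_eq_iff)

context
  fixes n :: nat and I :: "'k::field_char_0 mpoly set"
  assumes I: "graded_ideal n I"
begin

text \<open>Powers of \<open>x_S\<close> are units among the Laurent polynomials, so the auxiliary
  exponent \<open>u\<close> of the relation cancels.\<close>

lemma loc_rel_iff:
  assumes S: "finite S"
  shows "((a, s), (b, t)) \<in> loc_rel (poly_ring n) (ideal_module I) (xprod S) \<longleftrightarrow>
    a \<in> I \<and> b \<in> I \<and> xs S (- int s) * laur a = xs S (- int t) * laur b"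
proof -
  have eq: "xprod S ^ (u + t) * a = xprod S ^ (u + s) * b \<longleftrightarrow> xs S (- int s) * laur a = xs S (- int t) * laur b" for u
  proof -
    have "xprod S ^ (u + t) * a = xprod S ^ (u + s) * b \<longleftrightarrow>
        xs S (int (u + t)) * laur a = xs S (int (u + s)) * laur b"
      unfolding laur_inject[symmetric, of "xprod S ^ (u + t) * a"] laur_mult laur_xprod_power[OF S] ..
    also have "\<dots> \<longleftrightarrow> xs S (- int s) * laur a = xs S (- int t) * laur b"
    proof
      assume "xs S (int (u + t)) * laur a = xs S (int (u + s)) * laur b"
      then have "xs S (- int (u + s + t)) * (xs S (int (u + t)) * laur a) = xs S (- int (u + s + t)) * (xs S (int (u + s)) * laur b)"
        by simp
      then show "xs S (- int s) * laur a = xs S (- int t) * laur b"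
        by (simp add: mult.assoc[symmetric] xs_mult)
    next
      assume "xs S (- int s) * laur a = xs S (- int t) * laur b"
      then have "xs S (int (u + s + t)) * (xs S (- int s) * laur a) = xs S (int (u + s + t)) * (xs S (- int t) * laur b)"
        by simp
      then show "xs S (int (u + t)) * laur a = xs S (int (u + s)) * laur b"
        by (simp add: mult.assoc[symmetric] xs_mult)
    qed
    finally show ?thesis .
  qed
  show ?thesis
    by (simp add: loc_rel_def poly_ring_nat_pow eq)
qed

lemma frac_eq:
  assumes "finite S" "a \<in> I"
  shows "frac (poly_ring n) (ideal_module I) (xprod S) a s = fracs I S (xs S (- int s) * laur a)"
  using assms by (auto simp: frac_def fracs_def loc_rel_iff)

lemma carrier_localise:
  assumes S: "finite S"
  shows "carrier (localise (poly_ring n) (ideal_module I) (xprod S)) = fracs I S ` loc_all I S"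
proof -
  have "carrier (localise (poly_ring n) (ideal_module I) (xprod S)) =
      {frac (poly_ring n) (ideal_module I) (xprod S) a s | a s. a \<in> I}"
    by (auto simp: localise_def quotient_def frac_def)
  also have "\<dots> = fracs I S ` loc_all I S"
  proof (intro equalityI subsetI)
    fix x assume "x \<in> {frac (poly_ring n) (ideal_module I) (xprod S) a s | a s. a \<in> I}"
    then obtain a s where a: "a \<in> I" "x = frac (poly_ring n) (ideal_module I) (xprod S) a s" by blast
    then have "x = fracs I S (xs S (- int s) * laur a)" by (simp add: frac_eq[OF S])
    moreover have "xs S (- int s) * laur a \<in> loc_all I S" using a unfolding loc_all_def by blast
    ultimately show "x \<in> fracs I S ` loc_all I S" by blast
  next
    fix x assume "x \<in> fracs I S ` loc_all I S"
    then obtain a s where a: "a \<in> I" "x = fracs I S (xs S (- int s) * laur a)" by (auto simp: loc_all_def)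
    then have "x = frac (poly_ring n) (ideal_module I) (xprod S) a s" by (simp add: frac_eq[OF S])
    then show "x \<in> {frac (poly_ring n) (ideal_module I) (xprod S) a s | a s. a \<in> I}" using a by blast
  qed
  finally show ?thesis .
qed

lemma localise_zero:
  assumes S: "finite S"
  shows "\<zero>\<^bsub>localise (poly_ring n) (ideal_module I) (xprod S)\<^esub> = fracs I S 0"
  using frac_eq[OF S graded_idealD(2)[OF I], of 0] by (simp add: localise_def)

lemma loc_all_zero: "0 \<in> loc_all I S"
  using graded_idealD(2)[OF I] by (force simp: loc_all_def)

lemma loc_all_uminus: "y \<in> loc_all I S \<Longrightarrow> - y \<in> loc_all I S"
  using graded_idealD(7)[OF I] by (force simp: loc_all_def laur_uminus)

lemma loc_all_add:
  assumes S: "S \<subseteq> {1..n}" and y: "y \<in> loc_all I S" and z: "z \<in> loc_all I S"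
  shows "y + z \<in> loc_all I S"
proof -
  have fin: "finite S" using S by (rule finite_subset) simp
  obtain a s b t where y: "y = xs S (- int s) * laur a" "a \<in> I" and z: "z = xs S (- int t) * laur b" "b \<in> I"
    using y z by (auto simp: loc_all_def)
  have "xprod S ^ t * a + xprod S ^ s * b \<in> I"
    using S y z by (intro graded_idealD[OF I] PR_power PR_xprod)
  moreover have "y + z = xs S (- int (s + t)) * laur (xprod S ^ t * a + xprod S ^ s * b)"
    by (simp add: y z laur_add laur_mult laur_xprod_power[OF fin] distrib_left mult.assoc[symmetric] xs_mult)
  ultimately show ?thesis unfolding loc_all_def by blast
qed

text \<open>The sum is a union over all pairs of representatives. Each pair gives the same class,
  and there is at least one pair.\<close>

lemma localise_add:
  assumes S: "S \<subseteq> {1..n}" and y: "y \<in> loc_all I S" and z: "z \<in> loc_all I S"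
  shows "fracs I S y \<oplus>\<^bsub>localise (poly_ring n) (ideal_module I) (xprod S)\<^esub> fracs I S z = fracs I S (y + z)"
proof -
  have fin: "finite S" using S by (rule finite_subset) simp
  have "frac (poly_ring n) (ideal_module I) (xprod S) (xprod S ^ t * a + xprod S ^ s * b) (s + t) = fracs I S (y + z)"
    if "(a, s) \<in> fracs I S y" "(b, t) \<in> fracs I S z" for a s b t
  proof -
    have ab: "y = xs S (- int s) * laur a" "a \<in> I" "z = xs S (- int t) * laur b" "b \<in> I"
      using that by (auto simp: fracs_def)
    have "xprod S ^ t * a + xprod S ^ s * b \<in> I"
      using S ab by (intro graded_idealD[OF I] PR_power PR_xprod)
    moreover have "y + z = xs S (- int (s + t)) * laur (xprod S ^ t * a + xprod S ^ s * b)"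
      by (simp add: ab laur_add laur_mult laur_xprod_power[OF fin] distrib_left mult.assoc[symmetric] xs_mult)
    ultimately show ?thesis by (simp add: frac_eq[OF fin])
  qed
  then have "(\<Union>(a, s)\<in>fracs I S y. \<Union>(b, t)\<in>fracs I S z.
      frac (poly_ring n) (ideal_module I) (xprod S) (xprod S ^ t * a + xprod S ^ s * b) (s + t)) =
      (\<Union>u\<in>fracs I S y. \<Union>v\<in>fracs I S z. fracs I S (y + z))"
    by (intro SUP_cong refl) auto
  also have "\<dots> = fracs I S (y + z)"
  proof -
    have "fracs I S y \<noteq> {}" "fracs I S z \<noteq> {}" using y z by (auto simp: loc_all_def fracs_def)
    then show ?thesis by simp
  qed
  finally show ?thesis by (simp add: localise_def poly_ring_nat_pow)
qed

lemma localise_abelian_group: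
  assumes S: "S \<subseteq> {1..n}"
  shows "abelian_group (localise (poly_ring n) (ideal_module I) (xprod S))"
proof -
  have fin: "finite S" using S by (rule finite_subset) simp
  note [simp] = carrier_localise[OF fin] localise_zero[OF fin] localise_add[OF S] 
    loc_all_add[OF S] loc_all_zero loc_all_uminus
  show ?thesis
  proof (rule abelian_groupI)
    fix x assume "x \<in> carrier (localise (poly_ring n) (ideal_module I) (xprod S))"
    then obtain y where y: "x = fracs I S y" "y \<in> loc_all I S" by auto
    show "\<exists>z\<in>carrier (localise (poly_ring n) (ideal_module I) (xprod S)).
        z \<oplus>\<^bsub>localise (poly_ring n) (ideal_module I) (xprod S)\<^esub> x = \<zero>\<^bsub>localise (poly_ring n) (ideal_module I) (xprod S)\<^esub>"
      by (rule bexI[of _ "fracs I S (- y)"]) (auto simp: y)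
  qed (auto simp: add_ac)
qed

lemma localise_uminus:
  assumes S: "S \<subseteq> {1..n}" and y: "y \<in> loc_all I S"
  shows "\<ominus>\<^bsub>localise (poly_ring n) (ideal_module I) (xprod S)\<^esub> fracs I S y = fracs I S (- y)"
proof -
  have fin: "finite S" using S by (rule finite_subset) simp
  interpret abelian_group "localise (poly_ring n) (ideal_module I) (xprod S)"
    by (rule localise_abelian_group[OF S])
  show ?thesis
    by (rule minus_equality)
       (use y in \<open>auto simp: carrier_localise[OF fin] localise_zero[OF fin] localise_add[OF S] loc_all_uminus\<close>)
qed

lemma localise_finsum:
  assumes S: "S \<subseteq> {1..n}" and F: "finite F" "\<And>i. i \<in> F \<Longrightarrow> y i \<in> loc_all I S"
  shows "finsum (localise (poly_ring n) (ideal_module I) (xprod S)) (\<lambda>i. fracs I S (y i)) F = fracs I S (\<Sum>i\<in>F. y i)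
    \<and> (\<Sum>i\<in>F. y i) \<in> loc_all I S"
proof -
  have fin: "finite S" using S by (rule finite_subset) simp
  interpret abelian_group "localise (poly_ring n) (ideal_module I) (xprod S)"
    by (rule localise_abelian_group[OF S])
  show ?thesis using F
  proof (induction F rule: finite_induct)
    case (insert i F)
    have "finsum (localise (poly_ring n) (ideal_module I) (xprod S)) (\<lambda>i. fracs I S (y i)) (insert i F) =
       fracs I S (y i) \<oplus>\<^bsub>localise (poly_ring n) (ideal_module I) (xprod S)\<^esub>
         finsum (localise (poly_ring n) (ideal_module I) (xprod S)) (\<lambda>i. fracs I S (y i)) F"
      using insert by (intro finsum_insert) (auto simp: carrier_localise[OF fin])
    also have "\<dots> = fracs I S (y i + (\<Sum>i\<in>F. y i))"
      using insert localise_add[OF S] by simp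
    finally show ?case using insert loc_all_add[OF S] by simp
  qed (simp add: localise_zero[OF fin] loc_all_zero)
qed

text \<open>Between localisations seen as groups of Laurent polynomials, the natural map is the
  inclusion.\<close>

lemma loc_map_fracs:
  assumes T: "T \<subseteq> {1..n}" "i \<in> T" and y: "y \<in> loc_all I (T - {i})"
  shows "loc_map (poly_ring n) (ideal_module I) (xprod (T - {i})) (pvar i) (fracs I (T - {i}) y) = fracs I T y
    \<and> y \<in> loc_all I T"
proof -
  have fin: "finite T" using T(1) by (rule finite_subset) simp
  have xT: "xprod (T - {i}) * pvar i = xprod T"
    using fin T(2) by (simp add: xprod_def prod.remove[of T i] mult.commute)
  have xs: "xs T k = xs {i} k * xs (T - {i}) k" for k
    using xs_insert[of "T - {i}" i k] fin T(2) by (simp add: insert_absorb)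
  have shift: "xs T (- int s) * laur (pvar i ^ s * a) = xs (T - {i}) (- int s) * laur a" for s and a :: "'k mpoly"
    by (simp add: xs laur_mult laur_pvar_power mult.assoc mult.left_commute[of "xs (T - {i}) _"])
  have mem: "pvar i ^ s * a \<in> I" if "a \<in> I" for s a
    using T that by (intro graded_idealD(4)[OF I] PR_power PR_pvar) auto
  have ne: "fracs I (T - {i}) y \<noteq> {}" using y by (auto simp: loc_all_def fracs_def)
  have "loc_map (poly_ring n) (ideal_module I) (xprod (T - {i})) (pvar i) (fracs I (T - {i}) y) =
      (\<Union>u\<in>fracs I (T - {i}) y. fracs I T y)"
    unfolding loc_map_def
    by (intro SUP_cong refl) (auto simp: poly_ring_nat_pow xT frac_eq[OF fin mem] shift fracs_def)
  moreover have "y \<in> loc_all I T"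
  proof -
    obtain a s where a: "y = xs (T - {i}) (- int s) * laur a" "a \<in> I" using y by (auto simp: loc_all_def)
    have "xs T (- int s) * laur (pvar i ^ s * a) \<in> loc_all I T"
      using mem[OF a(2)] unfolding loc_all_def by blast
    then show ?thesis by (simp add: shift a(1))
  qed
  ultimately show ?thesis using ne by simp
qed

section \<open>Comparison of the two Cech complexes\<close>

abbreviation (input) cmod :: "('k mpoly, 'k mpoly) module" where "cmod \<equiv> ideal_module I"

text \<open>Restricted to \<open>cech_idx n p\<close> because the elements of
  \<open>cech_group\<close> are extensional functions.\<close>

definition cechify :: "nat \<Rightarrow> (nat set \<Rightarrow> 'k laurent) \<Rightarrow> nat set \<Rightarrow> ('k mpoly \<times> nat) set" where
  "cechify p c = (\<lambda>S\<in>cech_idx n p. fracs I S (c S))"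

lemma cechify_cong: "(\<And>S. S \<in> cech_idx n p \<Longrightarrow> c S = e S) \<Longrightarrow> cechify p c = cechify p e"
  by (auto simp: cechify_def intro!: restrict_ext)

lemma cechify_inject:
  assumes "c \<in> cochains n I p r" "cechify p c = cechify p e" "S \<in> cech_idx n p"
  shows "c S = e S"
proof -
  have "fracs I S (c S) = fracs I S (e S)"
    using fun_cong[OF assms(2), of S] assms(3) by (simp add: cechify_def)
  moreover have "c S \<in> loc_all I S" using assms by (auto simp: cochains_def intro: loc_all_of_loc)
  ultimately show ?thesis using fracs_inject by blast
qed

lemma cech_group_simps:
  "carrier (cech_group n cmod (ideal_grading I) p r) = cechify p ` cochains n I p r" (is ?carr)
  "\<one>\<^bsub>cech_group n cmod (ideal_grading I) p r\<^esub> = cechify p (\<lambda>S. 0)" (is ?one)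
  "c \<in> cochains n I p r \<Longrightarrow> e \<in> cochains n I p r \<Longrightarrow>
    cechify p c \<otimes>\<^bsub>cech_group n cmod (ideal_grading I) p r\<^esub> cechify p e = cechify p (\<lambda>S. c S + e S)"
proof -
  have set_eq: "{frac (poly_ring n) cmod (xprod S) a s | a s. a \<in> ideal_grading I (r + int s * int (card S))}
      = fracs I S ` loc I S r" if "S \<in> cech_idx n p" for S
  proof (intro equalityI subsetI)
    have fin: "finite S" using cech_idxD[OF that] by blast
    {
      fix x assume "x \<in> {frac (poly_ring n) cmod (xprod S) a s | a s. a \<in> ideal_grading I (r + int s * int (card S))}"
      then obtain a s where a: "a \<in> I" "homogeneous (r + int s * int (card S)) a" "x = frac (poly_ring n) cmod (xprod S) a s"
        by (auto simp: ideal_grading_def)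
      then show "x \<in> fracs I S ` loc I S r" using locI[OF a(1,2)] by (auto simp: frac_eq[OF fin])
    next
      fix x assume "x \<in> fracs I S ` loc I S r"
      then obtain a s where a: "a \<in> I" "homogeneous (r + int s * int (card S)) a" "x = fracs I S (xs S (- int s) * laur a)"
        by (auto simp: loc_def)
      then have "x = frac (poly_ring n) cmod (xprod S) a s" by (simp add: frac_eq[OF fin])
      then show "x \<in> {frac (poly_ring n) cmod (xprod S) a s | a s. a \<in> ideal_grading I (r + int s * int (card S))}"
        using a unfolding ideal_grading_def by blast
    }
  qed
  show ?carr
  proof -
    have "carrier (cech_group n cmod (ideal_grading I) p r) = (\<Pi>\<^sub>E S\<in>cech_idx n p. fracs I S ` loc I S r)"
      unfolding cech_group_def partial_object.simps by (rule PiE_cong[OF set_eq])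
    also have "\<dots> = cechify p ` cochains n I p r"
    proof (intro equalityI subsetI)
      fix f assume f: "f \<in> (\<Pi>\<^sub>E S\<in>cech_idx n p. fracs I S ` loc I S r)"
      then have "\<forall>S\<in>cech_idx n p. \<exists>y\<in>loc I S r. f S = fracs I S y" by fastforce
      then obtain c where c: "\<And>S. S \<in> cech_idx n p \<Longrightarrow> c S \<in> loc I S r \<and> f S = fracs I S (c S)" by metis
      have "f = cechify p c"
      proof
        fix S show "f S = cechify p c S"
          using f c[of S] by (cases "S \<in> cech_idx n p") (auto simp: cechify_def PiE_def extensional_def)
      qed
      then show "f \<in> cechify p ` cochains n I p r" using c by (auto simp: cochains_def)
    qed (auto simp: cechify_def cochains_def)
    finally show ?thesis .
  qed
  show ?one
    by (auto simp: cech_group_def cechify_def localise_zero dest!: cech_idxD intro!: restrict_ext)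
  assume ce: "c \<in> cochains n I p r" "e \<in> cochains n I p r"
  show "cechify p c \<otimes>\<^bsub>cech_group n cmod (ideal_grading I) p r\<^esub> cechify p e = cechify p (\<lambda>S. c S + e S)"
  proof -
    have "fracs I S (c S) \<oplus>\<^bsub>cech_loc n cmod S\<^esub> fracs I S (e S) = fracs I S (c S + e S)" if S: "S \<in> cech_idx n p" for S
    proof (rule localise_add)
      show "S \<subseteq> {1..n}" using cech_idxD[OF S] by blast
      show "c S \<in> loc_all I S" "e S \<in> loc_all I S"
        using ce S by (auto simp: cochains_def intro: loc_all_of_loc)
    qed
    then show ?thesis by (auto simp: cech_group_def cechify_def intro!: restrict_ext)
  qed
qed

lemma cech_diff_cechify:
  assumes c: "c \<in> cochains n I p r"
  shows "cech_diff n cmod p (cechify p c) = cechify (Suc p) (cdiff c)"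
  unfolding cech_diff_def cechify_def[of "Suc p"]
proof (rule restrict_ext)
  fix T assume T: "T \<in> cech_idx n (Suc p)"
  then have T': "T \<subseteq> {1..n}" "finite T" using cech_idxD by blast+
  interpret abelian_group "localise (poly_ring n) cmod (xprod T)"
    by (rule localise_abelian_group[OF T'(1)])
  let ?y = "\<lambda>i. csgn i T * c (T - {i})"
  have *: "(let y = loc_map (poly_ring n) cmod (xprod (T - {i})) (pvar i) (cechify p c (T - {i}))
        in if even (card {j\<in>T. j < i}) then y else \<ominus>\<^bsub>cech_loc n cmod T\<^esub> y) = fracs I T (?y i)
      \<and> ?y i \<in> loc_all I T" if i: "i \<in> T" for i
  proof -
    have idx: "T - {i} \<in> cech_idx n p" by (rule cech_idx_remove[OF T i])
    then have "c (T - {i}) \<in> loc_all I (T - {i})" using c by (auto simp: cochains_def intro: loc_all_of_loc)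
    note lm = loc_map_fracs[OF T'(1) i this]
    show ?thesis
      using lm idx localise_uminus[OF T'(1)] loc_all_uminus
      by (cases "even (card {j\<in>T. j < i})") (auto simp: cechify_def csgn_def)
  qed
  have "(\<Oplus>\<^bsub>cech_loc n cmod T\<^esub> i\<in>T.
       (let y = loc_map (poly_ring n) cmod (xprod (T - {i})) (pvar i) (cechify p c (T - {i}))
        in if even (card {j\<in>T. j < i}) then y else \<ominus>\<^bsub>cech_loc n cmod T\<^esub> y)) =
     (\<Oplus>\<^bsub>cech_loc n cmod T\<^esub> i\<in>T. fracs I T (?y i))"
    using * by (intro finsum_cong') (auto simp: carrier_localise[OF T'(2)])
  also have "\<dots> = fracs I T (cdiff c T)"
    using localise_finsum[OF T', of ?y] * by (simp add: cdiff_def)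
  finally show "(\<Oplus>\<^bsub>cech_loc n cmod T\<^esub> i\<in>T.
       (let y = loc_map (poly_ring n) cmod (xprod (T - {i})) (pvar i) (cechify p c (T - {i}))
        in if even (card {j\<in>T. j < i}) then y else \<ominus>\<^bsub>cech_loc n cmod T\<^esub> y)) = fracs I T (cdiff c T)" .
qed

lemma cech_cocycles_eq:
  "cech_cocycles n cmod (ideal_grading I) p r =
    cechify p ` {c \<in> cochains n I p r. cdiff c \<in> cochains n {0} (Suc p) r}"
proof -
  have "cech_diff n cmod p (cechify p c) = cechify (Suc p) (\<lambda>S. 0) \<longleftrightarrow> cdiff c \<in> cochains n {0} (Suc p) r"
    if c: "c \<in> cochains n I p r" for c
    unfolding cech_diff_cechify[OF c]
    using cechify_inject[OF cochains_cdiff[OF I c], of "\<lambda>S. 0"] cechify_cong[of "Suc p" "cdiff c" "\<lambda>S. 0"]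
    by (auto simp: cochains_def loc_zero_ideal)
  then show ?thesis
    by (auto simp: cech_cocycles_def kernel_def cech_group_simps)
qed

lemma cech_coboundaries_eq:
  "cech_coboundaries n cmod (ideal_grading I) p r = cechify p ` cobounds n I p r"
proof (cases p)
  case (Suc q)
  have "cech_diff n cmod q ` cechify q ` cochains n I q r = cechify (Suc q) ` cdiff ` cochains n I q r"
    unfolding image_image by (intro image_cong refl cech_diff_cechify)
  then show ?thesis by (simp add: cech_coboundaries_def cobounds_def cech_group_simps Suc)
qed (simp add: cech_coboundaries_def cobounds_def cech_group_simps)

text \<open>\<open>cechify\<close> carries cocycles and coboundaries onto those of the complex of
  fractions. The quotient is then compared coset by coset: it is trivial iff every cocycle has the
  coset of the coboundaries.\<close>

theorem local_cohomology_nonzero_iff: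
  "carrier (local_cohomology n cmod (ideal_grading I) p r) \<noteq> {\<one>\<^bsub>local_cohomology n cmod (ideal_grading I) p r\<^esub>}
    \<longleftrightarrow> \<not> vanish n I {0} p r"
proof -
  let ?Z = "{c \<in> cochains n I p r. cdiff c \<in> cochains n {0} (Suc p) r}"
  let ?D = "cechify p ` cobounds n I p r"
  \<comment> \<open>The coset of \<open>z\<close>, with the coboundary as the left summand as in
    \<open>r_coset\<close>.\<close>
  define cos where "cos z = cechify p ` (\<lambda>w S. w S + z S) ` cobounds n I p r" for z
  have carr: "carrier (local_cohomology n cmod (ideal_grading I) p r) = cos ` ?Z"
  proof -
    have "?D #>\<^bsub>cech_group n cmod (ideal_grading I) p r\<lparr>carrier := cechify p ` ?Z\<rparr>\<^esub> cechify p z = cos z"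
      if "z \<in> ?Z" for z
    proof -
      have "cechify p w \<otimes>\<^bsub>cech_group n cmod (ideal_grading I) p r\<^esub> cechify p z = cechify p (\<lambda>S. w S + z S)"
        if "w \<in> cobounds n I p r" for w
        using cech_group_simps(3)[OF cobounds_sub[OF I that]] \<open>z \<in> ?Z\<close> by blast
      then show ?thesis by (auto simp: r_coset_def cos_def image_iff)
    qed
    then show ?thesis
      by (auto simp: local_cohomology_def FactGroup_def RCOSETS_def cech_cocycles_eq cech_coboundaries_eq)
  qed
  have one: "\<one>\<^bsub>local_cohomology n cmod (ideal_grading I) p r\<^esub> = ?D"
    by (simp add: local_cohomology_def FactGroup_def cech_coboundaries_eq)
  have "cos z = ?D \<longleftrightarrow> (\<exists>w\<in>cobounds n I p r. (\<lambda>S. z S - w S) \<in> cochains n {0} p r)" if z: "z \<in> ?Z" for z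
  proof
    assume "cos z = ?D"
    moreover have "cechify p z \<in> cos z"
      unfolding cos_def image_image
      using cobounds_zero[OF I, of p r] by (intro image_eqI[where x = "\<lambda>S. 0"]) (auto intro: cechify_cong)
    ultimately obtain w where "w \<in> cobounds n I p r" "cechify p z = cechify p w" by auto
    then show "\<exists>w\<in>cobounds n I p r. (\<lambda>S. z S - w S) \<in> cochains n {0} p r"
      using cechify_inject[of z p r w] z by (intro bexI[of _ w]) (auto simp: cochains_def loc_zero_ideal)
  next
    assume "\<exists>w\<in>cobounds n I p r. (\<lambda>S. z S - w S) \<in> cochains n {0} p r"
    then obtain w where w: "w \<in> cobounds n I p r" "\<And>S. S \<in> cech_idx n p \<Longrightarrow> z S = w S"
      by (auto simp: cochains_def loc_zero_ideal)
    have "cos z = cos w"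
      unfolding cos_def image_image using w(2) by (intro image_cong refl cechify_cong) simp
    also have "\<dots> = ?D"
    proof (intro equalityI subsetI)
      fix x assume "x \<in> cos w"
      then obtain v where v: "v \<in> cobounds n I p r" "x = cechify p (\<lambda>S. v S + w S)"
        by (auto simp: cos_def)
      then show "x \<in> ?D" using cobounds_add[OF I v(1) w(1)] by blast
    next
      fix x assume "x \<in> ?D"
      then obtain v where v: "v \<in> cobounds n I p r" "x = cechify p v" by blast
      have "(\<lambda>S. - w S) \<in> cobounds n I p r"
        using cobounds_mult[OF I w(1), of "- 1" 0] by (simp add: laur_uminus PR_uminus homogeneous_uminus)
      from cobounds_add[OF I v(1) this] have mem: "(\<lambda>S. v S + - w S) \<in> cobounds n I p r" .
      have "x = cechify p (\<lambda>S. (v S + - w S) + w S)" using v(2) by simp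
      then show "x \<in> cos w" unfolding cos_def image_image by (rule image_eqI[OF _ mem])
    qed
    finally show "cos z = ?D" .
  qed
  moreover have "?Z \<noteq> {}"
    using cochains_zero[OF I, of p r] by (auto intro!: exI[of _ "\<lambda>S. 0"] simp: cochains_def loc_zero_ideal cdiff_def)
  then have "cos ` ?Z = {?D} \<longleftrightarrow> (\<forall>z\<in>?Z. cos z = ?D)" by blast
  ultimately have "cos ` ?Z = {?D} \<longleftrightarrow> vanish n I {0} p r"
    unfolding vanish_def by simp blast
  then show ?thesis unfolding carr one by simp
qed

end

section \<open>The reverse lexicographic order\<close>

lemma revlex_irrefl: "\<not> revlex_less t t"
  by (simp add: revlex_less_def)

lemma revlex_trans:
  assumes "revlex_less s t" "revlex_less t u"
  shows "revlex_less s u"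
proof (cases "pdeg s < pdeg t \<or> pdeg t < pdeg u")
  case True
  then show ?thesis using assms by (auto simp: revlex_less_def)
next
  case False
  then obtain i j where i: "lookup t i < lookup s i" "\<forall>k>i. lookup t k = lookup s k"
    and j: "lookup u j < lookup t j" "\<forall>k>j. lookup u k = lookup t k"
    and deg: "pdeg s = pdeg t" "pdeg t = pdeg u"
    using assms unfolding revlex_less_def by auto
  \<comment> \<open>The later of the two deciding positions decides between \<open>s\<close> and
    \<open>u\<close>.\<close>
  have "lookup u (max i j) < lookup s (max i j)"
    using i j by (cases i j rule: linorder_cases) (auto simp: max_def)
  moreover have "\<forall>k>max i j. lookup u k = lookup s k" using i j by simp
  ultimately show ?thesis using deg unfolding revlex_less_def by auto
qed

lemma revlex_asym: "revlex_less s t \<Longrightarrow> \<not> revlex_less t s"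
  using revlex_trans revlex_irrefl by blast

lemma revlex_total:
  assumes "s \<noteq> t"
  shows "revlex_less s t \<or> revlex_less t s"
proof (cases "pdeg s = pdeg t")
  case True
  let ?D = "{i. lookup s i \<noteq> lookup t i}"
  have "?D \<subseteq> keys s \<union> keys t" by (auto simp: in_keys_iff)
  then have fin: "finite ?D" by (rule finite_subset) simp
  have ne: "?D \<noteq> {}" using assms poly_mapping_eqI[of s t] by auto
  define i where "i = Max ?D"
  have "lookup s i \<noteq> lookup t i" using Max_in[OF fin ne] by (simp add: i_def)
  moreover have "lookup s k = lookup t k" if "k > i" for k
    using Max_ge[OF fin, of k] that by (force simp: i_def)
  ultimately show ?thesis using True unfolding revlex_less_def
    by (cases "lookup s i" "lookup t i" rule: linorder_cases) auto
qed (auto simp: revlex_less_def)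

lemma revlex_add_iff [simp]: "revlex_less (u + s) (u + t) \<longleftrightarrow> revlex_less s t"
  by (simp add: revlex_less_def lookup_add)

lemma revlex_pdeg: "revlex_less s t \<Longrightarrow> pdeg s \<le> pdeg t"
  by (auto simp: revlex_less_def)

text \<open>The order refines the degree, so only finitely many monomials in \<open>n\<close>
  variables lie below a given one. Counting them gives a measure for inductions along the
  order.\<close>

definition revlex_rank :: "nat \<Rightarrow> pprod \<Rightarrow> nat" where
  "revlex_rank n t = card {s \<in> pprods n. revlex_less s t}"

lemma revlex_rank_less:
  assumes "s \<in> pprods n" "revlex_less s t"
  shows "revlex_rank n s < revlex_rank n t"
  unfolding revlex_rank_def
proof (rule psubset_card_mono)
  show "finite {s \<in> pprods n. revlex_less s t}"
    by (rule finite_subset[OF _ finite_pprods_pdeg[of n "pdeg t"]]) (auto dest: revlex_pdeg)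
  show "{r \<in> pprods n. revlex_less r s} \<subset> {s \<in> pprods n. revlex_less s t}"
    using assms revlex_trans revlex_irrefl by blast
qed

lemma ex_revlex_max:
  "finite S \<Longrightarrow> S \<noteq> {} \<Longrightarrow> \<exists>t\<in>S. \<forall>s\<in>S. s \<noteq> t \<longrightarrow> revlex_less s t"
proof (induction S rule: finite_ne_induct)
  case (insert x S)
  then obtain t where t: "t \<in> S" "\<forall>s\<in>S. s \<noteq> t \<longrightarrow> revlex_less s t" by blast
  show ?case
  proof (cases "revlex_less x t")
    case True
    then show ?thesis using t by auto
  next
    case False
    then have "revlex_less t x" using revlex_total[of x t] t insert by auto
    then have "\<forall>s\<in>insert x S. s \<noteq> x \<longrightarrow> revlex_less s x"
      using t(2) revlex_trans[of _ t x] by auto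
    then show ?thesis by blast
  qed
qed simp

lemma ex_lead: "f \<noteq> 0 \<Longrightarrow> \<exists>t. is_lead t f"
  unfolding is_lead_def Bex_def[symmetric] by (rule ex_revlex_max) simp_all

lemma is_lead_unique: "is_lead s f \<Longrightarrow> is_lead t f \<Longrightarrow> s = t"
proof (rule ccontr)
  assume "is_lead s f" "is_lead t f" "s \<noteq> t"
  then have "revlex_less s t" "revlex_less t s" by (auto simp: is_lead_def)
  then show False using revlex_asym by blast
qed

lemma is_lead_mult_mono: "is_lead t f \<Longrightarrow> is_lead (u + t) (mono u * f)"
  by (auto simp: is_lead_def keys_mult_mono)

definition leads :: "'k::comm_ring_1 mpoly set \<Rightarrow> pprod set" where
  "leads A = {t. \<exists>f\<in>A. is_lead t f}"

lemma leads_pprods: "graded_ideal n A \<Longrightarrow> t \<in> leads A \<Longrightarrow> t \<in> pprods n"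
  using graded_idealD(1) by (fastforce simp: leads_def is_lead_def PR_iff)

lemma leads_add: "graded_ideal n A \<Longrightarrow> t \<in> leads A \<Longrightarrow> u \<in> pprods n \<Longrightarrow> u + t \<in> leads A"
  unfolding leads_def using is_lead_mult_mono graded_idealD(4) PR_single by blast

lemma leads_homogeneous:
  assumes A: "graded_ideal n A" and t: "t \<in> leads A"
  shows "\<exists>f\<in>A. is_lead t f \<and> homogeneous (int (pdeg t)) f"
proof -
  obtain f where f: "f \<in> A" "is_lead t f" using t by (auto simp: leads_def)
  have "is_lead t (hcomp (int (pdeg t)) f)" using f(2) by (auto simp: is_lead_def keys_keep)
  then show ?thesis using graded_idealD(6)[OF A f(1)] homogeneous_hcomp by blast
qed

text \<open>\<open>leads A\<close> is closed under multiplication by monomials, so the polynomials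
  supported on it form an ideal. Membership in the initial ideal thus depends on the support
  alone.\<close>

lemma mono_in_initial_ideal:
  fixes A :: "'k::comm_ring_1 mpoly set"
  assumes A: "graded_ideal n A"
  shows "initial_ideal n A = {f \<in> PR n. keys f \<subseteq> leads A}"
proof -
  interpret cring "poly_ring n :: 'k mpoly ring" by (rule poly_ring_cring)
  let ?M = "{f \<in> PR n. keys f \<subseteq> leads A}"
  let ?B = "{mono t | t. \<exists>f\<in>A. is_lead t f} :: 'k mpoly set"
  have B: "?B \<subseteq> PR n" using leads_pprods[OF A] by (auto simp: leads_def intro!: PR_single)
  have "graded_ideal n ?M"
    unfolding graded_ideal_def
  proof (intro conjI ballI allI)
    show "f + g \<in> ?M" if "f \<in> ?M" "g \<in> ?M" for f g
      using that keys_add[of f g] by (auto intro: PR_add)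
    show "h * f \<in> ?M" if "f \<in> ?M" "h \<in> PR n" for f h
    proof -
      have "t \<in> leads A" if t: "t \<in> keys (h * f)" for t
      proof -
        obtain a b where "t = a + b" "a \<in> keys h" "b \<in> keys f"
          using keys_mult[of h f] t by blast
        then show ?thesis using \<open>f \<in> ?M\<close> \<open>h \<in> PR n\<close> by (auto simp: PR_iff intro!: leads_add[OF A])
      qed
      then show ?thesis using that by (auto intro: PR_mult)
    qed
    show "hcomp d f \<in> ?M" if "f \<in> ?M" for f d
      using that by (auto intro: PR_keep simp: keys_keep)
  qed auto
  moreover have "?B \<subseteq> ?M" using B by (auto simp: leads_def)
  ultimately have "initial_ideal n A \<subseteq> ?M"
    unfolding initial_ideal_def by (intro genideal_minimal graded_ideal_imp_ideal)
  moreover have "?M \<subseteq> initial_ideal n A"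
  proof
    fix f :: "'k mpoly" assume f: "f \<in> ?M"
    interpret J: ideal "initial_ideal n A" "poly_ring n"
      unfolding initial_ideal_def by (rule genideal_ideal[OF B])
    have sm: "single t (lookup f t) \<in> initial_ideal n A" if "t \<in> keys f" for t
    proof -
      have "t \<in> leads A" using f that by auto
      then have "mono t \<in> ?B" by (auto simp: leads_def)
      then have "mono t \<in> initial_ideal n A"
        unfolding initial_ideal_def using genideal_self[OF B] by blast
      from J.I_l_closed[OF this, of "single 0 (lookup f t)"]
      show ?thesis by (simp add: PR_single mult_single)
    qed
    have "(\<Sum>t\<in>F. single t (lookup f t)) \<in> initial_ideal n A"
      if F: "finite F" "F \<subseteq> keys f" for F
      using F
    proof (induction F rule: finite_induct)
      case (insert t F)
      then show ?case using J.a_closed sm by simp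
    qed (use J.zero_closed in simp)
    from this[of "keys f"] show "f \<in> initial_ideal n A"
      using poly_mapping_sum_single[of "keys f" f] by simp
  qed
  ultimately show ?thesis by (rule subset_antisym)
qed

section \<open>Evaluation homomorphisms\<close>

definition mono_eval :: "('v \<Rightarrow> 'b::comm_ring_1) \<Rightarrow> ('v \<Rightarrow>\<^sub>0 nat) \<Rightarrow> 'b" where
  "mono_eval \<sigma> t = (\<Prod>v\<in>keys t. \<sigma> v ^ lookup t v)"

lemma mono_eval_eq_prod:
  "finite S \<Longrightarrow> keys t \<subseteq> S \<Longrightarrow> mono_eval \<sigma> t = (\<Prod>v\<in>S. \<sigma> v ^ lookup t v)"
  unfolding mono_eval_def by (rule prod.mono_neutral_left) (auto simp: in_keys_iff)

lemma mono_eval_add: "mono_eval \<sigma> (s + t) = mono_eval \<sigma> s * mono_eval \<sigma> t"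
proof -
  let ?S = "keys s \<union> keys t"
  show ?thesis
    by (simp add: mono_eval_eq_prod[of ?S] keys_add_nat lookup_add power_add prod.distrib)
qed

lemma mono_eval_zero [simp]: "mono_eval \<sigma> 0 = 1"
  by (simp add: mono_eval_def)

lemma mono_eval_single [simp]: "mono_eval \<sigma> (single v k) = \<sigma> v ^ k"
  by (simp add: mono_eval_def)

lemma mono_eval_cong: "(\<And>v. v \<in> keys t \<Longrightarrow> \<sigma> v = \<tau> v) \<Longrightarrow> mono_eval \<sigma> t = mono_eval \<tau> t"
  by (simp add: mono_eval_def)

lemma poly_eval_alt: "poly_eval \<phi> \<sigma> f = (\<Sum>t\<in>keys f. \<phi> (lookup f t) * mono_eval \<sigma> t)"
  by (simp add: poly_eval_def mono_eval_def)

lemma mono_eval_pvar: "mono_eval (pvar :: nat \<Rightarrow> 'k::comm_ring_1 mpoly) t = mono t"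
proof -
  have "mono_eval (pvar :: nat \<Rightarrow> 'k mpoly) t = (\<Prod>v\<in>keys t. mono (single v (lookup t v)))"
    by (simp add: mono_eval_def pvar_power)
  also have "\<dots> = mono (\<Sum>v\<in>keys t. single v (lookup t v))"
  proof -
    have "(\<Prod>v\<in>F. mono (single v (lookup t v))) = (mono (\<Sum>v\<in>F. single v (lookup t v)) :: 'k mpoly)"
      if F: "finite F" for F using F by (induction F rule: finite_induct) (simp_all add: mult_single)
    then show ?thesis by simp
  qed
  also have "(\<Sum>v\<in>keys t. single v (lookup t v)) = t"
    using poly_mapping_sum_single[of "keys t" t] by simp
  finally show ?thesis .
qed

text \<open>Three coefficient maps are needed: constants for coordinate changes, the identity for
  polynomials in matrix entries, and constant polynomials in a parameter for the shears.\<close>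

locale coeff_hom =
  fixes \<phi> :: "'a::comm_ring_1 \<Rightarrow> 'b::comm_ring_1"
  assumes add: "\<phi> (a + b) = \<phi> a + \<phi> b" and mult: "\<phi> (a * b) = \<phi> a * \<phi> b" and one: "\<phi> 1 = 1"
begin

lemma zero [simp]: "\<phi> 0 = 0"
  using add[of 0 0] by simp

lemma sum: "\<phi> (sum f A) = (\<Sum>i\<in>A. \<phi> (f i))"
  by (induction A rule: infinite_finite_induct) (auto simp: add)

lemma eval_eq_sum:
  "finite S \<Longrightarrow> keys f \<subseteq> S \<Longrightarrow>
    poly_eval \<phi> \<sigma> f = (\<Sum>t\<in>S. \<phi> (lookup f t) * mono_eval \<sigma> t)"
  unfolding poly_eval_alt by (rule sum.mono_neutral_left) (auto simp: in_keys_iff)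

lemma eval_add: "poly_eval \<phi> \<sigma> (f + g) = poly_eval \<phi> \<sigma> f + poly_eval \<phi> \<sigma> g"
proof -
  let ?S = "keys f \<union> keys g"
  have "keys (f + g) \<subseteq> ?S" by (rule keys_add)
  then show ?thesis
    by (simp add: eval_eq_sum[of ?S] lookup_add add distrib_right sum.distrib)
qed

lemma eval_zero [simp]: "poly_eval \<phi> \<sigma> 0 = 0"
  by (simp add: poly_eval_alt)

lemma eval_single: "poly_eval \<phi> \<sigma> (single t c) = \<phi> c * mono_eval \<sigma> t"
  by (simp add: poly_eval_alt)

lemma eval_sum: "poly_eval \<phi> \<sigma> (sum f A) = (\<Sum>i\<in>A. poly_eval \<phi> \<sigma> (f i))"
  by (induction A rule: infinite_finite_induct) (auto simp: eval_add)

lemma eval_mult: "poly_eval \<phi> \<sigma> (f * g) = poly_eval \<phi> \<sigma> f * poly_eval \<phi> \<sigma> g"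
proof -
  let ?F = "keys f" and ?G = "keys g"
  have "f * g = (\<Sum>s\<in>?F. \<Sum>t\<in>?G. single (s + t) (lookup f s * lookup g t))"
    by (subst poly_mapping_sum_single[of ?F f], simp, simp,
        subst poly_mapping_sum_single[of ?G g], simp, simp)
      (simp add: sum_product mult_single)
  then show ?thesis
    by (simp add: eval_sum eval_single mono_eval_add mult) (simp add: poly_eval_alt sum_product mult_ac)
qed

lemma eval_one [simp]: "poly_eval \<phi> \<sigma> 1 = 1"
  using eval_single[of \<sigma> 0 1] by (simp add: one)

lemma eval_power: "poly_eval \<phi> \<sigma> (f ^ k) = poly_eval \<phi> \<sigma> f ^ k"
  by (induction k) (auto simp: eval_mult)

lemma eval_prod: "poly_eval \<phi> \<sigma> (prod f A) = (\<Prod>i\<in>A. poly_eval \<phi> \<sigma> (f i))"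
  by (induction A rule: infinite_finite_induct) (auto simp: eval_mult)

end

interpretation const_hom: coeff_hom "single 0 :: 'k::comm_ring_1 \<Rightarrow> 'k mpoly"
  by unfold_locales (simp_all add: single_add mult_single)

interpretation id_hom: coeff_hom "id :: 'k::comm_ring_1 \<Rightarrow> 'k"
  by unfold_locales simp_all

lemma poly_eval_pvar: "poly_eval (single 0) pvar f = f"
  for f :: "'k::comm_ring_1 mpoly"
  using poly_mapping_sum_single[of "keys f" f]
  by (simp add: poly_eval_alt mono_eval_pvar mult_single)

section \<open>Linear changes of coordinates\<close>

definition lin_form :: "nat \<Rightarrow> 'k::field mat \<Rightarrow> nat \<Rightarrow> 'k mpoly" where
  "lin_form n g j = (\<Sum>i\<in>{1..n}. single 0 (g $$ (i - 1, j - 1)) * pvar i)"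

lemma GL_act_alt: "GL_act n g = poly_eval (single 0) (lin_form n g)"
  by (simp add: GL_act_def lin_form_def[abs_def])

lemma GL_act_add: "GL_act n g (f + h) = GL_act n g f + GL_act n g h"
  and GL_act_mult: "GL_act n g (f * h) = GL_act n g f * GL_act n g h"
  and GL_act_zero [simp]: "GL_act n g 0 = 0"
  and GL_act_sum: "GL_act n g (sum F A) = (\<Sum>i\<in>A. GL_act n g (F i))"
  by (simp_all add: GL_act_alt const_hom.eval_add const_hom.eval_mult const_hom.eval_sum)

lemma GL_act_const [simp]: "GL_act n g (single 0 c) = single 0 c"
  by (simp add: GL_act_alt const_hom.eval_single)

lemma GL_act_pvar: "GL_act n g (pvar j) = lin_form n g j"
  by (simp add: GL_act_alt pvar_def const_hom.eval_single)

lemma PR_lin_form: "lin_form n g j \<in> PR n"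
  unfolding lin_form_def by (intro PR_sum PR_mult PR_single PR_pvar) auto

lemma homogeneous_lin_form: "homogeneous 1 (lin_form n g j)"
  unfolding lin_form_def
proof (rule homogeneous_sum)
  fix i show "homogeneous 1 (single 0 (g $$ (i - 1, j - 1)) * pvar i)"
    using homogeneous_mult[of 0 "single 0 (g $$ (i - 1, j - 1))" 1 "pvar i"]
    by (simp add: homogeneous_single)
qed

lemma PR_GL_act: "GL_act n g f \<in> PR n"
  unfolding GL_act_alt poly_eval_alt mono_eval_def
  by (intro PR_sum PR_mult PR_single PR_prod PR_power PR_lin_form) auto

lemma homogeneous_mono_eval:
  assumes "\<And>v. homogeneous 1 (\<sigma> v)"
  shows "homogeneous (int (pdeg t)) (mono_eval \<sigma> t)"
proof -
  have "homogeneous (int (\<Sum>v\<in>F. lookup t v)) (\<Prod>v\<in>F. \<sigma> v ^ lookup t v)"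
    if F: "finite F" for F using F
  proof (induction F rule: finite_induct)
    case (insert v F)
    then show ?case
      using homogeneous_mult[OF homogeneous_power[OF assms[of v], of "lookup t v"] insert.IH] by simp
  qed simp
  then show ?thesis by (simp add: mono_eval_def pdeg_def)
qed

lemma homogeneous_GL_act:
  assumes "homogeneous d f"
  shows "homogeneous d (GL_act n g f)"
  unfolding GL_act_alt poly_eval_alt
proof (rule homogeneous_sum)
  fix t assume "t \<in> keys f"
  then have "int (pdeg t) = d" using assms by (simp add: homogeneous_def)
  then show "homogeneous d (single 0 (lookup f t) * mono_eval (lin_form n g) t)"
    using homogeneous_mult[of 0 "single 0 (lookup f t)" _ "mono_eval (lin_form n g) t"]
      homogeneous_mono_eval[of "lin_form n g" t] homogeneous_lin_form
    by (auto simp: homogeneous_single)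
qed

lemma hcomp_GL_act: "hcomp d (GL_act n g f) = GL_act n g (hcomp d f)"
proof -
  obtain D where D: "finite D" "(\<Sum>e\<in>D. hcomp e f) = f" using ex_sum_hcomp by blast
  have kp: "keep P (sum h A) = (\<Sum>i\<in>A. keep P (h i))" for P A and h :: "int \<Rightarrow> 'a mpoly"
    by (induction A rule: infinite_finite_induct) (auto simp: keep_add)
  let ?E = "insert d D"
  have E: "(\<Sum>e\<in>?E. hcomp e f) = f"
  proof (cases "d \<in> D")
    case False
    have "hcomp d f = (\<Sum>e\<in>D. hcomp d (hcomp e f))" by (subst D(2)[symmetric]) (simp add: kp)
    also have "\<dots> = 0" using False by (intro sum.neutral) (auto simp: hcomp_homogeneous[OF homogeneous_hcomp])
    finally show ?thesis using D False by simp
  qed (use D in \<open>simp add: insert_absorb\<close>)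
  have "hcomp d (GL_act n g f) = (\<Sum>e\<in>?E. hcomp d (GL_act n g (hcomp e f)))"
    by (subst E[symmetric]) (simp only: GL_act_sum kp)
  also have "\<dots> = (\<Sum>e\<in>?E. if e = d then GL_act n g (hcomp e f) else 0)"
    by (intro sum.cong refl) (auto simp: hcomp_homogeneous[OF homogeneous_GL_act[OF homogeneous_hcomp]])
  also have "\<dots> = GL_act n g (hcomp d f)" using D(1) by (subst sum.delta) auto
  finally show ?thesis .
qed

lemma poly_eval_cong:
  "(\<And>t v. t \<in> keys f \<Longrightarrow> v \<in> keys t \<Longrightarrow> \<sigma> v = \<tau> v) \<Longrightarrow> poly_eval \<phi> \<sigma> f = poly_eval \<phi> \<tau> f"
  unfolding poly_eval_alt by (intro sum.cong refl arg_cong2[where f = "(*)"] mono_eval_cong)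

text \<open>Column \<open>j\<close> holds the coefficients of the image of \<open>x_j\<close>, so
  applying \<open>g\<close> to that image is the product of \<open>g\<close> with the
  column.\<close>

lemma GL_act_GL_act:
  assumes g: "g \<in> carrier_mat n n" and h: "h \<in> carrier_mat n n" and f: "f \<in> PR n"
  shows "GL_act n g (GL_act n h f) = GL_act n (g * h) f"
proof -
  have lin: "GL_act n g (lin_form n h j) = lin_form n (g * h) j" if j: "j \<in> {1..n}" for j
  proof -
    have "GL_act n g (lin_form n h j) = (\<Sum>i\<in>{1..n}. single 0 (h $$ (i - 1, j - 1)) * lin_form n g i)"
      by (subst lin_form_def) (simp add: GL_act_sum GL_act_mult GL_act_pvar)
    also have "\<dots> = (\<Sum>i\<in>{1..n}. \<Sum>l\<in>{1..n}. single 0 (g $$ (l - 1, i - 1) * h $$ (i - 1, j - 1)) * pvar l)"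
      unfolding lin_form_def sum_distrib_left
      by (intro sum.cong refl) (simp add: mult.assoc[symmetric] mult_single mult.commute[of "h $$ _"])
    also have "\<dots> = (\<Sum>l\<in>{1..n}. \<Sum>i\<in>{1..n}. single 0 (g $$ (l - 1, i - 1) * h $$ (i - 1, j - 1)) * pvar l)"
      by (rule sum.swap)
    also have "\<dots> = (\<Sum>l\<in>{1..n}. single 0 ((g * h) $$ (l - 1, j - 1)) * pvar l)"
    proof (intro sum.cong refl)
      fix l assume l: "l \<in> {1..n}"
      have "(g * h) $$ (l - 1, j - 1) = (\<Sum>i\<in>{0..<n}. g $$ (l - 1, i) * h $$ (i, j - 1))"
        using g h l j by (auto simp: scalar_prod_def)
      also have "\<dots> = (\<Sum>i\<in>{1..n}. g $$ (l - 1, i - 1) * h $$ (i - 1, j - 1))"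
        by (rule sum.reindex_bij_witness[of _ "\<lambda>i. i - 1" Suc]) auto
      finally have "single 0 ((g * h) $$ (l - 1, j - 1)) =
          (\<Sum>i\<in>{1..n}. single 0 (g $$ (l - 1, i - 1) * h $$ (i - 1, j - 1)) :: 'a mpoly)"
        by (simp only: const_hom.sum)
      then show "(\<Sum>i\<in>{1..n}. single 0 (g $$ (l - 1, i - 1) * h $$ (i - 1, j - 1)) * pvar l) =
          single 0 ((g * h) $$ (l - 1, j - 1)) * pvar l"
        by (simp only: sum_distrib_right)
    qed
    finally show ?thesis by (simp add: lin_form_def)
  qed
  have "GL_act n g (mono_eval (lin_form n h) t) = mono_eval (lin_form n (g * h)) t" if "t \<in> pprods n" for t
  proof -
    have "GL_act n g (mono_eval (lin_form n h) t) = mono_eval (\<lambda>v. GL_act n g (lin_form n h v)) t"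
      unfolding mono_eval_def GL_act_alt[of n g] by (simp add: const_hom.eval_prod const_hom.eval_power)
    also have "\<dots> = mono_eval (lin_form n (g * h)) t"
      by (intro mono_eval_cong lin) (use that in \<open>auto simp: pprods_def\<close>)
    finally show ?thesis .
  qed
  then show ?thesis using f
    unfolding GL_act_alt[of n h] GL_act_alt[of n "g * h"] poly_eval_alt
    by (auto simp: GL_act_sum GL_act_mult PR_iff intro!: sum.cong)
qed

lemma GL_act_one:
  fixes f :: "'k::field mpoly"
  assumes f: "f \<in> PR n"
  shows "GL_act n (1\<^sub>m n) f = f"
proof -
  have lin: "lin_form n (1\<^sub>m n) j = (pvar j :: 'k mpoly)" if j: "j \<in> {1..n}" for j
  proof -
    have "lin_form n (1\<^sub>m n) j = (\<Sum>i\<in>{1..n}. if i = j then pvar i else 0 :: 'k mpoly)"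
      unfolding lin_form_def using j by (intro sum.cong refl) auto
    then show ?thesis using j by simp
  qed
  have "GL_act n (1\<^sub>m n) f = poly_eval (single 0) pvar f"
    unfolding GL_act_alt
  proof (rule poly_eval_cong)
    fix t v assume "t \<in> keys f" "v \<in> keys t"
    then have "v \<in> {1..n}" using f by (auto simp: PR_iff pprods_def subset_iff)
    then show "lin_form n (1\<^sub>m n) v = (pvar v :: 'k mpoly)" by (rule lin)
  qed
  then show ?thesis by (simp add: poly_eval_pvar)
qed

lemma GL_inverse:
  assumes "g \<in> GL n"
  obtains h where "h \<in> GL n" "g * h = 1\<^sub>m n" "h * g = 1\<^sub>m n"
proof -
  have g: "g \<in> carrier_mat n n" using assms by (simp add: GL_def)
  obtain h where h: "g * h = 1\<^sub>m n" "h * g = 1\<^sub>m (dim_row h)"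
    using assms g by (auto simp: GL_def invertible_mat_def inverts_mat_def)
  have "dim_col h = n" using arg_cong[OF h(1), of dim_col] by simp
  moreover have "dim_row h = n" using arg_cong[OF h(2), of dim_col] g by simp
  ultimately have hc: "h \<in> carrier_mat n n" by auto
  then have "h \<in> GL n" using h g by (auto simp: GL_def invertible_mat_def inverts_mat_def)
  then show ?thesis using that h hc by auto
qed

lemma GL_carrier: "g \<in> GL n \<Longrightarrow> g \<in> carrier_mat n n"
  by (simp add: GL_def)

lemma GL_I: "g \<in> carrier_mat n n \<Longrightarrow> h \<in> carrier_mat n n \<Longrightarrow> g * h = 1\<^sub>m n \<Longrightarrow> h * g = 1\<^sub>m n \<Longrightarrow> g \<in> GL n"
  by (auto simp: GL_def invertible_mat_def inverts_mat_def)

lemma GL_one [simp]: "1\<^sub>m n \<in> GL n"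
  by (rule GL_I[of _ _ "1\<^sub>m n"]) auto

lemma GL_mult:
  assumes "g \<in> GL n" "h \<in> GL n"
  shows "g * h \<in> GL n"
proof -
  obtain g' where g': "g' \<in> GL n" "g * g' = 1\<^sub>m n" "g' * g = 1\<^sub>m n" by (rule GL_inverse[OF assms(1)])
  obtain h' where h': "h' \<in> GL n" "h * h' = 1\<^sub>m n" "h' * h = 1\<^sub>m n" by (rule GL_inverse[OF assms(2)])
  note c = assms[THEN GL_carrier] g'(1)[THEN GL_carrier] h'(1)[THEN GL_carrier]
  have "g * h * (h' * g') = g * (h * h') * g'" using c by (simp add: assoc_mult_mat[of _ n n _ n _ n])
  then have 1: "g * h * (h' * g') = 1\<^sub>m n" using c h' g' by simp
  have "h' * g' * (g * h) = h' * (g' * g) * h" using c by (simp add: assoc_mult_mat[of _ n n _ n _ n])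
  then have 2: "h' * g' * (g * h) = 1\<^sub>m n" using c h' g' by simp
  show ?thesis by (rule GL_I[OF _ _ 1 2]) (use c in auto)
qed

text \<open>Makes invertibility the nonvanishing of a polynomial function, which can be controlled
  along a line of matrices.\<close>

lemma GL_iff_det: "(g :: 'k::field mat) \<in> GL n \<longleftrightarrow> g \<in> carrier_mat n n \<and> det g \<noteq> 0"
proof
  assume g: "g \<in> GL n"
  obtain h where h: "h \<in> GL n" "g * h = 1\<^sub>m n" "h * g = 1\<^sub>m n" by (rule GL_inverse[OF g])
  have "det g * det h = det (1\<^sub>m n :: 'k mat)"
    using det_mult[OF GL_carrier[OF g] GL_carrier[OF h(1)]] by (simp add: h)
  then show "g \<in> carrier_mat n n \<and> det g \<noteq> 0" using g by (auto simp: GL_carrier)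
next
  assume g: "g \<in> carrier_mat n n \<and> det g \<noteq> 0"
  then have "g \<in> Units (ring_mat TYPE('k) n ())" by (intro det_non_zero_imp_unit) auto
  then show "g \<in> GL n" unfolding Units_def ring_mat_def using g by (auto intro: GL_I)
qed

lemma graded_ideal_GL_act:
  assumes I: "graded_ideal n I" and g: "g \<in> GL n"
  shows "graded_ideal n (GL_act n g ` I)"
  unfolding graded_ideal_def
proof (intro conjI ballI allI)
  obtain g' where g': "g' \<in> GL n" "g * g' = 1\<^sub>m n" "g' * g = 1\<^sub>m n" by (rule GL_inverse[OF g])
  show "GL_act n g ` I \<subseteq> PR n" using PR_GL_act by auto
  show "0 \<in> GL_act n g ` I" using graded_idealD(2)[OF I] by force
  fix f assume "f \<in> GL_act n g ` I"
  then obtain a where a: "a \<in> I" "f = GL_act n g a" by auto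
  show "hcomp d f \<in> GL_act n g ` I" for d
    unfolding a(2) hcomp_GL_act by (intro imageI graded_idealD(6)[OF I] a)
  show "h * f \<in> GL_act n g ` I" if h: "h \<in> PR n" for h
  proof -
    have "GL_act n g (GL_act n g' h) = h"
      using GL_act_GL_act[OF GL_carrier[OF g] GL_carrier[OF g'(1)] h] GL_act_one[OF h] g'(2) by simp
    then have "h * f = GL_act n g (GL_act n g' h * a)" by (simp add: a GL_act_mult)
    then show ?thesis using graded_idealD(4)[OF I a(1) PR_GL_act] by blast
  qed
  fix e assume "e \<in> GL_act n g ` I"
  then show "f + e \<in> GL_act n g ` I"
    using a graded_idealD(3)[OF I] by (force simp: GL_act_add[symmetric])
qed

lemma GL_act_image:
  assumes "graded_ideal n I" "g \<in> carrier_mat n n" "h \<in> carrier_mat n n"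
  shows "GL_act n g ` GL_act n h ` I = GL_act n (g * h) ` I"
  unfolding image_image using assms graded_idealD(1)[OF assms(1)] by (intro image_cong refl GL_act_GL_act) auto

section \<open>Polynomial functions on matrices\<close>

text \<open>Closure properties are immediate from the inductive form;
  \<open>poly_fun_imp_poly\<close> and \<open>poly_eval_poly_fun\<close> translate to and from the
  polynomials in \<open>zariski_open\<close>.\<close>

inductive_set poly_fun :: "nat \<Rightarrow> ('k::comm_ring_1 mat \<Rightarrow> 'k) set" for n where
  const: "(\<lambda>g. c) \<in> poly_fun n"
| entry: "i < n \<Longrightarrow> j < n \<Longrightarrow> (\<lambda>g. g $$ (i, j)) \<in> poly_fun n"
| add: "P \<in> poly_fun n \<Longrightarrow> Q \<in> poly_fun n \<Longrightarrow> (\<lambda>g. P g + Q g) \<in> poly_fun n"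
| mult: "P \<in> poly_fun n \<Longrightarrow> Q \<in> poly_fun n \<Longrightarrow> (\<lambda>g. P g * Q g) \<in> poly_fun n"

lemma poly_fun_sum: "(\<And>i. i \<in> A \<Longrightarrow> P i \<in> poly_fun n) \<Longrightarrow> (\<lambda>g. \<Sum>i\<in>A. P i g) \<in> poly_fun n"
  by (induction A rule: infinite_finite_induct) (auto intro: poly_fun.intros)

lemma poly_fun_prod: "(\<And>i. i \<in> A \<Longrightarrow> P i \<in> poly_fun n) \<Longrightarrow> (\<lambda>g. \<Prod>i\<in>A. P i g) \<in> poly_fun n"
  by (induction A rule: infinite_finite_induct) (auto intro: poly_fun.intros)

lemma poly_fun_power: "P \<in> poly_fun n \<Longrightarrow> (\<lambda>g. P g ^ k) \<in> poly_fun n"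
  by (induction k) (auto intro: poly_fun.intros)

lemma poly_fun_uminus: "P \<in> poly_fun n \<Longrightarrow> (\<lambda>g. - P g) \<in> poly_fun n"
  using poly_fun.mult[OF poly_fun.const[of "- 1"], of P n] by simp

lemma poly_fun_diff: "P \<in> poly_fun n \<Longrightarrow> Q \<in> poly_fun n \<Longrightarrow> (\<lambda>g. P g - Q g) \<in> poly_fun n"
  using poly_fun.add[OF _ poly_fun_uminus] by (metis (no_types, lifting) ext uminus_add_conv_diff add.commute)

lemma det_poly_fun: "\<exists>D\<in>poly_fun n. \<forall>g\<in>carrier_mat n n. det g = D g"
proof (rule bexI)
  let ?D = "\<lambda>g::'a mat. \<Sum>p\<in>{p. p permutes {0..<n}}. signof p * (\<Prod>i = 0..<n. g $$ (i, p i))"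
  show "\<forall>g\<in>carrier_mat n n. det g = ?D g" by (simp add: det_def')
  show "?D \<in> poly_fun n"
  proof (intro poly_fun_sum poly_fun.mult poly_fun.const poly_fun_prod poly_fun.entry)
    fix p i assume "p \<in> {p. p permutes {0..<n}}" "i \<in> {0..<n}"
    then show "i < n" "p i < n" using permutes_in_image[of p "{0..<n}" i] by auto
  qed
qed

lemma poly_fun_line:
  fixes g h :: "'k::comm_ring_1 mat"
  assumes "P \<in> poly_fun n"
  shows "\<exists>q. \<forall>c. P (mat n n (\<lambda>ij. g $$ ij + c * (h $$ ij - g $$ ij))) = poly q c"
  using assms
proof induction
  case (const c)
  show ?case by (rule exI[of _ "[:c:]"]) simp
next
  case (entry i j)
  then show ?case
    by (intro exI[of _ "[:g $$ (i, j), h $$ (i, j) - g $$ (i, j):]"]) simp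
next
  case (add P Q)
  then obtain p q where "\<forall>c. P (mat n n (\<lambda>ij. g $$ ij + c * (h $$ ij - g $$ ij))) = poly p c"
    "\<forall>c. Q (mat n n (\<lambda>ij. g $$ ij + c * (h $$ ij - g $$ ij))) = poly q c" by blast
  then show ?case by (intro exI[of _ "p + q"]) simp
next
  case (mult P Q)
  then obtain p q where "\<forall>c. P (mat n n (\<lambda>ij. g $$ ij + c * (h $$ ij - g $$ ij))) = poly p c"
    "\<forall>c. Q (mat n n (\<lambda>ij. g $$ ij + c * (h $$ ij - g $$ ij))) = poly q c" by blast
  then show ?case by (intro exI[of _ "p * q"]) simp
qed

text \<open>Restrict to the line through two matrices at which the factors do not vanish.\<close>

lemma poly_fun_mult_nonzero:
  fixes P Q :: "'k::field_char_0 mat \<Rightarrow> 'k"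
  assumes P: "P \<in> poly_fun n" "g \<in> GL n" "P g \<noteq> 0" and Q: "Q \<in> poly_fun n" "h \<in> GL n" "Q h \<noteq> 0"
  shows "\<exists>e\<in>GL n. P e \<noteq> 0 \<and> Q e \<noteq> 0"
proof -
  define L where "L c = mat n n (\<lambda>ij. g $$ ij + c * (h $$ ij - g $$ ij))" for c
  have L: "L 0 = g" "L 1 = h" "\<And>c. L c \<in> carrier_mat n n"
    using GL_carrier[OF P(2)] GL_carrier[OF Q(2)] by (auto simp: L_def)
  obtain D :: "'k mat \<Rightarrow> 'k" where D: "D \<in> poly_fun n" "\<And>g. g \<in> carrier_mat n n \<Longrightarrow> det g = D g"
    using det_poly_fun by blast
  obtain p where p: "\<And>c. P (L c) = poly p c" using poly_fun_line[OF P(1)] unfolding L_def by blast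
  obtain q where q: "\<And>c. Q (L c) = poly q c" using poly_fun_line[OF Q(1)] unfolding L_def by blast
  obtain d where d: "\<And>c. D (L c) = poly d c" using poly_fun_line[OF D(1)] unfolding L_def by blast
  have "p \<noteq> 0" using p[of 0] P(3) by (auto simp: L)
  moreover have "q \<noteq> 0" using q[of 1] Q(3) by (auto simp: L)
  \<comment> \<open>The determinant joins the product so that the point chosen on the line is
    invertible.\<close>
  moreover have "d \<noteq> 0" using d[of 0] D(2)[of g] P(2) by (auto simp: L GL_iff_det)
  ultimately have "p * q * d \<noteq> 0" by simp
  then obtain c where "poly (p * q * d) c \<noteq> 0" using poly_all_0_iff_0 by blast
  then have "P (L c) \<noteq> 0 \<and> Q (L c) \<noteq> 0 \<and> det (L c) \<noteq> 0" using L(3) by (simp add: p q d D(2))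
  then show ?thesis using L(3) by (auto simp: GL_iff_det)
qed

lemma poly_fun_prod_nonzero:
  fixes P :: "'i \<Rightarrow> 'k::field_char_0 mat \<Rightarrow> 'k"
  assumes "finite F" "\<And>i. i \<in> F \<Longrightarrow> P i \<in> poly_fun n \<and> (\<exists>g\<in>GL n. P i g \<noteq> 0)"
  shows "\<exists>g\<in>GL n. (\<Prod>i\<in>F. P i g) \<noteq> 0"
  using assms
proof (induction F rule: finite_induct)
  case empty
  show ?case by (rule bexI[OF _ GL_one]) simp
next
  case (insert i F)
  obtain g where g: "g \<in> GL n" "(\<Prod>i\<in>F. P i g) \<noteq> 0" using insert by blast
  obtain h where h: "h \<in> GL n" "P i h \<noteq> 0" using insert.prems[of i] by blast
  have F: "(\<lambda>g. \<Prod>i\<in>F. P i g) \<in> poly_fun n" using insert.prems by (intro poly_fun_prod) auto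
  have i: "P i \<in> poly_fun n" using insert.prems[of i] by blast
  obtain e where "e \<in> GL n" "P i e \<noteq> 0" "(\<Prod>i\<in>F. P i e) \<noteq> 0"
    using poly_fun_mult_nonzero[where P = "P i" and Q = "\<lambda>g. \<Prod>i\<in>F. P i g", OF i h F g] by blast
  then show ?case using insert.hyps by (intro bexI[of _ e]) auto
qed

lemma poly_fun_imp_poly:
  assumes "P \<in> poly_fun n"
  shows "\<exists>f :: ((nat \<times> nat) \<Rightarrow>\<^sub>0 nat) \<Rightarrow>\<^sub>0 'k::comm_ring_1.
    (\<forall>t\<in>keys f. keys t \<subseteq> {..<n} \<times> {..<n}) \<and>
    (\<forall>g. P g = poly_eval id (\<lambda>v. g $$ v) f)"
  using assms
proof induction
  case (const c)
  show ?case
  proof (intro exI[of _ "single 0 c"] conjI allI)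
    show "c = poly_eval id (\<lambda>v. g $$ v) (single 0 c)" for g :: "'k mat"
      unfolding id_hom.eval_single by simp
  qed simp
next
  case (entry i j)
  show ?case
  proof (intro exI[of _ "single (single (i, j) 1) 1"] conjI allI)
    show "g $$ (i, j) = poly_eval id (\<lambda>v. g $$ v) (single (single (i, j) 1) 1)" for g :: "'k mat"
      unfolding id_hom.eval_single by simp
  qed (use entry in simp)
next
  case (add P Q)
  then obtain p q :: "((nat \<times> nat) \<Rightarrow>\<^sub>0 nat) \<Rightarrow>\<^sub>0 'k" where
    pq: "\<forall>t\<in>keys p. keys t \<subseteq> {..<n} \<times> {..<n}" "\<forall>g. P g = poly_eval id (\<lambda>v. g $$ v) p"
    "\<forall>t\<in>keys q. keys t \<subseteq> {..<n} \<times> {..<n}" "\<forall>g. Q g = poly_eval id (\<lambda>v. g $$ v) q"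
    by blast
  show ?case
  proof (intro exI[of _ "p + q"] conjI allI ballI)
    show "P g + Q g = poly_eval id (\<lambda>v. g $$ v) (p + q)" for g
      unfolding id_hom.eval_add using pq by simp
    show "keys t \<subseteq> {..<n} \<times> {..<n}" if "t \<in> keys (p + q)" for t
      using keys_add[of p q] that pq(1,3) by blast
  qed
next
  case (mult P Q)
  then obtain p q :: "((nat \<times> nat) \<Rightarrow>\<^sub>0 nat) \<Rightarrow>\<^sub>0 'k" where
    pq: "\<forall>t\<in>keys p. keys t \<subseteq> {..<n} \<times> {..<n}" "\<forall>g. P g = poly_eval id (\<lambda>v. g $$ v) p"
    "\<forall>t\<in>keys q. keys t \<subseteq> {..<n} \<times> {..<n}" "\<forall>g. Q g = poly_eval id (\<lambda>v. g $$ v) q"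
    by blast
  show ?case
  proof (intro exI[of _ "p * q"] conjI allI ballI)
    show "P g * Q g = poly_eval id (\<lambda>v. g $$ v) (p * q)" for g
      unfolding id_hom.eval_mult using pq by simp
    show "keys t \<subseteq> {..<n} \<times> {..<n}" if t: "t \<in> keys (p * q)" for t
    proof -
      obtain a b where "t = a + b" "a \<in> keys p" "b \<in> keys q"
        using keys_mult[of p q] t by blast
      then show ?thesis using pq(1,3) by (simp add: keys_add_nat)
    qed
  qed
qed

lemma poly_eval_poly_fun:
  assumes "\<forall>t\<in>keys f. keys t \<subseteq> {..<n} \<times> {..<n}"
  shows "(\<lambda>g. poly_eval id (\<lambda>v. g $$ v) f) \<in> poly_fun n"
  unfolding poly_eval_def
proof (intro poly_fun_sum poly_fun.mult poly_fun.const poly_fun_prod poly_fun_power)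
  fix t v assume "t \<in> keys f" "v \<in> keys t"
  then have "v \<in> {..<n} \<times> {..<n}" using assms by blast
  then show "(\<lambda>g. g $$ v) \<in> poly_fun n" by (cases v) (auto intro: poly_fun.entry)
qed

lemma zariski_open_Int_nonempty:
  fixes U V :: "'k::field_char_0 mat set"
  assumes "zariski_open n U" "zariski_open n V" "U \<noteq> {}" "V \<noteq> {}"
  shows "U \<inter> V \<noteq> {}"
proof -
  obtain F :: "((nat \<times> nat \<Rightarrow>\<^sub>0 nat) \<Rightarrow>\<^sub>0 'k) set" where
    F: "\<forall>f\<in>F. \<forall>t\<in>keys f. keys t \<subseteq> {..<n} \<times> {..<n}"
    "U = {g \<in> GL n. \<exists>f\<in>F. poly_eval id (\<lambda>v. g $$ v) f \<noteq> 0}" using assms(1) by (auto simp: zariski_open_def)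
  obtain H :: "((nat \<times> nat \<Rightarrow>\<^sub>0 nat) \<Rightarrow>\<^sub>0 'k) set" where
    H: "\<forall>f\<in>H. \<forall>t\<in>keys f. keys t \<subseteq> {..<n} \<times> {..<n}"
    "V = {g \<in> GL n. \<exists>f\<in>H. poly_eval id (\<lambda>v. g $$ v) f \<noteq> 0}" using assms(2) by (auto simp: zariski_open_def)
  obtain g f where g: "g \<in> GL n" "f \<in> F" "poly_eval id (\<lambda>v. g $$ v) f \<noteq> 0" using assms(3) F(2) by blast
  obtain h e where h: "h \<in> GL n" "e \<in> H" "poly_eval id (\<lambda>v. h $$ v) e \<noteq> 0" using assms(4) H(2) by blast
  obtain a where "a \<in> GL n" "poly_eval id (\<lambda>v. a $$ v) f \<noteq> 0" "poly_eval id (\<lambda>v. a $$ v) e \<noteq> 0"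
    using poly_fun_mult_nonzero[OF poly_eval_poly_fun g(1,3) poly_eval_poly_fun h(1,3)] F(1) H(1) g(2) h(2) by blast
  then show ?thesis using F(2) H(2) g(2) h(2) by blast
qed

lemma zariski_open_poly_fun:
  fixes P :: "'k::field mat \<Rightarrow> 'k"
  assumes "P \<in> poly_fun n"
  shows "zariski_open n {g \<in> GL n. P g \<noteq> 0}"
proof -
  obtain f :: "((nat \<times> nat) \<Rightarrow>\<^sub>0 nat) \<Rightarrow>\<^sub>0 'k" where
    "\<forall>t\<in>keys f. keys t \<subseteq> {..<n} \<times> {..<n}"
    "\<forall>g. P g = poly_eval id (\<lambda>v. g $$ v) f" using poly_fun_imp_poly[OF assms] by blast
  then show ?thesis unfolding zariski_open_def by (intro exI[of _ "{f}"]) auto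
qed

section \<open>Dickson's lemma\<close>

lemma pprod_dvd_iff: "(\<exists>u. t = s + u) \<longleftrightarrow> (\<forall>v. lookup s v \<le> lookup t v)"
  for s t :: pprod
proof
  assume le: "\<forall>v. lookup s v \<le> lookup t v"
  have "t = s + (t - s)" by (rule poly_mapping_eqI) (use le in \<open>simp add: lookup_add lookup_minus\<close>)
  then show "\<exists>u. t = s + u" by blast
qed (auto simp: lookup_add)

text \<open>Some subsequence is monotone. If it decreases, it is constant from the place of its
  minimum on.\<close>

lemma nat_incseq_subseq: "\<exists>r :: nat \<Rightarrow> nat. strict_mono r \<and> (\<forall>i j. i \<le> j \<longrightarrow> f (r i) \<le> f (r j))" for f :: "nat \<Rightarrow> nat"
proof -
  obtain r :: "nat \<Rightarrow> nat" where r: "strict_mono r" "monoseq (\<lambda>k. f (r k))" using seq_monosub[of f] by blast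
  show ?thesis
  proof (cases "\<forall>m. \<forall>k\<ge>m. f (r m) \<le> f (r k)")
    case False
    then have dec: "\<And>m k. m \<le> k \<Longrightarrow> f (r k) \<le> f (r m)" using r(2) by (auto simp: monoseq_def)
    obtain N where N: "\<And>k. f (r N) \<le> f (r k)" using ex_has_least_nat[of "\<lambda>_. True" 0 "\<lambda>k. f (r k)"] by auto
    have "f (r (N + k)) = f (r N)" for k using dec[of N "N + k"] N[of "N + k"] by simp
    moreover have "strict_mono (\<lambda>k. r (N + k))" using r(1) by (simp add: strict_mono_def)
    ultimately show ?thesis by (intro exI[of _ "\<lambda>k. r (N + k)"]) simp
  qed (use r(1) in blast)
qed

text \<open>One variable after the other is made nondecreasing; thinning out further keeps the
  earlier ones nondecreasing.\<close>

lemma pprod_incseq_subseq: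
  fixes f :: "nat \<Rightarrow> pprod"
  shows "\<exists>r :: nat \<Rightarrow> nat. strict_mono r \<and> (\<forall>i j. i \<le> j \<longrightarrow> (\<forall>v\<in>{1..m}. lookup (f (r i)) v \<le> lookup (f (r j)) v))"
proof (induction m)
  case 0
  show ?case by (rule exI[of _ id]) (simp add: strict_mono_def)
next
  case (Suc m)
  then obtain r :: "nat \<Rightarrow> nat" where r: "strict_mono r" "\<And>i j v. i \<le> j \<Longrightarrow> v \<in> {1..m} \<Longrightarrow> lookup (f (r i)) v \<le> lookup (f (r j)) v"
    by blast
  obtain q :: "nat \<Rightarrow> nat" where q: "strict_mono q" "\<And>i j. i \<le> j \<Longrightarrow> lookup (f (r (q i))) (Suc m) \<le> lookup (f (r (q j))) (Suc m)"
    using nat_incseq_subseq[of "\<lambda>k. lookup (f (r k)) (Suc m)"] by blast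
  show ?case
  proof (intro exI[of _ "\<lambda>k. r (q k)"] conjI allI impI ballI)
    show "strict_mono (\<lambda>k. r (q k))" using r(1) q(1) by (simp add: strict_mono_def)
    fix i j v :: nat assume ij: "i \<le> j" and v: "v \<in> {1..Suc m}"
    show "lookup (f (r (q i))) v \<le> lookup (f (r (q j))) v"
    proof (cases "v = Suc m")
      case False
      have "q i \<le> q j" using q(1) ij by (simp add: strict_mono_less_eq)
      then show ?thesis using r(2)[of "q i" "q j" v] v False by simp
    qed (use q(2)[OF ij] in simp)
  qed
qed

definition min_pprods :: "pprod set \<Rightarrow> pprod set" where
  "min_pprods S = {t \<in> S. \<forall>s\<in>S. (\<exists>u. t = s + u) \<longrightarrow> s = t}"

text \<open>Among infinitely many minimal elements a nondecreasing subsequence would give two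
  distinct ones of which one divides the other.\<close>

lemma finite_min_pprods:
  assumes S: "S \<subseteq> pprods n"
  shows "finite (min_pprods S)"
proof (rule ccontr)
  assume "infinite (min_pprods S)"
  then obtain f :: "nat \<Rightarrow> pprod" where f: "inj f" "range f \<subseteq> min_pprods S" using infinite_countable_subset by blast
  obtain r :: "nat \<Rightarrow> nat" where r: "strict_mono r" "\<And>i j v. i \<le> j \<Longrightarrow> v \<in> {1..n} \<Longrightarrow> lookup (f (r i)) v \<le> lookup (f (r j)) v"
    using pprod_incseq_subseq[where m = n and f = f] by blast
  have fS: "f k \<in> S" "f k \<in> min_pprods S" for k using f(2) by (auto simp: min_pprods_def)
  have "lookup (f (r 0)) v \<le> lookup (f (r 1)) v" for v
  proof (cases "v \<in> {1..n}")
    case False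
    then have "lookup (f (r 0)) v = 0" using fS(1) S by (fastforce simp: pprods_def in_keys_iff)
    then show ?thesis by simp
  qed (use r(2) in simp)
  then have "\<exists>u. f (r 1) = f (r 0) + u" by (simp add: pprod_dvd_iff)
  then have "f (r 0) = f (r 1)" using fS by (auto simp: min_pprods_def)
  then have "r 0 = r 1" using f(1) by (simp add: inj_eq)
  then show False using r(1) by (metis strict_mono_eq zero_neq_one)
qed

lemma min_pprods_below: "t \<in> S \<Longrightarrow> \<exists>s\<in>min_pprods S. \<exists>u. t = s + u"
proof (induction "pdeg t" arbitrary: t rule: less_induct)
  case less
  show ?case
  proof (cases "t \<in> min_pprods S")
    case True
    then show ?thesis by (intro bexI[of _ t] exI[of _ 0]) auto
  next
    case False
    then obtain s u where su: "s \<in> S" "t = s + u" "s \<noteq> t" using less.prems by (auto simp: min_pprods_def)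
    then have "u \<noteq> 0" by auto
    then have "pdeg s < pdeg t" using pdeg_eq_0_iff[of u] by (simp add: su(2))
    then obtain q w where "q \<in> min_pprods S" "s = q + w" using less.hyps[OF _ su(1)] by blast
    then show ?thesis by (intro bexI[of _ q] exI[of _ "w + u"]) (simp_all add: su(2) add.assoc)
  qed
qed

section \<open>Polynomial families and generic leading terms\<close>

lemma finite_divisors: "finite {s :: pprod. \<exists>u. t = s + u}"
proof -
  let ?F = "{f::nat \<Rightarrow> nat. \<forall>i. (i \<in> keys t \<longrightarrow> f i \<in> {..pdeg t}) \<and> (i \<notin> keys t \<longrightarrow> f i = 0)}"
  have "lookup ` {s. \<exists>u. t = s + u} \<subseteq> ?F"
  proof (clarsimp, intro conjI impI)
    fix s u i assume "t = s + u"
    show "i \<in> keys (s + u) \<Longrightarrow> lookup s i \<le> pdeg s + pdeg u"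
      using lookup_le_pdeg[of s i] by simp
    show "i \<notin> keys (s + u) \<Longrightarrow> lookup s i = 0"
      by (simp add: keys_add_nat in_keys_iff)
  qed
  moreover have "finite ?F" by (rule finite_set_of_finite_funs) auto
  ultimately have "finite (lookup ` {s. \<exists>u. t = s + u})" by (rule finite_subset)
  then show ?thesis by (rule finite_imageD) (auto intro: inj_onI poly_mapping_eqI)
qed

text \<open>The range of summation depends on \<open>t\<close> alone. Sums over supports would vary
  with the matrix when the factors are families.\<close>

lemma lookup_mult_divisors:
  fixes f g :: "'k::comm_ring_1 mpoly"
  shows "lookup (f * g) t = (\<Sum>s\<in>{s. \<exists>u. t = s + u}. lookup f s * lookup g (t - s))"
proof -
  let ?D = "{s. \<exists>u. t = s + u}"
  have "f * g = (\<Sum>s\<in>keys f. single 0 (lookup f s) * (mono s * g))"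
    using poly_mapping_sum_single[of "keys f" f]
    by (simp add: sum_distrib_right[symmetric] mult.assoc[symmetric] mult_single)
  then have "lookup (f * g) t = (\<Sum>s\<in>keys f. if s \<in> ?D then lookup f s * lookup g (t - s) else 0)"
    by (simp add: lookup_sum lookup_mult_mono if_distrib cong: if_cong)
  also have "\<dots> = (\<Sum>s\<in>keys f \<inter> ?D. lookup f s * lookup g (t - s))"
    by (simp add: sum.inter_restrict)
  also have "\<dots> = (\<Sum>s\<in>?D. lookup f s * lookup g (t - s))"
    using finite_divisors[of t] by (intro sum.mono_neutral_left) (auto simp: in_keys_iff)
  finally show ?thesis .
qed

definition poly_coeffs :: "nat \<Rightarrow> ('k::field mat \<Rightarrow> 'k mpoly) \<Rightarrow> bool" where
  "poly_coeffs n F \<longleftrightarrow> (\<forall>t. (\<lambda>g. lookup (F g) t) \<in> poly_fun n)"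

lemma poly_coeffs_const: "poly_coeffs n (\<lambda>g. f)"
  by (simp add: poly_coeffs_def poly_fun.const)

lemma poly_coeffs_sum: "(\<And>i. i \<in> A \<Longrightarrow> poly_coeffs n (F i)) \<Longrightarrow> poly_coeffs n (\<lambda>g. \<Sum>i\<in>A. F i g)"
  by (auto simp: poly_coeffs_def lookup_sum intro: poly_fun_sum)

lemma poly_coeffs_mult: "poly_coeffs n F \<Longrightarrow> poly_coeffs n G \<Longrightarrow> poly_coeffs n (\<lambda>g. F g * G g)"
  by (auto simp: poly_coeffs_def lookup_mult_divisors intro!: poly_fun_sum poly_fun.mult)

lemma poly_coeffs_prod: "(\<And>i. i \<in> A \<Longrightarrow> poly_coeffs n (F i)) \<Longrightarrow> poly_coeffs n (\<lambda>g. \<Prod>i\<in>A. F i g)"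
  by (induction A rule: infinite_finite_induct) (auto intro: poly_coeffs_const poly_coeffs_mult)

lemma poly_coeffs_power: "poly_coeffs n F \<Longrightarrow> poly_coeffs n (\<lambda>g. F g ^ k)"
  by (induction k) (auto intro: poly_coeffs_const poly_coeffs_mult)

lemma poly_coeffs_GL_act:
  assumes f: "f \<in> PR n"
  shows "poly_coeffs n (\<lambda>g. GL_act n g f)"
  unfolding GL_act_alt poly_eval_alt mono_eval_def
proof (intro poly_coeffs_sum poly_coeffs_mult poly_coeffs_const poly_coeffs_prod poly_coeffs_power)
  fix t v assume "t \<in> keys f" "v \<in> keys t"
  then have v: "v \<in> {1..n}" using f by (auto simp: PR_iff pprods_def subset_iff)
  have "poly_coeffs n (\<lambda>g. single 0 (g $$ (i - 1, v - 1)))" if "i \<in> {1..n}" for i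
    unfolding poly_coeffs_def
  proof
    fix t :: pprod
    show "(\<lambda>g. lookup (single 0 (g $$ (i - 1, v - 1))) t) \<in> poly_fun n"
      using that v by (cases "t = 0") (auto simp: lookup_single intro: poly_fun.intros)
  qed
  then show "poly_coeffs n (\<lambda>g. lin_form n g v)"
    unfolding lin_form_def by (intro poly_coeffs_sum poly_coeffs_mult poly_coeffs_const)
qed

text \<open>A form in \<open>g I\<close> chosen polynomially in \<open>g\<close>. Families of the
  shape \<open>g |-> g a\<close> with \<open>a\<close> in \<open>I\<close> would not suffice, since
  cancellation multiplies by coefficients that depend on \<open>g\<close>.\<close>

definition family :: "nat \<Rightarrow> 'k::field mpoly set \<Rightarrow> nat \<Rightarrow> ('k mat \<Rightarrow> 'k mpoly) \<Rightarrow> bool" where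
  "family n I d F \<longleftrightarrow> poly_coeffs n F \<and> (\<forall>g\<in>GL n. F g \<in> GL_act n g ` I \<and> homogeneous (int d) (F g))"

text \<open>The leading term of \<open>F\<close> read as a single polynomial whose coefficients are
  functions on the matrices.\<close>

definition gen_lead :: "nat \<Rightarrow> pprod \<Rightarrow> ('k::field mat \<Rightarrow> 'k mpoly) \<Rightarrow> bool" where
  "gen_lead n t F \<longleftrightarrow> (\<exists>g\<in>GL n. lookup (F g) t \<noteq> 0) \<and>
     (\<forall>s. revlex_less t s \<longrightarrow> (\<forall>g\<in>GL n. lookup (F g) s = 0))"

definition gen_leads :: "nat \<Rightarrow> 'k::field mpoly set \<Rightarrow> pprod set" where
  "gen_leads n I = {t. \<exists>d F. family n I d F \<and> gen_lead n t F}"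

lemma gen_lead_imp_is_lead:
  assumes "gen_lead n t F" "g \<in> GL n" "lookup (F g) t \<noteq> 0"
  shows "is_lead t (F g)"
  unfolding is_lead_def
proof (intro conjI ballI impI)
  show "t \<in> keys (F g)" using assms(3) by (simp add: in_keys_iff)
  fix s assume "s \<in> keys (F g)" "s \<noteq> t"
  then show "revlex_less s t" using revlex_total[of s t] assms(1,2) by (auto simp: gen_lead_def in_keys_iff)
qed

context
  fixes n :: nat and I :: "'k::field_char_0 mpoly set"
  assumes I: "graded_ideal n I"
begin

lemma family_PR: "family n I d F \<Longrightarrow> g \<in> GL n \<Longrightarrow> F g \<in> PR n"
  using PR_GL_act by (fastforce simp: family_def)

lemma gen_leads_pprods:
  assumes "t \<in> gen_leads n I"
  shows "t \<in> pprods n"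
proof -
  obtain d F g where "family n I d F" "g \<in> GL n" "lookup (F g) t \<noteq> 0"
    using assms by (auto simp: gen_leads_def gen_lead_def)
  then have "F g \<in> PR n" "t \<in> keys (F g)" using family_PR by (auto simp: in_keys_iff)
  then show ?thesis by (auto simp: PR_iff)
qed

lemma family_mult_mono:
  assumes F: "family n I d F" and u: "u \<in> pprods n"
  shows "family n I (pdeg u + d) (\<lambda>g. mono u * F g)"
  unfolding family_def
proof (intro conjI ballI)
  show "poly_coeffs n (\<lambda>g. mono u * F g)"
    using F by (auto simp: family_def intro: poly_coeffs_mult poly_coeffs_const)
  fix g :: "'k mat" assume g: "g \<in> GL n"
  then show "mono u * F g \<in> GL_act n g ` I"
    using F graded_idealD(4)[OF graded_ideal_GL_act[OF I g]] u by (auto simp: family_def PR_single)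
  show "homogeneous (int (pdeg u + d)) (mono u * F g)"
    using F g homogeneous_mult[of "int (pdeg u)" "mono u" "int d" "F g"] by (simp add: family_def homogeneous_single)
qed

lemma gen_lead_mult_mono:
  fixes F :: "'k mat \<Rightarrow> 'k mpoly"
  assumes "gen_lead n t F"
  shows "gen_lead n (u + t) (\<lambda>g. mono u * F g)"
  unfolding gen_lead_def
proof (intro conjI allI impI ballI)
  show "\<exists>g\<in>GL n. lookup (mono u * F g) (u + t) \<noteq> 0" using assms by (auto simp: gen_lead_def)
  fix s and g :: "'k mat" assume s: "revlex_less (u + t) s" and g: "g \<in> GL n"
  show "lookup (mono u * F g) s = 0"
    using s g assms by (auto simp: lookup_mult_mono gen_lead_def)
qed

lemma family_degree:
  assumes "family n I d F" "gen_lead n t F"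
  shows "pdeg t = d"
proof -
  obtain g where "g \<in> GL n" "lookup (F g) t \<noteq> 0" using assms(2) by (auto simp: gen_lead_def)
  then show ?thesis using assms(1) by (auto simp: family_def homogeneous_def in_keys_iff)
qed

lemma family_combine:
  assumes F: "family n I d F" and G: "family n I d G" and P: "P \<in> poly_fun n" and Q: "Q \<in> poly_fun n"
  shows "family n I d (\<lambda>g. single 0 (P g) * F g - single 0 (Q g) * G g)"
  unfolding family_def
proof (intro conjI ballI)
  show "poly_coeffs n (\<lambda>g. single 0 (P g) * F g - single 0 (Q g) * G g)"
    using F G P Q by (auto simp: family_def poly_coeffs_def lookup_minus intro!: poly_fun_diff poly_fun.mult)
  fix g :: "'k mat" assume g: "g \<in> GL n"
  have A: "graded_ideal n (GL_act n g ` I)" by (rule graded_ideal_GL_act[OF I g])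
  show "single 0 (P g) * F g - single 0 (Q g) * G g \<in> GL_act n g ` I"
    using F G g by (intro graded_idealD(8)[OF A] graded_idealD(4)[OF A] PR_single) (auto simp: family_def)
  show "homogeneous (int d) (single 0 (P g) * F g - single 0 (Q g) * G g)"
    using F G g homogeneous_mult[of 0 "single 0 (P g)" "int d" "F g"]
      homogeneous_mult[of 0 "single 0 (Q g)" "int d" "G g"]
    by (intro homogeneous_diff) (auto simp: family_def homogeneous_single)
qed

text \<open>Cancelling generic leading terms with the families \<open>H\<close> keeps the leading term of \<open>F g\<close>, because
  the leading coefficients of \<open>H\<close> do not vanish at \<open>g\<close>.\<close>

lemma lead_family:
  assumes g: "g \<in> GL n"
    and H: "\<And>t. t \<in> gen_leads n I \<Longrightarrow> \<exists>d H. family n I d H \<and> gen_lead n t H \<and> lookup (H g) t \<noteq> 0"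
    and F: "family n I d F" and lead: "is_lead s (F g)"
    and b: "\<And>t h. h \<in> GL n \<Longrightarrow> revlex_rank n t \<ge> b \<Longrightarrow> lookup (F h) t = 0"
  shows "s \<in> gen_leads n I"
  using F lead b
proof (induction b arbitrary: F rule: less_induct)
  case (less b)
  \<comment> \<open>All terms occurring in some member; the fixed degree makes this set finite, so a
    generic leading term exists.\<close>
  let ?S = "{t. \<exists>h\<in>GL n. lookup (F h) t \<noteq> 0}"
  have S: "?S \<subseteq> {t \<in> pprods n. pdeg t \<le> d}"
  proof
    fix t assume "t \<in> ?S"
    then obtain h where "h \<in> GL n" "t \<in> keys (F h)" by (auto simp: in_keys_iff)
    then show "t \<in> {t \<in> pprods n. pdeg t \<le> d}"
      using family_PR[OF less.prems(1)] less.prems(1) by (auto simp: PR_iff family_def homogeneous_def)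
  qed
  moreover have "s \<in> ?S" using less.prems(2) g by (auto simp: is_lead_def in_keys_iff)
  ultimately obtain t where t: "t \<in> ?S" "\<And>r. r \<in> ?S \<Longrightarrow> r \<noteq> t \<Longrightarrow> revlex_less r t"
    using ex_revlex_max[of ?S] finite_subset[OF S finite_pprods_pdeg] by blast
  have Ft: "gen_lead n t F"
    unfolding gen_lead_def using t revlex_asym revlex_irrefl by blast
  then have tG: "t \<in> gen_leads n I" using less.prems(1) by (auto simp: gen_leads_def)
  show ?case
  proof (cases "lookup (F g) t = 0")
    case False
    then show ?thesis using gen_lead_imp_is_lead[OF Ft g] is_lead_unique less.prems(2) tG by blast
  next
    case True
    obtain e H where H: "family n I e H" "gen_lead n t H" "lookup (H g) t \<noteq> 0"
      using H[OF tG] by blast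
    have "e = d" using family_degree[OF H(1,2)] family_degree[OF less.prems(1) Ft] by simp
    \<comment> \<open>Coefficients are crossed so that no division occurs and the family stays
      polynomial. The term \<open>t\<close> cancels at every matrix, while at \<open>g\<close> the
      result is a nonzero multiple of \<open>F g\<close>.\<close>
    define F' where "F' = (\<lambda>h. single 0 (lookup (H h) t) * F h -
      single 0 (lookup (F h) t) * H h)"
    have F': "family n I d F'"
      unfolding F'_def using less.prems(1) H(1) \<open>e = d\<close>
      by (intro family_combine) (auto simp: family_def poly_coeffs_def)
    have "F' g = single 0 (lookup (H g) t) * F g" by (simp add: F'_def True)
    then have "is_lead s (F' g)"
      using less.prems(2) H(3) by (simp add: is_lead_def in_keys_iff)
    moreover have "lookup (F' h) r = 0" if h: "h \<in> GL n" and r: "revlex_rank n r \<ge> revlex_rank n t" for r h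
    proof (cases "r = t")
      case True
      then show ?thesis by (simp add: F'_def lookup_minus)
    next
      case False
      show ?thesis
      proof (cases "revlex_less t r")
        case True
        then show ?thesis using Ft H(2) h by (simp add: F'_def lookup_minus gen_lead_def)
      next
        case nl: False
        then have "revlex_less r t" using revlex_total False by blast
        then have "r \<notin> pprods n" using revlex_rank_less[of r n t] r by auto
        then show ?thesis using family_PR[OF F' h] by (auto simp: PR_iff in_keys_iff)
      qed
    qed
    moreover have "revlex_rank n t < b"
    proof (rule ccontr)
      assume "\<not> revlex_rank n t < b"
      then show False using less.prems(3)[of _ t] t(1) by auto
    qed
    ultimately show ?thesis using less.IH[OF _ F'] by blast
  qed
qed

text \<open>Monomial multiples of families reduce the condition on \<open>g\<close> to minimal
  terms. Conversely each form in \<open>g I\<close> is a value of a family \<open>h |-> h a\<close>,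
  to which \<open>lead_family\<close> applies.\<close>

lemma leads_eq_gen_leads:
  assumes g: "g \<in> GL n"
    and H: "\<And>t. t \<in> min_pprods (gen_leads n I) \<Longrightarrow> \<exists>d H. family n I d H \<and> gen_lead n t H \<and> lookup (H g) t \<noteq> 0"
  shows "leads (GL_act n g ` I) = gen_leads n I"
proof
  have H': "\<exists>d H. family n I d H \<and> gen_lead n t H \<and> lookup (H g) t \<noteq> 0" if t: "t \<in> gen_leads n I" for t
  proof -
    obtain s u where s: "s \<in> min_pprods (gen_leads n I)" "t = u + s" using min_pprods_below[OF t] add.commute by metis
    obtain d H where H: "family n I d H" "gen_lead n s H" "lookup (H g) s \<noteq> 0" using H[OF s(1)] by blast
    have "u \<in> pprods n" using gen_leads_pprods[OF t] by (simp add: s(2) pprods_add)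
    then show ?thesis
      using family_mult_mono[OF H(1)] gen_lead_mult_mono[OF H(2), of u] H(3) unfolding s(2)
      by (intro exI[of _ "pdeg u + d"] exI[of _ "\<lambda>g. mono u * H g"]) simp
  qed
  show "gen_leads n I \<subseteq> leads (GL_act n g ` I)"
  proof
    fix t assume "t \<in> gen_leads n I"
    then obtain d H where H: "family n I d H" "gen_lead n t H" "lookup (H g) t \<noteq> 0" using H' by blast
    have "H g \<in> GL_act n g ` I" using H(1) g by (simp add: family_def)
    then show "t \<in> leads (GL_act n g ` I)"
      using gen_lead_imp_is_lead[OF H(2) g H(3)] unfolding leads_def by blast
  qed
  show "leads (GL_act n g ` I) \<subseteq> gen_leads n I"
  proof
    fix s assume s: "s \<in> leads (GL_act n g ` I)"
    obtain f where f: "f \<in> GL_act n g ` I" "is_lead s f" "homogeneous (int (pdeg s)) f"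
      using leads_homogeneous[OF graded_ideal_GL_act[OF I g] s] by blast
    obtain a where a: "a \<in> I" "f = GL_act n g a" using f(1) by blast
    define d where "d = pdeg s"
    define a' where "a' = hcomp (int d) a"
    have a': "a' \<in> I" "homogeneous (int d) a'"
      unfolding a'_def by (rule graded_idealD(6)[OF I a(1)], rule homogeneous_hcomp)
    let ?F = "\<lambda>h. GL_act n h a'"
    have F: "family n I d ?F"
      unfolding family_def using poly_coeffs_GL_act[OF graded_idealD(1)[OF I a'(1)]] a'
      by (simp add: homogeneous_GL_act)
    have "?F g = hcomp (int d) f" by (simp only: a'_def hcomp_GL_act[symmetric] a(2)[symmetric])
    then have "?F g = f" using hcomp_homogeneous[OF f(3), of "int d"] by (simp only: d_def) simp
    then have lead: "is_lead s (?F g)" using f(2) by simp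
    \<comment> \<open>The sum of all ranks in degrees up to \<open>d\<close> bounds each of them and
      provides the start of the induction in \<open>lead_family\<close>.\<close>
    have b: "lookup (?F h) t = 0" if h: "h \<in> GL n" and t: "revlex_rank n t \<ge> Suc (\<Sum>r\<in>{r \<in> pprods n. pdeg r \<le> d}. revlex_rank n r)" for t h
    proof (rule ccontr)
      assume "lookup (?F h) t \<noteq> 0"
      then have "t \<in> keys (?F h)" by (simp add: in_keys_iff)
      then have "t \<in> {r \<in> pprods n. pdeg r \<le> d}"
        using family_PR[OF F h] F h by (auto simp: PR_iff family_def homogeneous_def)
      then have "revlex_rank n t \<le> (\<Sum>r\<in>{r \<in> pprods n. pdeg r \<le> d}. revlex_rank n r)"
        by (intro member_le_sum finite_pprods_pdeg) auto
      then show False using t by simp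
    qed
    show "s \<in> gen_leads n I" by (rule lead_family[OF g H' F lead b])
  qed
qed

text \<open>The open set is where the product of the leading coefficients of finitely many families,
  one for each minimal term, does not vanish.\<close>

lemma generic_leads:
  "\<exists>U. zariski_open n U \<and> U \<noteq> {} \<and> U \<subseteq> GL n \<and> (\<forall>g\<in>U. leads (GL_act n g ` I) = gen_leads n I)"
proof -
  let ?M = "min_pprods (gen_leads n I)"
  have "\<forall>t\<in>?M. \<exists>H. (\<exists>d. family n I d H) \<and> gen_lead n t H" by (auto simp: min_pprods_def gen_leads_def)
  then obtain H where H: "\<And>t. t \<in> ?M \<Longrightarrow> (\<exists>d. family n I d (H t)) \<and> gen_lead n t (H t)" by metis
  define P where "P t g = lookup (H t g) t" for t g
  have fin: "finite ?M" using finite_min_pprods[of _ n] gen_leads_pprods by blast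
  have P: "P t \<in> poly_fun n \<and> (\<exists>g\<in>GL n. P t g \<noteq> 0)" if "t \<in> ?M" for t
    using H[OF that] by (auto simp: P_def[abs_def] family_def poly_coeffs_def gen_lead_def)
  let ?U = "{g \<in> GL n. (\<Prod>t\<in>?M. P t g) \<noteq> 0}"
  have "zariski_open n ?U" using P by (intro zariski_open_poly_fun poly_fun_prod) auto
  moreover have "?U \<noteq> {}" using poly_fun_prod_nonzero[where P = P, OF fin P] by auto
  moreover have "leads (GL_act n g ` I) = gen_leads n I" if g: "g \<in> ?U" for g
  proof (rule leads_eq_gen_leads)
    fix t assume t: "t \<in> ?M"
    have "P t g \<noteq> 0" using g t fin by auto
    then show "\<exists>d H. family n I d H \<and> gen_lead n t H \<and> lookup (H g) t \<noteq> 0"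
      using H[OF t] by (auto simp: P_def)
  qed (use g in simp)
  ultimately show ?thesis by (intro exI[of _ ?U]) auto
qed

text \<open>Nonempty open sets meet, so the ideal described by \<open>THE\<close> is unique and can
  be computed on the set from \<open>generic_leads\<close>.\<close>

lemma Min_gens_Gin:
  "Min_gens n (Gin n I) = min_pprods (gen_leads n I)"
proof -
  obtain U where U: "zariski_open n U" "U \<noteq> {}" "U \<subseteq> GL n" "\<And>g. g \<in> U \<Longrightarrow> leads (GL_act n g ` I) = gen_leads n I"
    using generic_leads by blast
  let ?J = "{f \<in> PR n. keys f \<subseteq> gen_leads n I}"
  have J: "initial_ideal n (GL_act n g ` I) = ?J" if g: "g \<in> U" for g
  proof -
    have "g \<in> GL n" using g U(3) by blast
    from mono_in_initial_ideal[OF graded_ideal_GL_act[OF I this]] show ?thesis by (simp only: U(4)[OF g])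
  qed
  have "Gin n I = ?J"
    unfolding Gin_def
  proof (rule the_equality)
    show "\<exists>U. zariski_open n U \<and> U \<noteq> {} \<and> (\<forall>g\<in>U. initial_ideal n (GL_act n g ` I) = ?J)"
      using U J by blast
    fix J assume "\<exists>U. zariski_open n U \<and> U \<noteq> {} \<and> (\<forall>g\<in>U. initial_ideal n (GL_act n g ` I) = J)"
    then obtain V where V: "zariski_open n V" "V \<noteq> {}" "\<forall>g\<in>V. initial_ideal n (GL_act n g ` I) = J" by blast
    then obtain g where "g \<in> U" "g \<in> V" using zariski_open_Int_nonempty[OF U(1) V(1) U(2) V(2)] by blast
    then show "J = ?J" using J V(3) by blast
  qed
  then have "t \<in> pprods n \<Longrightarrow> mono t \<in> Gin n I \<longleftrightarrow> t \<in> gen_leads n I" for t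
    by (auto simp: PR_single)
  then show ?thesis
    using gen_leads_pprods by (auto simp: Min_gens_def min_pprods_def)
qed

end

section \<open>Stability of the generic leading terms\<close>

interpretation const_poly_hom: coeff_hom "\<lambda>a. [:single 0 a:] :: 'k::comm_ring_1 mpoly poly"
  by unfold_locales (simp_all add: single_add mult_single mult.commute)

text \<open>The substitution \<open>x_i |-> x_i + c x_j\<close> with \<open>c\<close> as the
  indeterminate of the outer polynomial, so that the derivative at \<open>c = 0\<close> is the
  coefficient of index 1.\<close>

definition shear :: "nat \<Rightarrow> nat \<Rightarrow> 'k::comm_ring_1 mpoly \<Rightarrow> 'k mpoly poly" where
  "shear i j = poly_eval (\<lambda>a. [:single 0 a:]) (\<lambda>v. if v = i then [:pvar i, pvar j:] else [:pvar v:])"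

lemma coeff_linear_power:
  fixes a b :: "'a::comm_ring_1"
  shows "coeff ([:a, b:] ^ m) 0 = a ^ m" "coeff ([:a, b:] ^ m) 1 = of_nat m * a ^ (m - 1) * b"
proof -
  show 0: "coeff ([:a, b:] ^ m) 0 = a ^ m" for m by (simp add: coeff_0_power)
  show "coeff ([:a, b:] ^ m) 1 = of_nat m * a ^ (m - 1) * b"
  proof (induction m)
    case (Suc m)
    have "coeff ([:a, b:] ^ Suc m) 1 = a * coeff ([:a, b:] ^ m) 1 + b * coeff ([:a, b:] ^ m) 0"
      by simp
    also have "\<dots> = a * (of_nat m * a ^ (m - 1) * b) + b * a ^ m" unfolding 0 Suc.IH ..
    also have "\<dots> = of_nat (Suc m) * a ^ (Suc m - 1) * b"
      by (cases m) (simp_all add: algebra_simps)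
    finally show ?case .
  qed simp
qed

text \<open>The coefficient of index 1 is \<open>x_j\<close> times the partial derivative by
  \<open>x_i\<close>. For \<open>m = 0\<close> the truncated exponent \<open>m - 1\<close> comes
  with the factor 0.\<close>

lemma shear_mono:
  fixes i j m :: nat and u :: pprod
  assumes u: "i \<notin> keys u"
  shows "coeff (shear i j (mono (single i m + u) :: 'a::comm_ring_1 mpoly)) 0 = mono (single i m + u)"
    "coeff (shear i j (mono (single i m + u) :: 'a::comm_ring_1 mpoly)) 1 =
      of_nat m * mono (single i (m - 1) + single j 1 + u)"
proof -
  let ?\<sigma> = "\<lambda>v. if v = i then [:pvar i, pvar j:] else [:pvar v:] :: 'a mpoly poly"
  have "mono_eval ?\<sigma> u = mono_eval (\<lambda>v. [:pvar v:]) u"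
    by (rule mono_eval_cong) (use u in auto)
  also have "\<dots> = [:mono u:]"
  proof -
    have pw: "[:c:] ^ k = [:c ^ k:]" for c :: "'a mpoly" and k
      by (induction k) (simp_all add: one_pCons)
    have "(\<Prod>v\<in>F. [:c v:]) = [:\<Prod>v\<in>F. c v:]" for F and c :: "nat \<Rightarrow> 'a mpoly"
      by (induction F rule: infinite_finite_induct) (simp_all add: one_pCons)
    then have "mono_eval (\<lambda>v. [:pvar v :: 'a mpoly:]) u = [:mono_eval pvar u:]"
      by (simp add: mono_eval_def pw)
    then show ?thesis by (simp add: mono_eval_pvar)
  qed
  finally have sh: "shear i j (mono (single i m + u) :: 'a mpoly) = [:pvar i, pvar j:] ^ m * [:mono u:]"
    by (simp add: shear_def const_poly_hom.eval_single mono_eval_add one_pCons[symmetric])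
  show "coeff (shear i j (mono (single i m + u) :: 'a mpoly)) 0 = mono (single i m + u)"
  proof -
    have "coeff (shear i j (mono (single i m + u) :: 'a mpoly)) 0 = mono u * coeff ([:pvar i, pvar j:] ^ m) 0"
      by (simp only: sh mult.commute[of _ "[:mono u:]"]) simp
    also have "\<dots> = mono u * mono (single i m)"
      unfolding coeff_linear_power(1) pvar_power ..
    finally show ?thesis by (simp add: mult_single add.commute)
  qed
  have "coeff (shear i j (mono (single i m + u) :: 'a mpoly)) 1 = mono u * coeff ([:pvar i, pvar j:] ^ m) 1"
    by (simp only: sh mult.commute[of _ "[:mono u:]"]) simp
  also have "\<dots> = of_nat m * (mono (single i (m - 1)) * mono (single j 1) * mono u)"
    unfolding coeff_linear_power(2) pvar_power by (simp add: pvar_def mult_ac)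
  also have "\<dots> = of_nat m * mono (single i (m - 1) + single j 1 + u)"
    by (simp add: mult_single)
  finally show "coeff (shear i j (mono (single i m + u) :: 'a mpoly)) 1 =
      of_nat m * mono (single i (m - 1) + single j 1 + u)" .
qed

context
  fixes n i j :: nat
  assumes ij: "j \<in> {1..n}" "i \<in> {1..n}" "j \<noteq> i"
begin

text \<open>Multiplication from the left adds \<open>c\<close> times row \<open>i\<close> to row
  \<open>j\<close>; on variables the matrix acts by \<open>x_i |-> x_i + c x_j\<close>.\<close>

abbreviation elem :: "'k::field \<Rightarrow> 'k mat" where
  "elem c \<equiv> addrow_mat n c (j - 1) (i - 1)"

lemma elem_carrier [simp]: "elem c \<in> carrier_mat n n"
  by (simp add: addrow_mat_def)

lemma elem_inverse: "elem c * elem (- c) = 1\<^sub>m n" "elem (- c) * elem c = 1\<^sub>m n"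
  using addrow_mat_inv[of "j - 1" n "i - 1" c] addrow_mat_inv[of "j - 1" n "i - 1" "- c"] ij by auto

lemma elem_GL: "elem c \<in> GL n"
  using GL_I[OF elem_carrier elem_carrier elem_inverse(1) elem_inverse(2)] .

lemma elem_mult_entry:
  assumes "g \<in> carrier_mat n n" "a < n" "b < n"
  shows "(elem c * g) $$ (a, b) = g $$ (a, b) + (if a = j - 1 then c * g $$ (i - 1, b) else 0)"
proof -
  have "elem c * g = addrow c (j - 1) (i - 1) g"
    using assms ij by (intro addrow_mat[symmetric, of _ n n]) auto
  then show ?thesis using assms by auto
qed

lemma lin_form_elem:
  assumes v: "v \<in> {1..n}"
  shows "lin_form n (elem c) v = (if v = i then pvar i + single 0 c * pvar j else pvar v)"
proof -
  have "lin_form n (elem c) v = (\<Sum>l\<in>{1..n}. (if l = v then pvar v else 0) + (if l = j then if v = i then single 0 c * pvar j else 0 else 0))"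
    unfolding lin_form_def
  proof (intro sum.cong refl)
    fix l assume l: "l \<in> {1..n}"
    have "elem c $$ (l - 1, v - 1) = (if l = v then 1 else 0) + (if l = j \<and> v = i then c else 0)"
      using l v ij by (auto simp: addrow_mat_def)
    then show "single 0 (elem c $$ (l - 1, v - 1)) * pvar l =
        (if l = v then pvar v else 0) + (if l = j then if v = i then single 0 c * pvar j else 0 else 0)"
      using ij by auto
  qed
  also have "\<dots> = (if v = i then pvar i + single 0 c * pvar j else pvar v)"
    using v ij by (simp add: sum.distrib)
  finally show ?thesis .
qed

lemma poly_shear:
  assumes f: "f \<in> PR n"
  shows "poly (shear i j f) (single 0 c) = GL_act n (elem c) f"
proof -
  have "poly (shear i j f) (single 0 c) =
      poly_eval (single 0) (\<lambda>v. if v = i then pvar i + single 0 c * pvar j else pvar v) f"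
    unfolding shear_def poly_eval_alt mono_eval_def
    by (simp add: poly_sum poly_prod if_distrib[of "\<lambda>p. poly p (single 0 c)"] mult.commute cong: if_cong)
  also have "\<dots> = GL_act n (elem c) f"
    unfolding GL_act_alt
  proof (rule poly_eval_cong)
    fix t v assume "t \<in> keys f" "v \<in> keys t"
    then have "v \<in> {1..n}" using f by (auto simp: PR_iff pprods_def subset_iff)
    then show "(if v = i then pvar i + single 0 c * pvar j else pvar v) = lin_form n (elem c) v"
      by (rule lin_form_elem[symmetric])
  qed
  finally show ?thesis .
qed

text \<open>\<open>P (elem (- c) * g)\<close> is a polynomial in \<open>c\<close> whose linear
  coefficient is again a polynomial function of \<open>g\<close>. Coefficients are embedded as
  constants so that they can be multiplied with a \<open>shear\<close>.\<close>

lemma poly_fun_elem: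
  fixes P :: "'k::field mat \<Rightarrow> 'k"
  assumes "P \<in> poly_fun n"
  shows "\<exists>Q. \<exists>P'\<in>poly_fun n. \<forall>g\<in>carrier_mat n n.
    (\<forall>c. poly (Q g) (single 0 c :: 'k mpoly) = single 0 (P (elem (- c) * g))) \<and>
    coeff (Q g) 0 = single 0 (P g) \<and> coeff (Q g) (Suc 0) = single 0 (P' g)"
  using assms
proof induction
  case (const a)
  show ?case
    by (intro exI[of _ "\<lambda>g. [:single 0 a:]"] bexI[of _ "\<lambda>g. 0"]) (simp_all add: poly_fun.const)
next
  case (entry a b)
  let ?P' = "\<lambda>g. if a = j - 1 then - g $$ (i - 1, b) else 0 :: 'k"
  have "?P' \<in> poly_fun n"
  proof (cases "a = j - 1")
    case True
    then show ?thesis using entry ij by (auto intro!: poly_fun_uminus poly_fun.entry)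
  qed (simp add: poly_fun.const)
  moreover have "poly [:single 0 (g $$ (a, b)), single 0 (?P' g) :: 'k mpoly:] (single 0 c) =
      single 0 ((elem (- c) * g) $$ (a, b))" if "g \<in> carrier_mat n n" for g c
    using elem_mult_entry[OF that entry] by (auto simp: mult_single single_add[symmetric])
  ultimately show ?case
    by (intro exI[of _ "\<lambda>g. [:single 0 (g $$ (a, b)), single 0 (?P' g):]"] bexI[of _ ?P']) simp_all
next
  case (add P Q)
  obtain p P' where p: "P' \<in> poly_fun n" "\<forall>g\<in>carrier_mat n n.
    (\<forall>c. poly (p g) (single 0 c :: 'k mpoly) = single 0 (P (elem (- c) * g))) \<and>
    coeff (p g) 0 = single 0 (P g) \<and> coeff (p g) (Suc 0) = single 0 (P' g)" using add.IH(1) by blast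
  obtain q Q' where q: "Q' \<in> poly_fun n" "\<forall>g\<in>carrier_mat n n.
    (\<forall>c. poly (q g) (single 0 c :: 'k mpoly) = single 0 (Q (elem (- c) * g))) \<and>
    coeff (q g) 0 = single 0 (Q g) \<and> coeff (q g) (Suc 0) = single 0 (Q' g)" using add.IH(2) by blast
  show ?case
    by (intro exI[of _ "\<lambda>g. p g + q g"] bexI[OF _ poly_fun.add[OF p(1) q(1)]]) (simp add: p(2) q(2) single_add)
next
  case (mult P Q)
  obtain p P' where p: "P' \<in> poly_fun n" "\<forall>g\<in>carrier_mat n n.
    (\<forall>c. poly (p g) (single 0 c :: 'k mpoly) = single 0 (P (elem (- c) * g))) \<and>
    coeff (p g) 0 = single 0 (P g) \<and> coeff (p g) (Suc 0) = single 0 (P' g)" using mult.IH(1) by blast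
  obtain q Q' where q: "Q' \<in> poly_fun n" "\<forall>g\<in>carrier_mat n n.
    (\<forall>c. poly (q g) (single 0 c :: 'k mpoly) = single 0 (Q (elem (- c) * g))) \<and>
    coeff (q g) 0 = single 0 (Q g) \<and> coeff (q g) (Suc 0) = single 0 (Q' g)" using mult.IH(2) by blast
  have pf: "(\<lambda>g. P g * Q' g + P' g * Q g) \<in> poly_fun n"
    using mult.hyps p(1) q(1) by (intro poly_fun.add poly_fun.mult)
  show ?case
  proof (intro exI[of _ "\<lambda>g. p g * q g"] bexI[OF _ pf] ballI conjI allI)
    fix g :: "'k mat" assume g: "g \<in> carrier_mat n n"
    show "poly (p g * q g) (single 0 c) = single 0 (P (elem (- c) * g) * Q (elem (- c) * g))" for c
      using p(2) q(2) g by (simp add: mult_single)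
    show "coeff (p g * q g) 0 = single 0 (P g * Q g)"
      using p(2) q(2) g by (simp add: mult_single coeff_mult_0)
    have "coeff (p g * q g) (Suc 0) = coeff (p g) 0 * coeff (q g) (Suc 0) + coeff (p g) (Suc 0) * coeff (q g) 0"
      by (simp add: coeff_mult)
    also have "\<dots> = single 0 (P g * Q' g + P' g * Q g)"
      using p(2) q(2) g by (simp add: mult_single single_add)
    finally show "coeff (p g * q g) (Suc 0) = single 0 (P g * Q' g + P' g * Q g)" .
  qed
qed

end

text \<open>Replacing \<open>c\<close> by \<open>2 c\<close> and subtracting \<open>2\<^sup>N\<close> times the original removes the top coefficient.\<close>

lemma coeffs_in_subspace:
  fixes Q :: "nat \<Rightarrow> 'k::field_char_0 mpoly"
  assumes add: "\<And>f g. f \<in> V \<Longrightarrow> g \<in> V \<Longrightarrow> f + g \<in> V" and scale: "\<And>a f. f \<in> V \<Longrightarrow> single 0 a * f \<in> V"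
    and zero: "0 \<in> V"
    and V: "\<And>c. (\<Sum>k\<le>N. single 0 (c ^ k) * Q k) \<in> V" and k: "k \<le> N"
  shows "Q k \<in> V"
  using V k
proof (induction N arbitrary: Q k)
  case 0
  then show ?case using "0.prems"(1)[of 1] by simp
next
  case (Suc N)
  have diff: "f - g \<in> V" if "f \<in> V" "g \<in> V" for f g
    using add[OF that(1) scale[OF that(2), of "- 1"]] by (simp add: single_uminus)
  let ?s = "\<lambda>k. (2 ^ k - 2 ^ Suc N :: 'k)"
  have s: "?s k \<noteq> 0" if "k \<le> N" for k
  proof -
    \<comment> \<open>In characteristic 0 distinct powers of 2 remain distinct.\<close>
    have "(2::nat) ^ k \<noteq> 2 ^ Suc N" using that by (simp only: power_inject_exp)
    then have "(of_nat (2 ^ k) :: 'k) \<noteq> of_nat (2 ^ Suc N)" unfolding of_nat_eq_iff .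
    then show ?thesis unfolding of_nat_power of_nat_numeral right_minus_eq .
  qed
  have "(\<Sum>k\<le>N. single 0 (c ^ k) * (single 0 (?s k) * Q k)) \<in> V" for c
  proof -
    have "(\<Sum>k\<le>Suc N. single 0 ((2 * c) ^ k) * Q k) -
        single 0 (2 ^ Suc N) * (\<Sum>k\<le>Suc N. single 0 (c ^ k) * Q k) =
        (\<Sum>k\<le>Suc N. single 0 (c ^ k) * (single 0 (?s k) * Q k))"
      unfolding sum_distrib_left sum_subtractf[symmetric]
    proof (intro sum.cong refl)
      fix k
      have e: "(2 * c) ^ k - 2 ^ Suc N * c ^ k = c ^ k * ?s k" by (simp add: power_mult_distrib algebra_simps)
      have "single 0 ((2 * c) ^ k) * Q k - single 0 (2 ^ Suc N) * (single 0 (c ^ k) * Q k) =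
          single 0 ((2 * c) ^ k - 2 ^ Suc N * c ^ k) * Q k"
        by (simp only: single_diff const_hom.mult left_diff_distrib mult.assoc)
      also have "\<dots> = single 0 (c ^ k) * (single 0 (?s k) * Q k)"
        by (simp only: e const_hom.mult mult.assoc)
      finally show "single 0 ((2 * c) ^ k) * Q k - single 0 (2 ^ Suc N) * (single 0 (c ^ k) * Q k) =
          single 0 (c ^ k) * (single 0 (?s k) * Q k)" .
    qed
    also have "\<dots> = (\<Sum>k\<le>N. single 0 (c ^ k) * (single 0 (?s k) * Q k))" by simp
    finally have eq: "(\<Sum>k\<le>Suc N. single 0 ((2 * c) ^ k) * Q k) -
        single 0 (2 ^ Suc N) * (\<Sum>k\<le>Suc N. single 0 (c ^ k) * Q k) =
        (\<Sum>k\<le>N. single 0 (c ^ k) * (single 0 (?s k) * Q k))" .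
    from diff[OF Suc.prems(1)[of "2 * c"] scale[OF Suc.prems(1)[of c], of "2 ^ Suc N"]]
    show ?thesis unfolding eq .
  qed
  note IH = Suc.IH[OF this]
  have le: "Q k \<in> V" if "k \<le> N" for k
    using scale[OF IH[OF that], of "inverse (?s k)"] s[OF that]
    by (simp add: mult.assoc[symmetric] mult_single)
  have "(\<Sum>k\<le>N. Q k) \<in> V"
  proof -
    have "(\<Sum>k\<in>F. Q k) \<in> V" if "finite F" "F \<subseteq> {..N}" for F
      using that by (induction F rule: finite_induct) (auto intro: add zero le)
    then show ?thesis by simp
  qed
  moreover have "(\<Sum>k\<le>N. Q k) + Q (Suc N) \<in> V" using Suc.prems(1)[of 1] by simp
  ultimately have "Q (Suc N) \<in> V" using diff by fastforce
  then show ?case using le Suc.prems(2) by (cases "k = Suc N") auto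
qed

text \<open>A polynomial curve inside a subspace has its derivatives there; applied to the linear
  coefficient.\<close>

lemma poly_coeffs_in_subspace:
  fixes W :: "'k::field_char_0 mpoly poly"
  assumes "\<And>f g. f \<in> V \<Longrightarrow> g \<in> V \<Longrightarrow> f + g \<in> V" "\<And>a f. f \<in> V \<Longrightarrow> single 0 a * f \<in> V" "0 \<in> V"
    and W: "\<And>c. poly W (single 0 c) \<in> V"
  shows "coeff W k \<in> V"
proof (cases "k \<le> degree W")
  case True
  have pw: "single 0 c ^ k = (single 0 (c ^ k) :: 'k mpoly)" for c k
    by (induction k) (simp_all add: mult_single)
  have "(\<Sum>k\<le>degree W. single 0 (c ^ k) * coeff W k) \<in> V" for c
    using W[of c] by (simp add: poly_altdef pw mult.commute)
  then show ?thesis using True by (intro coeffs_in_subspace[where N = "degree W" and Q = "coeff W", OF assms(1-3)])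
qed (simp add: coeff_eq_0 assms(3))

text \<open>Take the derivative of \<open>E(c) F(E(-c) g)\<close>, where \<open>E(c)\<close> is the substitution \<open>x\<^sub>i \<mapsto> x\<^sub>i + c x\<^sub>j\<close>, at \<open>c = 0\<close>.  Up to terms which are not larger than the generic
  leading term \<open>t\<close> of \<open>F\<close> it is \<open>x\<^sub>j \<partial>F/\<partial>x\<^sub>i\<close>, whose generic leading term is \<open>t x\<^sub>j / x\<^sub>i\<close>.\<close>

lemma gen_leads_stable:
  fixes I :: "'k::field_char_0 mpoly set"
  assumes I: "graded_ideal n I" and t: "single i 1 + u \<in> gen_leads n I" and ij: "j \<in> {1..n}" "j < i"
  shows "single j 1 + u \<in> gen_leads n I"
proof -
  let ?t = "single i 1 + u" and ?t' = "single j 1 + u"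
  have "?t \<in> pprods n" by (rule gen_leads_pprods[OF I t])
  then have i: "i \<in> {1..n}" "u \<in> pprods n" by (auto simp: pprods_add pprods_single)
  have ij': "j \<in> {1..n}" "i \<in> {1..n}" "j \<noteq> i" using ij i by auto
  note elem = elem_carrier[OF ij'] elem_inverse[OF ij'] elem_GL[OF ij']
  let ?E = "\<lambda>c::'k. addrow_mat n c (j - 1) (i - 1)"
  obtain d F where F: "family n I d F" "gen_lead n ?t F" using t by (auto simp: gen_leads_def)
  define P where "P s = (\<lambda>g. lookup (F g) s)" for s
  have Pf: "P s \<in> poly_fun n" for s using F(1) by (simp add: P_def family_def poly_coeffs_def)
  have "\<forall>s. \<exists>Q. \<exists>P'\<in>poly_fun n. \<forall>g\<in>carrier_mat n n.
    (\<forall>c. poly (Q g) (single 0 c :: 'k mpoly) = single 0 (P s (?E (- c) * g))) \<and>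
    coeff (Q g) 0 = single 0 (P s g) \<and> coeff (Q g) (Suc 0) = single 0 (P' g)"
    using poly_fun_elem[OF ij' Pf] by blast
  then obtain Q P' where P': "\<And>s. P' s \<in> poly_fun n" and
    Q: "\<And>s g c. g \<in> carrier_mat n n \<Longrightarrow> poly (Q s g) (single 0 c :: 'k mpoly) = single 0 (P s (?E (- c) * g))"
    "\<And>s g. g \<in> carrier_mat n n \<Longrightarrow> coeff (Q s g) 0 = single 0 (P s g)"
    "\<And>s g. g \<in> carrier_mat n n \<Longrightarrow> coeff (Q s g) (Suc 0) = single 0 (P' s g)" by metis
  define M where "M = {s \<in> pprods n. pdeg s = d}"
  have finM: "finite M" unfolding M_def by (rule finite_subset[OF _ finite_pprods_pdeg[of n d]]) auto
  define D where "D s = coeff (shear i j (mono s :: 'k mpoly)) (Suc 0)" for s :: pprod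
  \<comment> \<open>\<open>W g\<close> is \<open>E(c) F(E(-c) g)\<close> as a polynomial in
    \<open>c\<close>, and \<open>G g\<close> is its derivative at 0. The part with \<open>D\<close>
    comes from moving the variables, the part with \<open>P'\<close> from moving the matrix.\<close>
  define W where "W g = (\<Sum>s\<in>M. Q s g * shear i j (mono s))" for g
  define G where "G g = (\<Sum>s\<in>M. single 0 (P s g) * D s + single 0 (P' s g) * mono s)" for g
  have split: "\<exists>m w. s = single i m + w \<and> i \<notin> keys w" for s :: pprod
  proof (intro exI conjI)
    show "s = single i (lookup s i) + (s - single i (lookup s i))"
      by (rule poly_mapping_eqI) (auto simp: lookup_add lookup_minus lookup_single when_def)
    show "i \<notin> keys (s - single i (lookup s i))"
      by (simp add: in_keys_iff lookup_minus)
  qed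
  have shear0: "coeff (shear i j (mono s)) 0 = (mono s :: 'k mpoly)" for s
    using split[of s] shear_mono(1)[where ?'a = 'k] by blast
  have GW: "G g = coeff (W g) (Suc 0)" if g: "g \<in> carrier_mat n n" for g
  proof -
    have "coeff (p * q) (Suc 0) = coeff p 0 * coeff q (Suc 0) + coeff p (Suc 0) * coeff q 0" for p q :: "'k mpoly poly"
      by (simp add: coeff_mult)
    then show ?thesis by (simp only: W_def G_def coeff_sum Q(2,3)[OF g] shear0 D_def)
  qed
  have Fsum: "F g = (\<Sum>s\<in>M. single 0 (P s g) * mono s)" if g: "g \<in> GL n" for g
  proof -
    have "keys (F g) \<subseteq> M"
      using family_PR[OF I F(1) g] F(1) g by (auto simp: PR_iff family_def homogeneous_def M_def)
    from poly_mapping_sum_single[OF finM this] show ?thesis by (simp add: P_def mult_single)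
  qed
  have Wc: "poly (W g) (single 0 c) = GL_act n (?E c) (F (?E (- c) * g))" if g: "g \<in> GL n" for g c
  proof -
    have "poly (W g) (single 0 c) =
        (\<Sum>s\<in>M. single 0 (P s (?E (- c) * g)) * GL_act n (?E c) (mono s))"
      unfolding W_def poly_sum poly_mult Q(1)[OF GL_carrier[OF g]]
      by (intro sum.cong refl arg_cong2[where f = "(*)"] poly_shear[OF ij']) (simp add: M_def PR_single)
    also have "\<dots> = GL_act n (?E c) (F (?E (- c) * g))"
      unfolding Fsum[OF GL_mult[OF elem(4) g]] by (simp add: GL_act_sum GL_act_mult)
    finally show ?thesis .
  qed
  have G_in: "G g \<in> GL_act n g ` I" if g: "g \<in> GL n" for g
  proof -
    have A: "graded_ideal n (GL_act n g ` I)" by (rule graded_ideal_GL_act[OF I g])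
    \<comment> \<open>The two shears cancel: \<open>E(c)\<close> maps \<open>E(-c) g I\<close> onto
      \<open>g I\<close>, so the whole curve stays in \<open>g I\<close>.\<close>
    have "poly (W g) (single 0 c) \<in> GL_act n g ` I" for c
    proof -
      have "F (?E (- c) * g) \<in> GL_act n (?E (- c) * g) ` I"
        using F(1) GL_mult[OF elem(4) g] by (simp add: family_def)
      then have "poly (W g) (single 0 c) \<in> GL_act n (?E c) ` GL_act n (?E (- c) * g) ` I"
        unfolding Wc[OF g] by (rule imageI)
      also have "GL_act n (?E c) ` GL_act n (?E (- c) * g) ` I = GL_act n (?E c * (?E (- c) * g)) ` I"
        using elem(1) GL_carrier[OF g] by (intro GL_act_image[OF I]) auto
      also have "?E c * (?E (- c) * g) = g"
      proof -
        have "?E c * (?E (- c) * g) = ?E c * ?E (- c) * g"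
          by (rule assoc_mult_mat[OF elem(1) elem(1) GL_carrier[OF g], symmetric])
        also have "\<dots> = g" unfolding elem(2) using GL_carrier[OF g] by simp
        finally show ?thesis .
      qed
      finally show ?thesis .
    qed
    then have "coeff (W g) (Suc 0) \<in> GL_act n g ` I"
      by (intro poly_coeffs_in_subspace graded_idealD(2,3)[OF A] graded_idealD(4)[OF A] PR_single) auto
    then show ?thesis by (simp add: GW GL_carrier[OF g])
  qed
  have D_eq: "D (single i m + w) = of_nat m * mono (single i (m - 1) + single j 1 + w)"
    if "i \<notin> keys w" for m w
    using shear_mono(2)[OF that, where ?'a = 'k] unfolding D_def by simp
  have lookup_D: "lookup (D s) (single j 1 + w) =
      (if s = single i 1 + w then of_nat (lookup s i) else 0)" for s w
  proof -
    obtain m v where s: "s = single i m + v" "i \<notin> keys v" using split by blast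
    have m: "m = lookup s i" using s by (simp add: lookup_add in_keys_iff)
    have *: "lookup (of_nat m * mono r :: 'k mpoly) q = (if q = r then of_nat m else 0)" for r q
      using lookup_mult_const[of "of_nat m :: 'k" "mono r" q] by (auto simp: lookup_single when_def simp flip: single_of_nat)
    have Ds: "D s = of_nat m * mono (single i (m - 1) + single j 1 + v)"
      unfolding s(1) by (rule D_eq[OF s(2)])
    show ?thesis
    proof (cases m)
      case 0
      have "s \<noteq> single i 1 + w"
      proof
        assume "s = single i 1 + w"
        then have "lookup s i \<noteq> 0" by (simp add: lookup_add)
        then show False using m 0 by simp
      qed
      moreover have "D s = 0" by (simp add: Ds 0)
      ultimately show ?thesis by simp
    next
      case (Suc k)
      have "single i (m - 1) + single j 1 + v = single j 1 + (single i k + v)"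
        by (simp add: Suc ac_simps)
      then have A: "single j 1 + w = single i (m - 1) + single j 1 + v \<longleftrightarrow> w = single i k + v"
        by (simp only: add_left_cancel)
      have "single i m = single i 1 + single i k"
        by (simp add: Suc single_add[symmetric])
      then have "s = single i 1 + (single i k + v)"
        by (simp only: s(1) add.assoc)
      then have B: "s = single i 1 + w \<longleftrightarrow> w = single i k + v"
        by (auto simp only: add_left_cancel)
      show ?thesis by (simp only: Ds * A B m[symmetric])
    qed
  qed
  have tt': "revlex_less ?t ?t'"
    unfolding revlex_less_def using ij
    by (intro disjI2 conjI exI[of _ i]) (auto simp: lookup_add lookup_single)
  \<comment> \<open>The coefficient of \<open>F\<close> at \<open>s\<close> vanishes on all of
    \<open>GL n\<close>, in particular along \<open>E(-c) g\<close>, and hence so does its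
    derivative.\<close>
  have P'_zero: "P' s g = 0" if s: "revlex_less ?t s" and g: "g \<in> GL n" for s g
  proof -
    have "poly (Q s g) (single 0 c) \<in> {0}" for c
      using F(2) s GL_mult[OF elem(4) g] by (simp add: Q(1)[OF GL_carrier[OF g]] P_def gen_lead_def)
    then have "coeff (Q s g) (Suc 0) \<in> {0}" by (intro poly_coeffs_in_subspace) auto
    then show ?thesis using Q(3)[OF GL_carrier[OF g]] by (metis singletonD lookup_single_eq lookup_zero)
  qed
  \<comment> \<open>Beyond \<open>t\<close> only \<open>x_j\<close> times the derivative of
    \<open>F\<close> by \<open>x_i\<close> contributes. Its factor is the exponent of
    \<open>x_i\<close>, which is nonzero in characteristic 0.\<close>
  have lookup_G: "lookup (G g) (single j 1 + w) =
      (if single i 1 + w \<in> M then P (single i 1 + w) g * of_nat (Suc (lookup w i)) else 0)"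
    if g: "g \<in> GL n" and w: "revlex_less ?t (single j 1 + w)" for g w
  proof -
    let ?s = "single i 1 + w"
    have "lookup (G g) (single j 1 + w) =
        (\<Sum>s\<in>M. P s g * lookup (D s) (single j 1 + w) +
          P' s g * (if s = single j 1 + w then 1 else 0))"
      by (simp add: G_def lookup_sum lookup_add lookup_single when_def)
    also have "\<dots> = (\<Sum>s\<in>M. if s = ?s then P ?s g * of_nat (Suc (lookup w i)) else 0)"
    proof (intro sum.cong refl)
      fix s
      have "P' s g * (if s = single j 1 + w then 1 else 0) = 0"
        by (cases "s = single j 1 + w") (simp_all only: P'_zero[OF w g] if_True if_False mult_zero_right mult_zero_left)
      moreover have "lookup ?s i = Suc (lookup w i)" by (simp add: lookup_add)
      ultimately show "P s g * lookup (D s) (single j 1 + w) +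
          P' s g * (if s = single j 1 + w then 1 else 0) =
          (if s = ?s then P ?s g * of_nat (Suc (lookup w i)) else 0)"
        unfolding lookup_D by (cases "s = ?s") (simp_all only: simp_thms if_True if_False add_0_right mult_zero_right)
    qed
    finally show ?thesis using finM by simp
  qed
  have "family n I d G"
    unfolding family_def
  proof (intro conjI ballI)
    show "poly_coeffs n G"
      unfolding poly_coeffs_def G_def
      by (auto simp: lookup_sum lookup_add intro!: poly_fun_sum poly_fun.add poly_fun.mult poly_fun.const Pf P')
    fix g :: "'k mat" assume g: "g \<in> GL n"
    show "G g \<in> GL_act n g ` I" by (rule G_in[OF g])
    show "homogeneous (int d) (G g)"
      unfolding G_def
    proof (intro homogeneous_sum homogeneous_add)
      fix s assume s: "s \<in> M"
      obtain m v where sv: "s = single i m + v" "i \<notin> keys v" using split by blast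
      have "keys (single 0 (P s g) * D s) \<subseteq> keys (D s)"
        by (auto simp: in_keys_iff)
      moreover have "homogeneous (int d) (D s)"
        unfolding sv(1) D_eq[OF sv(2)] using s
        by (cases m) (auto simp: sv(1) M_def homogeneous_single mult_single simp flip: single_of_nat)
      ultimately show "homogeneous (int d) (single 0 (P s g) * D s)" by (auto simp: homogeneous_def)
      show "homogeneous (int d) (single 0 (P' s g) * mono s)"
        using s by (simp add: mult_single homogeneous_single M_def)
    qed
  qed
  moreover have "gen_lead n ?t' G"
    unfolding gen_lead_def
  proof (intro conjI allI impI ballI)
    obtain g where g: "g \<in> GL n" "lookup (F g) ?t \<noteq> 0" using F(2) by (auto simp: gen_lead_def)
    have "?t \<in> M" using i \<open>?t \<in> pprods n\<close> family_degree[OF I F] by (simp add: M_def)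
    then have "lookup (G g) ?t' \<noteq> 0"
      using lookup_G[OF g(1) tt'] g(2) by (simp add: P_def del: of_nat_Suc)
    then show "\<exists>g\<in>GL n. lookup (G g) ?t' \<noteq> 0" using g(1) by blast
  next
    fix s and g :: "'k mat" assume s: "revlex_less ?t' s" and g: "g \<in> GL n"
    have ts: "revlex_less ?t s" by (rule revlex_trans[OF tt' s])
    show "lookup (G g) s = 0"
    proof (cases "\<exists>w. s = single j 1 + w")
      case True
      then obtain w where w: "s = single j 1 + w" by blast
      have "revlex_less u w" using s by (simp add: w)
      then have "revlex_less ?t (single i 1 + w)" by simp
      then have "P (single i 1 + w) g = 0" using F(2) g by (simp add: P_def gen_lead_def)
      then show ?thesis using lookup_G[OF g ts[unfolded w]] by (simp add: w)
    next
      case False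
      have "lookup (D r) s = 0" for r
      proof -
        obtain m v where r: "r = single i m + v" "i \<notin> keys v" using split by blast
        have "s \<noteq> single i (m - 1) + single j 1 + v"
          using False by (metis add.assoc add.left_commute)
        then show ?thesis unfolding r(1) D_eq[OF r(2)]
          by (auto simp: lookup_single when_def mult_single simp flip: single_of_nat)
      qed
      then have "lookup (G g) s = (\<Sum>r\<in>M. P' r g * (if r = s then 1 else 0))"
        by (simp add: G_def lookup_sum lookup_add lookup_single when_def)
      also have "\<dots> = 0" using P'_zero[OF ts g] by (intro sum.neutral) auto
      finally show ?thesis .
    qed
  qed
  ultimately show ?thesis unfolding gen_leads_def by blast
qed

section \<open>Cutting by the last variables\<close>

definition high :: "nat \<Rightarrow> pprod \<Rightarrow> bool" where
  "high i t \<longleftrightarrow> (\<exists>v\<in>keys t. i < v)"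

lemma pprods_high_iff: "t \<in> pprods n \<Longrightarrow> i \<le> n \<Longrightarrow> t \<in> pprods i \<longleftrightarrow> \<not> high i t"
  by (auto simp: pprods_def high_def subset_iff not_less)

text \<open>At the last variable of \<open>s\<close>, which comes after \<open>x_i\<close>, the
  exponent is positive in \<open>s\<close> and zero in \<open>t\<close>; beyond it both
  vanish.\<close>

lemma high_less:
  assumes "high i s" "\<not> high i t" "pdeg s = pdeg t"
  shows "revlex_less s t"
proof -
  have ne: "keys s \<noteq> {}" using assms(1) by (auto simp: high_def)
  define v where "v = Max (keys s)"
  have v: "v \<in> keys s" unfolding v_def using ne by (intro Max_in) auto
  have above: "lookup s k = 0" if "v < k" for k
  proof -
    have "k \<notin> keys s"
    proof
      assume "k \<in> keys s"
      then have "k \<le> v" unfolding v_def by (intro Max_ge) simp_all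
      then show False using that by simp
    qed
    then show ?thesis by (simp add: in_keys_iff)
  qed
  obtain w where "w \<in> keys s" "i < w" using assms(1) by (auto simp: high_def)
  moreover from this have "w \<le> v" unfolding v_def by (intro Max_ge) simp_all
  ultimately have iv: "i < v" by simp
  have "lookup t k = 0" if vk: "v \<le> k" for k
  proof (rule ccontr)
    assume "lookup t k \<noteq> 0"
    then have "k \<in> keys t" by (simp add: in_keys_iff)
    moreover have "i < k" using vk iv by simp
    ultimately show False using assms(2) unfolding high_def by blast
  qed
  then show ?thesis unfolding revlex_less_def
    using assms(3) v above by (intro disjI2 conjI exI[of _ v]) (auto simp: in_keys_iff)
qed

text \<open>The deciding position is at most \<open>i\<close>. If it is \<open>i\<close>, the
  exponent in \<open>s\<close> is the larger one, and otherwise the exponents of \<open>x_i\<close>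
  agree.\<close>

lemma revlex_less_low_keys:
  assumes "revlex_less s t" "pdeg s = pdeg t" "\<not> high i s" "i \<in> keys t"
  shows "i \<in> keys s"
proof -
  obtain k where k: "lookup t k < lookup s k" "\<forall>l>k. lookup t l = lookup s l"
    using assms(1,2) by (auto simp: revlex_less_def)
  have "k \<le> i" using k(1) assms(3) by (auto simp: high_def in_keys_iff not_less)
  then show ?thesis using k assms(4) by (cases "k = i") (auto simp: in_keys_iff)
qed

lemma pvar_divides:
  assumes e: "e \<in> PR n" and i: "\<And>t. t \<in> keys e \<Longrightarrow> i \<in> keys t"
  shows "\<exists>q\<in>PR n. e = pvar i * q"
proof (rule bexI)
  let ?q = "\<Sum>t\<in>keys e. single (t - single i 1) (lookup e t)"
  have t: "t = single i 1 + (t - single i 1)" if "t \<in> keys e" for t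
    using i[OF that] by (intro poly_mapping_eqI) (auto simp: lookup_add lookup_minus lookup_single when_def in_keys_iff)
  have "pvar i * ?q = (\<Sum>t\<in>keys e. single t (lookup e t))"
    unfolding sum_distrib_left pvar_def mult_single using t by (intro sum.cong refl) (metis mult_1)
  then show "e = pvar i * ?q" using poly_mapping_sum_single[of "keys e" e] by simp
  show "?q \<in> PR n"
  proof (intro PR_sum PR_single)
    fix s assume s: "s \<in> keys e"
    then have "s \<in> pprods n" using e by (auto simp: PR_iff)
    then show "s - single i 1 \<in> pprods n" using t[OF s] by (metis pprods_add)
  qed
qed

text \<open>\<open>A\<close> plus the ideal of the variables after \<open>x_i\<close>, kept in the
  ring of all \<open>n\<close> variables so that no change of rings occurs.\<close>

definition cut :: "nat \<Rightarrow> 'k::comm_ring_1 mpoly set \<Rightarrow> nat \<Rightarrow> 'k mpoly set" where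
  "cut n A i = {f \<in> PR n. \<exists>h\<in>A. \<forall>t\<in>keys (f - h). high i t}"

context
  fixes n :: nat and A :: "'k::field mpoly set"
  assumes A: "graded_ideal n A"
begin

lemma graded_ideal_cut: "graded_ideal n (cut n A i)"
  unfolding graded_ideal_def
proof (intro conjI ballI allI)
  show "cut n A i \<subseteq> PR n" by (auto simp: cut_def)
  show "0 \<in> cut n A i" using graded_idealD(2)[OF A] by (auto simp: cut_def intro!: bexI[of _ 0])
  fix f assume "f \<in> cut n A i"
  then obtain h where f: "f \<in> PR n" "h \<in> A" "\<And>t. t \<in> keys (f - h) \<Longrightarrow> high i t" by (auto simp: cut_def)
  show "q * f \<in> cut n A i" if q: "q \<in> PR n" for q
    unfolding cut_def
  proof (intro CollectI conjI bexI ballI)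
    show "q * f \<in> PR n" by (rule PR_mult[OF q f(1)])
    show "q * h \<in> A" by (rule graded_idealD(4)[OF A f(2) q])
    fix t assume "t \<in> keys (q * f - q * h)"
    then have "t \<in> keys (q * (f - h))" by (simp add: right_diff_distrib)
    then obtain a b where "t = a + b" "b \<in> keys (f - h)" using keys_mult[of q "f - h"] by blast
    then show "high i t" using f(3)[of b] by (auto simp: high_def keys_add_nat)
  qed
  show "hcomp d f \<in> cut n A i" for d
    unfolding cut_def using f
    by (intro CollectI conjI bexI[OF _ graded_idealD(6)[OF A f(2), of d]] PR_keep)
       (auto simp: keep_diff[symmetric] keys_keep)
  fix f' assume "f' \<in> cut n A i"
  then obtain h' where f': "f' \<in> PR n" "h' \<in> A" "\<And>t. t \<in> keys (f' - h') \<Longrightarrow> high i t" by (auto simp: cut_def)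
  show "f + f' \<in> cut n A i"
    unfolding cut_def
  proof (intro CollectI conjI bexI ballI)
    show "f + f' \<in> PR n" by (rule PR_add[OF f(1) f'(1)])
    show "h + h' \<in> A" by (rule graded_idealD(3)[OF A f(2) f'(2)])
    fix t assume "t \<in> keys (f + f' - (h + h'))"
    then have "t \<in> keys ((f - h) + (f' - h'))" by (simp add: algebra_simps)
    then show "high i t" using keys_add[of "f - h" "f' - h'"] f(3) f'(3) by blast
  qed
qed

lemma cut_n: "cut n A n = A"
proof
  show "A \<subseteq> cut n A n" using graded_idealD(1)[OF A] by (force simp: cut_def)
  show "cut n A n \<subseteq> A"
  proof
    fix f assume "f \<in> cut n A n"
    then obtain h where f: "f \<in> PR n" "h \<in> A" "\<And>t. t \<in> keys (f - h) \<Longrightarrow> high n t" by (auto simp: cut_def)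
    have "f - h \<in> PR n" using f graded_idealD(1)[OF A] by (intro PR_diff) auto
    then have "\<not> high n t" if "t \<in> keys (f - h)" for t
      using that pprods_high_iff[of t n n] by (auto simp: PR_iff)
    then have "keys (f - h) = {}" using f(3) by blast
    then have "f - h = 0" by simp
    then show "f \<in> A" using f(2) by simp
  qed
qed

lemma A_sub_cut: "A \<subseteq> cut n A i"
  using graded_idealD(1)[OF A] by (force simp: cut_def)

lemma high_sub_cut: "f \<in> PR n \<Longrightarrow> (\<And>t. t \<in> keys f \<Longrightarrow> high i t) \<Longrightarrow> f \<in> cut n A i"
  using graded_idealD(2)[OF A] by (force simp: cut_def)

lemma cut_Suc:
  assumes i: "Suc i \<le> n"
  shows "cut n A i = add_lin n (cut n A (Suc i)) (pvar (Suc i))"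
proof
  show "cut n A i \<subseteq> add_lin n (cut n A (Suc i)) (pvar (Suc i))"
  proof
    fix f assume "f \<in> cut n A i"
    then obtain h where f: "f \<in> PR n" "h \<in> A" "\<And>t. t \<in> keys (f - h) \<Longrightarrow> high i t" by (auto simp: cut_def)
    \<comment> \<open>The terms of \<open>f - h\<close> with last variable exactly
      \<open>x_(i+1)\<close>; together they are divisible by that variable.\<close>
    define e where "e = keep (\<lambda>t. \<not> high (Suc i) t) (f - h)"
    have e: "e \<in> PR n" unfolding e_def using f graded_idealD(1)[OF A] by (intro PR_keep PR_diff) auto
    have "Suc i \<in> keys t" if t: "t \<in> keys e" for t
    proof -
      have "high i t" "\<not> high (Suc i) t" using t f(3) by (auto simp: e_def keys_keep)
      then obtain v where "v \<in> keys t" "i < v" "\<not> Suc i < v" unfolding high_def by blast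
      moreover from this have "v = Suc i" by simp
      ultimately show ?thesis by simp
    qed
    then obtain q where q: "q \<in> PR n" "e = pvar (Suc i) * q" using pvar_divides[OF e] by blast
    have "lookup (f - e - h) t = (if high (Suc i) t then lookup (f - h) t else 0)" for t
      by (simp add: e_def lookup_minus lookup_keep)
    then have "high (Suc i) t" if "t \<in> keys (f - e - h)" for t
      using that by (auto simp: in_keys_iff split: if_splits)
    then have "f - e \<in> cut n A (Suc i)" unfolding cut_def using PR_diff[OF f(1) e] f(2) by blast
    moreover have "f = (f - e) + pvar (Suc i) * q" by (simp add: q(2))
    ultimately show "f \<in> add_lin n (cut n A (Suc i)) (pvar (Suc i))" unfolding add_lin_def using q(1) by blast
  qed
  show "add_lin n (cut n A (Suc i)) (pvar (Suc i)) \<subseteq> cut n A i"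
  proof
    fix f assume "f \<in> add_lin n (cut n A (Suc i)) (pvar (Suc i))"
    then obtain b q where f: "f = b + pvar (Suc i) * q" "b \<in> cut n A (Suc i)" "q \<in> PR n" by (auto simp: add_lin_def)
    have b: "b \<in> cut n A i" using f(2) by (auto simp: cut_def high_def) (meson Suc_lessD)
    have "pvar (Suc i) * q \<in> cut n A i"
    proof (rule high_sub_cut)
      show "pvar (Suc i) * q \<in> PR n" using i f(3) by (intro PR_mult PR_pvar) auto
      show "high i t" if "t \<in> keys (pvar (Suc i) * q)" for t
        using that by (auto simp: pvar_def keys_mult_mono high_def keys_add_nat)
    qed
    then show "f \<in> cut n A i" unfolding f(1) by (intro graded_idealD(3)[OF graded_ideal_cut] b)
  qed
qed

lemma homogeneous_of_pvar_mult:
  assumes "homogeneous (r + 1) (pvar i * q)"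
  shows "homogeneous r q"
proof -
  have "int (pdeg (single i 1 + s)) = r + 1" if "s \<in> keys q" for s
    using assms that by (auto simp: homogeneous_def pvar_def keys_mult_mono)
  then show ?thesis by (auto simp: homogeneous_def)
qed

lemma cut_homogeneous:
  assumes "f \<in> cut n A i" "homogeneous r f"
  obtains h where "h \<in> A" "homogeneous r h" "\<And>t. t \<in> keys (f - h) \<Longrightarrow> high i t"
    "\<And>t. \<not> high i t \<Longrightarrow> lookup f t = lookup h t"
proof -
  obtain h where h: "h \<in> A" "\<And>t. t \<in> keys (f - h) \<Longrightarrow> high i t" using assms(1) by (auto simp: cut_def)
  have "f - hcomp r h = hcomp r (f - h)" using assms(2) by (simp add: keep_diff hcomp_homogeneous)
  then have k: "high i t" if "t \<in> keys (f - hcomp r h)" for t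
    using that h(2) by (auto simp: keys_keep)
  have "lookup f t = lookup (hcomp r h) t" if "\<not> high i t" for t
    using k[of t] that by (auto simp: in_keys_iff lookup_minus)
  then show ?thesis using that[of "hcomp r h"] graded_idealD(6)[OF A h(1)] homogeneous_hcomp k by blast
qed

text \<open>The characteristic property of the reverse lexicographic order: modulo the variables after \<open>x\<^sub>i\<close>, a
  homogeneous polynomial is divisible by \<open>x\<^sub>i\<close> as soon as its leading term is.\<close>

lemma colon_imp_leads:
  assumes i: "i \<in> {1..n}"
    and colon: "\<And>f. f \<in> PR n \<Longrightarrow> homogeneous (int (pdeg t)) f \<Longrightarrow> pvar i * f \<in> cut n A i \<Longrightarrow> f \<in> cut n A i"
    and t: "t \<in> pprods i" "single i 1 + t \<in> leads A"
  shows "t \<in> leads A"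
proof -
  let ?t = "single i 1 + t"
  have "pprods i \<subseteq> pprods n" using i by (auto simp: pprods_def)
  then have tn: "t \<in> pprods n" "?t \<in> pprods n" "\<not> high i t" "\<not> high i ?t"
    using t(1) i pprods_high_iff[of t n i] by (auto simp: pprods_add pprods_single high_def keys_add_nat)
  obtain h where h: "h \<in> A" "is_lead ?t h" "homogeneous (int (pdeg ?t)) h" using leads_homogeneous[OF A t(2)] by blast
  have hPR: "h \<in> PR n" using graded_idealD(1)[OF A h(1)] .
  \<comment> \<open>The part of \<open>h\<close> free of the variables after \<open>x_i\<close>. Its
    leading term contains \<open>x_i\<close>, and by \<open>revlex_less_low_keys\<close> so do all
    its terms.\<close>
  define e where "e = keep (\<lambda>s. \<not> high i s) h"
  have e: "e \<in> PR n" unfolding e_def by (rule PR_keep[OF hPR])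
  have "i \<in> keys s" if s: "s \<in> keys e" for s
  proof (cases "s = ?t")
    case False
    have s': "s \<in> keys h" "\<not> high i s" using s by (auto simp: e_def keys_keep)
    then have "revlex_less s ?t" "pdeg s = pdeg ?t" using False h(2,3) by (auto simp: is_lead_def homogeneous_def)
    then show ?thesis using s'(2) by (intro revlex_less_low_keys[of s ?t]) (auto simp: keys_add_nat)
  qed (simp add: keys_add_nat)
  then obtain q where q: "q \<in> PR n" "e = pvar i * q" using pvar_divides[OF e] by blast
  have e_hom: "homogeneous (int (pdeg t) + 1) e"
    using h(3) by (auto simp: homogeneous_def e_def keys_keep)
  have q_hom: "homogeneous (int (pdeg t)) q" using homogeneous_of_pvar_mult[of "int (pdeg t)" i q] e_hom q(2) by simp
  have "pvar i * q \<in> cut n A i"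
    unfolding q(2)[symmetric] cut_def using e h(1)
    by (intro CollectI conjI bexI[of _ h]) (auto simp: e_def in_keys_iff lookup_minus lookup_keep split: if_splits)
  then have "q \<in> cut n A i" by (rule colon[OF q(1) q_hom])
  then obtain h' where h': "h' \<in> A" "homogeneous (int (pdeg t)) h'"
    "\<And>s. s \<in> keys (q - h') \<Longrightarrow> high i s" "\<And>s. \<not> high i s \<Longrightarrow> lookup q s = lookup h' s"
    using cut_homogeneous[OF _ q_hom] by metis
  have lq: "lookup q s = (if high i (single i 1 + s) then 0 else lookup h (single i 1 + s))" for s
  proof -
    have "lookup e (single i 1 + s) = lookup q s"
      unfolding q(2) pvar_def by (rule lookup_mult_mono_add)
    then show ?thesis by (auto simp: e_def lookup_keep split: if_splits)
  qed
  \<comment> \<open>Terms of \<open>h'\<close> in later variables are smaller by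
    \<open>high_less\<close>; the others come from terms of \<open>h\<close> divided by
    \<open>x_i\<close>.\<close>
  have "is_lead t h'"
    unfolding is_lead_def
  proof (intro conjI ballI impI)
    have "lookup h' t = lookup h ?t" using h'(4)[OF tn(3)] lq[of t] tn(4) by simp
    then show "t \<in> keys h'" using h(2) by (simp add: is_lead_def in_keys_iff)
    fix s assume s: "s \<in> keys h'" "s \<noteq> t"
    have deg: "pdeg s = pdeg t" using h'(2) s(1) by (simp add: homogeneous_def)
    show "revlex_less s t"
    proof (cases "high i s")
      case True
      then show ?thesis using high_less[OF True tn(3) deg] by simp
    next
      case False
      then have "lookup h (single i 1 + s) \<noteq> 0"
        using s(1) h'(4)[OF False] lq[of s] by (auto simp: in_keys_iff split: if_splits)
      then have "single i 1 + s \<in> keys h" by (simp only: in_keys_iff not_False_eq_True)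
      moreover have "single i 1 + s \<noteq> ?t" using s(2) by simp
      ultimately have "revlex_less (single i 1 + s) ?t" using h(2) unfolding is_lead_def by blast
      then show ?thesis by simp
    qed
  qed
  then show ?thesis using h'(1) by (auto simp: leads_def)
qed

text \<open>Division along the terms free of the later variables: the largest such term
  \<open>t\<close> gives a leading term \<open>x_i t\<close> of \<open>A\<close>, so
  \<open>t\<close> is one by hypothesis and can be subtracted without leaving the colon.\<close>

lemma leads_imp_colon:
  assumes i: "i \<in> {1..n}"
    and J: "\<And>t. t \<in> pprods i \<Longrightarrow> int (pdeg t) = r \<Longrightarrow> single i 1 + t \<in> leads A \<Longrightarrow> t \<in> leads A"
    and f: "f \<in> PR n" "homogeneous r f" "pvar i * f \<in> cut n A i"
  shows "f \<in> cut n A i"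
proof -
  note C = graded_ideal_cut[of i]
  have "f \<in> cut n A i" if "\<And>s. s \<in> keys f \<Longrightarrow> \<not> high i s \<Longrightarrow> revlex_rank n s < b" for b
    using f that
  proof (induction b arbitrary: f rule: less_induct)
    case (less b)
    show ?case
    proof (cases "keep (\<lambda>s. \<not> high i s) f = 0")
      case True
      have "high i s" if "s \<in> keys f" for s
        using arg_cong[OF True, of "\<lambda>g. lookup g s"] that by (auto simp: lookup_keep in_keys_iff split: if_splits)
      then show ?thesis by (intro high_sub_cut less.prems)
    next
      case False
      then obtain t where t: "is_lead t (keep (\<lambda>s. \<not> high i s) f)" using ex_lead by blast
      have tf: "t \<in> keys f" "\<not> high i t" using t by (auto simp: is_lead_def keys_keep)
      have below: "revlex_less s t" if "s \<in> keys f" "\<not> high i s" "s \<noteq> t" for s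
        using t that by (auto simp: is_lead_def keys_keep)
      have tn: "t \<in> pprods n" using tf(1) less.prems(1) by (auto simp: PR_iff)
      have deg_t: "int (pdeg t) = r" using tf(1) less.prems(2) by (simp add: homogeneous_def)
      have ti: "t \<in> pprods i" using pprods_high_iff[OF tn] tf(2) i by auto
      let ?t = "single i 1 + t"
      have "homogeneous (r + 1) (pvar i * f)"
        using homogeneous_mult[OF homogeneous_pvar less.prems(2), of i] by (simp add: add.commute)
      then obtain h where h: "h \<in> A" "homogeneous (r + 1) h" "\<And>s. \<not> high i s \<Longrightarrow> lookup (pvar i * f) s = lookup h s"
        using cut_homogeneous[OF less.prems(3)] by metis
      have low_t: "\<not> high i ?t" using tf(2) by (auto simp: high_def keys_add_nat)
      \<comment> \<open>Up to terms containing later variables, \<open>h\<close> agrees with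
        \<open>x_i f\<close>, and those terms are smaller in the same degree.\<close>
      have "is_lead ?t h"
        unfolding is_lead_def
      proof (intro conjI ballI impI)
        have "lookup h ?t = lookup f t"
          using h(3)[OF low_t] lookup_mult_mono_add[of "single i 1" f t] by (simp add: pvar_def)
        then show "?t \<in> keys h" using tf(1) by (simp add: in_keys_iff)
        fix s assume s: "s \<in> keys h" "s \<noteq> ?t"
        have deg: "pdeg s = pdeg ?t" using h(2) s(1) deg_t by (auto simp: homogeneous_def)
        show "revlex_less s ?t"
        proof (cases "high i s")
          case True
          then show ?thesis using high_less[OF True low_t deg] by simp
        next
          case False
          then have "s \<in> keys (pvar i * f)" using s(1) h(3)[OF False] by (simp add: in_keys_iff)
          then obtain s' where s': "s = single i 1 + s'" "s' \<in> keys f"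
            by (auto simp: pvar_def keys_mult_mono)
          then have "\<not> high i s'" using False by (auto simp: high_def keys_add_nat)
          then show ?thesis using below[OF s'(2)] s(2) by (auto simp: s'(1))
        qed
      qed
      then have "t \<in> leads A" using h(1) by (intro J[OF ti deg_t]) (auto simp: leads_def)
      then obtain g where g: "g \<in> A" "is_lead t g" "homogeneous r g"
        using leads_homogeneous[OF A] deg_t by blast
      define c where "c = lookup f t / lookup g t"
      have gt: "lookup g t \<noteq> 0" using g(2) by (simp add: is_lead_def in_keys_iff)
      define f' where "f' = f - single 0 c * g"
      have cg: "single 0 c * g \<in> A" by (intro graded_idealD(4)[OF A g(1)] PR_single) simp
      have f'PR: "f' \<in> PR n" unfolding f'_def using less.prems(1) graded_idealD(1)[OF A cg] by (rule PR_diff)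
      have f'hom: "homogeneous r f'"
        unfolding f'_def using less.prems(2) homogeneous_mult[of 0 "single 0 c" r g] g(3)
        by (intro homogeneous_diff) (auto simp: homogeneous_single)
      have pPR: "pvar i \<in> PR n" using i by (rule PR_pvar)
      have "pvar i * (single 0 c * g) \<in> cut n A i"
        using A_sub_cut graded_idealD(4)[OF A cg pPR] by blast
      from graded_idealD(8)[OF C less.prems(3) this]
      have f'cut: "pvar i * f' \<in> cut n A i" by (simp add: f'_def right_diff_distrib)
      have "revlex_rank n s < revlex_rank n t" if s: "s \<in> keys f'" "\<not> high i s" for s
      proof -
        have "lookup f' t = 0" using gt by (simp add: f'_def lookup_minus c_def)
        then have st: "s \<noteq> t" using s(1) by (auto simp: in_keys_iff)
        have "s \<in> keys f \<or> s \<in> keys g"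
          using s(1) by (auto simp: f'_def in_keys_iff lookup_minus)
        then have "revlex_less s t" using below[OF _ s(2) st] g(2) st by (auto simp: is_lead_def)
        moreover have "s \<in> pprods n" using s(1) f'PR by (auto simp: PR_iff)
        ultimately show ?thesis by (intro revlex_rank_less)
      qed
      moreover have "revlex_rank n t < b" by (rule less.prems(4)[OF tf])
      ultimately have "f' \<in> cut n A i" using less.IH[OF _ f'PR f'hom f'cut] by blast
      from graded_idealD(3)[OF C this subsetD[OF A_sub_cut cg]]
      show ?thesis by (simp add: f'_def)
    qed
  qed
  moreover have "revlex_rank n s < Suc (\<Sum>r\<in>keys f. revlex_rank n r)" if "s \<in> keys f" for s
    using that member_le_sum[of s "keys f" "revlex_rank n"] by simp
  ultimately show ?thesis by blast
qed

end

section \<open>Minimal generators of a stable monomial ideal\<close>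

context
  fixes J :: "pprod set" and n :: nat
  assumes Jn: "J \<subseteq> pprods n"
    and J_add: "\<And>t u. t \<in> J \<Longrightarrow> u \<in> pprods n \<Longrightarrow> u + t \<in> J"
    and stable: "\<And>i j u. single i 1 + u \<in> J \<Longrightarrow> j \<in> {1..n} \<Longrightarrow> j < i \<Longrightarrow> single j 1 + u \<in> J"
begin

lemma key_split: "v \<in> keys t \<Longrightarrow> \<exists>u. t = single v 1 + u" for t :: pprod
  using pprod_divides_power[of 1 t v] by (auto simp: in_keys_iff)

lemma J_keys: "t \<in> J \<Longrightarrow> v \<in> keys t \<Longrightarrow> v \<in> {1..n}"
  using Jn unfolding pprods_def by blast

text \<open>Write \<open>x_i t = s u\<close> with \<open>s\<close> a minimal generator. If
  \<open>x_i\<close> divided \<open>u\<close>, then \<open>s\<close> would divide \<open>t\<close>.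
  If an earlier \<open>x_v\<close> did, then \<open>x_v s / x_i\<close> would lie in
  \<open>J\<close> by stability and divide \<open>t\<close>.\<close>

lemma min_pprods_of_colon:
  assumes i: "i \<in> {1..n}" and t: "t \<in> pprods i" "t \<notin> J" "single i 1 + t \<in> J"
  shows "single i 1 + t \<in> min_pprods J"
proof -
  obtain s u where s: "s \<in> min_pprods J" and st: "single i 1 + t = s + u"
    using min_pprods_below[OF t(3)] by blast
  have sJ: "s \<in> J" using s by (simp add: min_pprods_def)
  have un: "u \<in> pprods n" using st Jn t(3) by (metis pprods_add subsetD)
  have iu: "i \<notin> keys u"
  proof
    assume "i \<in> keys u"
    then obtain u' where u': "u = single i 1 + u'" using key_split by blast
    then have "single i 1 + t = single i 1 + (u' + s)" using st by (simp add: ac_simps)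
    then have "t = u' + s" by (simp only: add_left_cancel)
    moreover have "u' \<in> pprods n" using un by (simp add: u' pprods_add)
    ultimately show False using J_add[OF sJ] t(2) by blast
  qed
  have "u = 0"
  proof (rule ccontr)
    assume "u \<noteq> 0"
    then obtain v where v: "v \<in> keys u" by (metis all_not_in_conv keys_eq_empty')
    then obtain u' where u': "u = single v 1 + u'" using key_split by blast
    have "v \<in> keys (single i 1 + t)" unfolding st using v by (simp add: keys_add_nat)
    then have "v \<in> {1..i}" using t(1) i by (auto simp: keys_add_nat pprods_def)
    then have vi: "v \<in> {1..n}" "v < i" using v iu i by (auto simp: order.order_iff_strict)
    have "i \<in> keys (s + u)" unfolding st[symmetric] by (simp add: keys_add_nat)
    then have "i \<in> keys s" using iu by (simp add: keys_add_nat)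
    then obtain s' where s': "s = single i 1 + s'" using key_split by blast
    have "single i 1 + t = single i 1 + (u' + (single v 1 + s'))"
      using st by (simp add: s' u' ac_simps)
    then have "t = u' + (single v 1 + s')" by (simp only: add_left_cancel)
    moreover have "single v 1 + s' \<in> J" using stable[OF _ vi] sJ s' by blast
    moreover have "u' \<in> pprods n" using un by (simp add: u' pprods_add)
    ultimately show False using J_add t(2) by blast
  qed
  then show ?thesis using s st by simp
qed

lemma max_var_pos:
  assumes "m \<in> J" "m \<noteq> 0"
  shows "max_var m \<in> {1..n}" "max_var m \<in> keys m"
proof -
  have "keys m \<noteq> {}" using assms(2) by simp
  then show k: "max_var m \<in> keys m" unfolding max_var_def using assms(2) by simp
  then show "max_var m \<in> {1..n}" by (rule J_keys[OF assms(1)])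
qed

lemma min_pprods_split:
  assumes m: "m \<in> min_pprods J" "m \<noteq> 0" "max_var m = i"
  shows "\<exists>t\<in>pprods i. m = single i 1 + t \<and> t \<notin> J"
proof -
  have mJ: "m \<in> J" using m(1) by (simp add: min_pprods_def)
  have "i \<in> keys m" using max_var_pos(2)[OF mJ m(2)] m(3) by simp
  then obtain t where t: "m = single i 1 + t" using key_split by blast
  have "keys m \<subseteq> {1..i}"
  proof
    fix v assume v: "v \<in> keys m"
    then have "v \<le> max_var m" using m(2) by (simp add: max_var_def)
    moreover have "v \<in> {1..n}" by (rule J_keys[OF mJ v])
    ultimately show "v \<in> {1..i}" using m(3) by simp
  qed
  then have "t \<in> pprods i" by (auto simp: t keys_add_nat pprods_def)
  moreover have "t \<notin> J"
  proof
    assume "t \<in> J"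
    moreover have "m = t + single i 1" using t by (simp only: add.commute)
    ultimately have "t = m" using m(1) unfolding min_pprods_def by blast
    then have "pdeg t = pdeg m" by simp
    then show False by (simp add: t)
  qed
  ultimately show ?thesis using t by blast
qed

text \<open>A generator \<open>m\<close> with last variable \<open>x_i\<close> corresponds to the
  colon element \<open>m / x_i\<close>, whence the degree \<open>r + 1\<close>.\<close>

lemma colon_iff_min_pprods:
  assumes i: "i \<in> {1..n}"
  shows "(\<forall>t\<in>pprods i. int (pdeg t) = r \<longrightarrow> single i 1 + t \<in> J \<longrightarrow> t \<in> J) \<longleftrightarrow>
    (\<forall>m\<in>min_pprods J. m \<noteq> 0 \<longrightarrow> max_var m = i \<longrightarrow> int (pdeg m) \<noteq> r + 1)"
proof (intro iffI ballI impI)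
  fix m assume *: "\<forall>t\<in>pprods i. int (pdeg t) = r \<longrightarrow> single i 1 + t \<in> J \<longrightarrow> t \<in> J"
    and m: "m \<in> min_pprods J" "m \<noteq> 0" "max_var m = i"
  obtain t where t: "t \<in> pprods i" "m = single i 1 + t" "t \<notin> J" using min_pprods_split[OF m] by blast
  have "m \<in> J" using m(1) by (simp add: min_pprods_def)
  then show "int (pdeg m) \<noteq> r + 1" using * t by auto
next
  fix t assume *: "\<forall>m\<in>min_pprods J. m \<noteq> 0 \<longrightarrow> max_var m = i \<longrightarrow> int (pdeg m) \<noteq> r + 1"
    and t: "t \<in> pprods i" "int (pdeg t) = r" "single i 1 + t \<in> J"
  show "t \<in> J"
  proof (rule ccontr)
    assume tJ: "t \<notin> J"
    let ?m = "single i 1 + t"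
    have m: "?m \<in> min_pprods J" by (rule min_pprods_of_colon[OF i t(1) tJ t(3)])
    have ne: "?m \<noteq> 0" using pdeg_eq_0_iff[of ?m] by simp
    have "max_var ?m = i"
    proof -
      have "Max (keys ?m) = i"
        using t(1) i by (intro Max_eqI) (auto simp: keys_add_nat pprods_def)
      then show ?thesis using ne by (simp add: max_var_def)
    qed
    then show False using * m ne t(2) by force
  qed
qed

text \<open>Stability trades every variable for \<open>x_1\<close> without changing the
  degree.\<close>

lemma power_of_first_var:
  assumes n: "1 \<le> n" and t: "t \<in> J"
  shows "single 1 (pdeg t) \<in> J"
proof -
  have "single 1 k + u \<in> J \<Longrightarrow> single 1 (k + pdeg u) \<in> J" for k u
  proof (induction "pdeg u" arbitrary: k u)
    case 0
    then show ?case using pdeg_eq_0_iff[of u] by simp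
  next
    case (Suc d)
    then have "u \<noteq> 0" by auto
    then obtain v where "v \<in> keys u" by (metis all_not_in_conv keys_eq_empty')
    then obtain u' where u': "u = single v 1 + u'" using key_split by blast
    have "single v 1 + (single 1 k + u') \<in> J" using Suc.prems by (simp add: u' ac_simps)
    moreover from this have "v \<in> {1..n}" by (rule J_keys) (simp add: keys_add_nat)
    ultimately have "single 1 1 + (single 1 k + u') \<in> J"
      using stable[of v "single 1 k + u'" 1] n by (cases "v = 1") auto
    then have "single 1 (Suc k) + u' \<in> J"
      by (simp add: add.assoc[symmetric] single_add[symmetric])
    moreover have "d = pdeg u'" using Suc.hyps(2) by (simp add: u')
    ultimately show ?case using Suc.hyps(1)[of u' "Suc k"] by (simp add: u')
  qed
  from this[of 0 t] show ?thesis using t by simp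
qed

end

section \<open>The chain of generic hyperplane sections\<close>

text \<open>Only stability of the leading terms is required of \<open>g\<close>, so the zero ideal
  in the given coordinates is an instance too.\<close>

locale generic_coordinates =
  fixes n :: nat and I :: "'k::field_char_0 mpoly set" and g g' :: "'k mat"
  assumes I: "graded_ideal n I" and g: "g \<in> GL n" and g': "g' \<in> GL n" "g * g' = 1\<^sub>m n" "g' * g = 1\<^sub>m n"
    and stable: "\<And>i j u. single i 1 + u \<in> leads (GL_act n g ` I) \<Longrightarrow> j \<in> {1..n} \<Longrightarrow> j < i \<Longrightarrow>
      single j 1 + u \<in> leads (GL_act n g ` I)"
begin

abbreviation (input) "gI \<equiv> GL_act n g ` I"

abbreviation (input) "gens \<equiv> min_pprods (leads (GL_act n g ` I))"

text \<open>\<open>I\<close> plus the linear forms \<open>g' x_(i+1), ..., g' x_n\<close>. The chain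
  starts at \<open>I\<close> itself and lives over the original variables, to which the Cech complex
  belongs.\<close>

definition section_ideal :: "nat \<Rightarrow> 'k mpoly set" where
  "section_ideal i = {f \<in> PR n. GL_act n g f \<in> cut n gI i}"

lemma graded_gI: "graded_ideal n gI"
  by (rule graded_ideal_GL_act[OF I g])

lemma act_inverse: "f \<in> PR n \<Longrightarrow> GL_act n g (GL_act n g' f) = f" "f \<in> PR n \<Longrightarrow> GL_act n g' (GL_act n g f) = f"
  using GL_act_GL_act[OF GL_carrier[OF g] GL_carrier[OF g'(1)]] GL_act_GL_act[OF GL_carrier[OF g'(1)] GL_carrier[OF g]]
    GL_act_one g'(2,3) by simp_all

lemma finite_gens: "finite gens"
  using finite_min_pprods[of _ n] leads_pprods[OF graded_gI] by blast

lemma leads_facts: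
  "leads gI \<subseteq> pprods n" "\<And>t u. t \<in> leads gI \<Longrightarrow> u \<in> pprods n \<Longrightarrow> u + t \<in> leads gI"
  using leads_pprods[OF graded_gI] leads_add[OF graded_gI] by auto

lemma graded_section: "graded_ideal n (section_ideal i)"
proof -
  note C = graded_idealD[OF graded_ideal_cut[OF graded_gI, of i]]
  show ?thesis
    unfolding graded_ideal_def section_ideal_def
    by (auto intro: PR_add PR_mult PR_keep C PR_GL_act simp: GL_act_add GL_act_mult hcomp_GL_act[symmetric])
qed

lemma section_n: "section_ideal n = I"
proof
  show "section_ideal n \<subseteq> I"
  proof
    fix f assume "f \<in> section_ideal n"
    then have "f \<in> {f \<in> PR n. GL_act n g f \<in> cut n gI n}" by (simp only: section_ideal_def)
    then have f: "f \<in> PR n" "GL_act n g f \<in> gI"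
      by (simp_all add: cut_n[OF graded_gI])
    obtain a where a: "GL_act n g f = GL_act n g a" "a \<in> I"
      using imageE[OF f(2)]
      by metis
    have "GL_act n g' (GL_act n g f) = f"
      by (rule act_inverse(2)[OF f(1)])
    moreover have "GL_act n g' (GL_act n g f) = a"
      unfolding a(1)
      by (rule act_inverse(2)[OF graded_idealD(1)[OF I a(2)]])
    ultimately show "f \<in> I"
      using a(2) by simp
  qed
  show "I \<subseteq> section_ideal n"
  proof
    fix f assume f: "f \<in> I"
    then show "f \<in> section_ideal n"
      unfolding section_ideal_def cut_n[OF graded_gI] mem_Collect_eq by (intro conjI imageI graded_idealD(1)[OF I])
  qed
qed

abbreviation (input) "gvar i \<equiv> GL_act n g' (pvar i)"

lemma section_Suc:
  assumes i: "Suc i \<le> n"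
  shows "section_ideal i = add_lin n (section_ideal (Suc i)) (gvar (Suc i))"
proof
  have v: "(pvar (Suc i) :: 'k mpoly) \<in> PR n" using i by (intro PR_pvar) auto
  show "section_ideal i \<subseteq> add_lin n (section_ideal (Suc i)) (gvar (Suc i))"
  proof
    fix f assume "f \<in> section_ideal i"
    then have f: "f \<in> PR n" "GL_act n g f \<in> add_lin n (cut n gI (Suc i)) (pvar (Suc i))"
      by (auto simp: section_ideal_def cut_Suc[OF graded_gI i])
    then obtain b q where bq: "GL_act n g f = b + pvar (Suc i) * q" "b \<in> cut n gI (Suc i)" "q \<in> PR n"
      by (auto simp: add_lin_def)
    have b: "b \<in> PR n" using bq(2) by (simp add: cut_def)
    have "f = GL_act n g' b + gvar (Suc i) * GL_act n g' q"
      using arg_cong[OF bq(1), of "GL_act n g'"] act_inverse(2)[OF f(1)] by (simp add: GL_act_add GL_act_mult)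
    moreover have "GL_act n g' b \<in> section_ideal (Suc i)"
      unfolding section_ideal_def mem_Collect_eq act_inverse(1)[OF b] using bq(2) PR_GL_act by blast
    ultimately show "f \<in> add_lin n (section_ideal (Suc i)) (gvar (Suc i))"
      unfolding add_lin_def using PR_GL_act by blast
  qed
  show "add_lin n (section_ideal (Suc i)) (gvar (Suc i)) \<subseteq> section_ideal i"
  proof
    fix f assume "f \<in> add_lin n (section_ideal (Suc i)) (gvar (Suc i))"
    then obtain b q where f: "f = b + gvar (Suc i) * q" "b \<in> section_ideal (Suc i)" "q \<in> PR n"
      by (auto simp: add_lin_def)
    have "GL_act n g f = GL_act n g b + pvar (Suc i) * GL_act n g q"
      using v by (simp add: f(1) GL_act_add GL_act_mult act_inverse)
    moreover have "GL_act n g b \<in> cut n gI (Suc i)" using f(2) by (simp add: section_ideal_def)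
    ultimately have "GL_act n g f \<in> cut n gI i"
      unfolding cut_Suc[OF graded_gI i] add_lin_def using PR_GL_act by blast
    moreover have "f \<in> PR n" using f by (auto simp: section_ideal_def intro: PR_add PR_mult PR_GL_act)
    ultimately show "f \<in> section_ideal i" by (simp add: section_ideal_def)
  qed
qed

text \<open>Three equivalences are joined: transport along \<open>g\<close>, the reverse
  lexicographic property, and the description of colons by generators of a stable ideal.\<close>

lemma section_colon_iff:
  assumes i: "i \<in> {1..n}"
  shows "(\<forall>f\<in>PR n. homogeneous r f \<longrightarrow> gvar i * f \<in> section_ideal i \<longrightarrow> f \<in> section_ideal i) \<longleftrightarrow>
    (\<forall>m\<in>gens. m \<noteq> 0 \<longrightarrow> max_var m = i \<longrightarrow> int (pdeg m) \<noteq> r + 1)"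
proof -
  have v: "(pvar i :: 'k mpoly) \<in> PR n" by (rule PR_pvar[OF i])
  have "(\<forall>f\<in>PR n. homogeneous r f \<longrightarrow> gvar i * f \<in> section_ideal i \<longrightarrow> f \<in> section_ideal i) \<longleftrightarrow>
    (\<forall>f\<in>PR n. homogeneous r f \<longrightarrow> pvar i * f \<in> cut n gI i \<longrightarrow> f \<in> cut n gI i)"
  proof (intro iffI ballI impI)
    fix f assume *: "\<forall>f\<in>PR n. homogeneous r f \<longrightarrow> gvar i * f \<in> section_ideal i \<longrightarrow> f \<in> section_ideal i"
      and f: "f \<in> PR n" "homogeneous r f" "pvar i * f \<in> cut n gI i"
    have "gvar i * GL_act n g' f \<in> section_ideal i"
      using f(3) act_inverse(1)[OF PR_mult[OF v f(1)]]
      by (simp add: section_ideal_def PR_mult PR_GL_act GL_act_mult[symmetric])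
    then have "GL_act n g' f \<in> section_ideal i" using * PR_GL_act homogeneous_GL_act[OF f(2)] by blast
    then show "f \<in> cut n gI i" using act_inverse(1)[OF f(1)] by (simp add: section_ideal_def)
  next
    fix f assume *: "\<forall>f\<in>PR n. homogeneous r f \<longrightarrow> pvar i * f \<in> cut n gI i \<longrightarrow> f \<in> cut n gI i"
      and f: "f \<in> PR n" "homogeneous r f" "gvar i * f \<in> section_ideal i"
    have "pvar i * GL_act n g f \<in> cut n gI i"
      using f(3) act_inverse(1)[OF v] by (simp add: section_ideal_def GL_act_mult)
    then have "GL_act n g f \<in> cut n gI i" using * PR_GL_act homogeneous_GL_act[OF f(2)] by blast
    then show "f \<in> section_ideal i" using f(1) by (simp add: section_ideal_def)
  qed
  also have "\<dots> \<longleftrightarrow> (\<forall>t\<in>pprods i. int (pdeg t) = r \<longrightarrow> single i 1 + t \<in> leads gI \<longrightarrow> t \<in> leads gI)"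
    using colon_imp_leads[OF graded_gI i] leads_imp_colon[OF graded_gI i, of r] by blast
  also have "\<dots> \<longleftrightarrow> (\<forall>m\<in>gens. m \<noteq> 0 \<longrightarrow> max_var m = i \<longrightarrow> int (pdeg m) \<noteq> r + 1)"
    by (rule colon_iff_min_pprods[OF leads_facts stable i])
  finally show ?thesis .
qed

text \<open>There are finitely many minimal generators, so no colon element exists beyond their
  degrees.\<close>

lemma section_filter_regular:
  assumes i: "i \<in> {1..n}"
  shows "gvar i \<in> PR n" "homogeneous 1 (gvar i)"
    "\<exists>r1. \<forall>r\<ge>r1. \<forall>f\<in>PR n. homogeneous r f \<longrightarrow> gvar i * f \<in> section_ideal i \<longrightarrow> f \<in> section_ideal i"
proof -
  show "gvar i \<in> PR n" by (rule PR_GL_act)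
  show "homogeneous 1 (gvar i)" by (rule homogeneous_GL_act) simp
  show "\<exists>r1. \<forall>r\<ge>r1. \<forall>f\<in>PR n. homogeneous r f \<longrightarrow> gvar i * f \<in> section_ideal i \<longrightarrow> f \<in> section_ideal i"
  proof (rule exI[of _ "int (\<Sum>m\<in>gens. pdeg m)"], intro allI impI)
    fix r assume r: "int (\<Sum>m\<in>gens. pdeg m) \<le> r"
    have "\<forall>m\<in>gens. m \<noteq> 0 \<longrightarrow> max_var m = i \<longrightarrow> int (pdeg m) \<noteq> r + 1"
    proof (intro ballI impI)
      fix m assume "m \<in> gens"
      then have "pdeg m \<le> (\<Sum>m\<in>gens. pdeg m)" by (intro member_le_sum finite_gens) auto
      then show "int (pdeg m) \<noteq> r + 1" using r by linarith
    qed
    then show "\<forall>f\<in>PR n. homogeneous r f \<longrightarrow> gvar i * f \<in> section_ideal i \<longrightarrow> f \<in> section_ideal i"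
      using section_colon_iff[OF i] by blast
  qed
qed

text \<open>Each further linear form costs \<open>1 - e\<close>. Its colon, constrained by the bound
  reached so far, limits the degrees of the generators with that last variable.\<close>

lemma vanish_above_sections:
  assumes van: "vanish_above n I e \<rho>" and e: "e \<le> 1" and k: "k \<le> n"
  shows "vanish_above n (section_ideal k) e (\<rho> + int (n - k) * (1 - e)) \<and>
    (\<forall>m\<in>gens. m \<noteq> 0 \<longrightarrow> k < max_var m \<longrightarrow> int (pdeg m) \<le> \<rho> + 1 + int (n - max_var m) * (1 - e))"
  using k
proof (induction k rule: inc_induct)
  case base
  have "\<not> n < max_var m" if "m \<in> gens" "m \<noteq> 0" for m
    using max_var_pos(1)[OF leads_facts stable, where m = m] that by (auto simp: min_pprods_def)
  then show ?case using van by (auto simp: section_n)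
next
  case (step k)
  have k: "Suc k \<le> n" "Suc k \<in> {1..n}" using step.hyps by auto
  note fr = graded_section section_filter_regular[OF k(2)]
  have nk: "int (n - k) = int (n - Suc k) + 1" using k by simp
  have van': "vanish_above n (section_ideal (Suc k)) e (\<rho> + int (n - Suc k) * (1 - e))" using step.IH by blast
  have "vanish_above n (section_ideal k) e (\<rho> + int (n - Suc k) * (1 - e) + 1 - e)"
    unfolding section_Suc[OF k(1)] by (rule vanish_above_quotient[OF fr van' e])
  moreover have "int (pdeg m) \<le> \<rho> + 1 + int (n - max_var m) * (1 - e)" if m: "m \<in> gens" "m \<noteq> 0" "k < max_var m" for m
  proof (cases "max_var m = Suc k")
    case True
    have "int (pdeg m) \<noteq> r + 1" if "r > \<rho> + int (n - Suc k) * (1 - e)" for r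
      using section_colon_iff[OF k(2), of r] vanish_above_colon[OF fr van' that] m True by blast
    from this[of "int (pdeg m) - 1"] have "\<not> \<rho> + int (n - Suc k) * (1 - e) < int (pdeg m) - 1" by auto
    then show ?thesis unfolding True by linarith
  next
    case False
    then show ?thesis using step.IH m by auto
  qed
  ultimately show ?case by (simp add: nk algebra_simps)
qed

text \<open>The way back up to \<open>I\<close>. The start \<open>k\<close> is free:
  \<open>k = 0\<close> gives the bound by generators, \<open>k = 1\<close> the bound by
  dimension.\<close>

lemma vanish_above_of_sections:
  assumes k: "k \<le> n"
    and "vanish_above n (section_ideal k) e (\<rho> + int (n - k) * (1 - e))"
    and gens: "\<And>m. m \<in> gens \<Longrightarrow> m \<noteq> 0 \<Longrightarrow> k < max_var m \<Longrightarrow> int (pdeg m) \<le> \<rho> + 1 + int (n - max_var m) * (1 - e)"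
  shows "vanish_above n I e \<rho>"
proof -
  have "vanish_above n (section_ideal l) e (\<rho> + int (n - l) * (1 - e))" if "k \<le> l" "l \<le> n" for l
    using that
  proof (induction l rule: dec_induct)
    case base
    show ?case by (rule assms(2))
  next
    case (step l)
    have l: "Suc l \<le> n" "Suc l \<in> {1..n}" using step.prems by auto
    have nl: "int (n - l) = int (n - Suc l) + 1" using l by simp
    have "vanish_above n (section_ideal l) e (\<rho> + int (n - l) * (1 - e))" using step by simp
    then have van: "vanish_above n (add_lin n (section_ideal (Suc l)) (gvar (Suc l))) e (\<rho> + int (n - Suc l) * (1 - e) + 1 - e)"
      unfolding section_Suc[OF l(1)] by (simp add: nl algebra_simps)
    show ?case
    proof (rule vanish_above_of_quotient[OF graded_section section_filter_regular[OF l(2)] van])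
      fix r f assume r: "\<rho> + int (n - Suc l) * (1 - e) < r" and f: "f \<in> PR n" "homogeneous r f" "gvar (Suc l) * f \<in> section_ideal (Suc l)"
      have "\<forall>m\<in>gens. m \<noteq> 0 \<longrightarrow> max_var m = Suc l \<longrightarrow> int (pdeg m) \<noteq> r + 1"
        using gens r step.hyps by fastforce
      then show "f \<in> section_ideal (Suc l)" using section_colon_iff[OF l(2), of r] f by blast
    qed
  qed
  from this[of n] show ?thesis using k by (simp add: section_n)
qed

text \<open>The \<open>n\<close> forms \<open>g' x_i\<close> together generate the irrelevant
  ideal.\<close>

lemma section_0:
  assumes "f \<in> PR n" "homogeneous r f" "1 \<le> r"
  shows "f \<in> section_ideal 0"
proof -
  have "high 0 t" if t: "t \<in> keys (GL_act n g f)" for t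
  proof -
    have "int (pdeg t) = r" using homogeneous_GL_act[OF assms(2)] t by (simp add: homogeneous_def)
    then have "t \<noteq> 0" using assms(3) by auto
    then obtain v where v: "v \<in> keys t" by (metis all_not_in_conv keys_eq_empty')
    moreover have "t \<in> pprods n" using t PR_GL_act[of n g f] by (auto simp: PR_iff)
    ultimately have "0 < v" by (auto simp: pprods_def)
    then show ?thesis using v by (auto simp: high_def)
  qed
  then show ?thesis using high_sub_cut[OF graded_gI PR_GL_act] assms(1) by (simp add: section_ideal_def)
qed

lemma vanish_above_section_0_iff:
  "vanish_above n (section_ideal 0) e \<rho> \<longleftrightarrow> (\<forall>r>\<rho>. \<forall>f\<in>PR n. homogeneous r f \<longrightarrow> f \<in> section_ideal 0)"
  by (rule vanish_above_primary_iff[OF graded_section]) (use section_0 in blast)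

text \<open>By stability a power of \<open>x_1\<close> is a leading term of \<open>g I\<close>.
  Modulo the later variables each degree is spanned by a power of \<open>x_1\<close>, so
  \<open>n - 1\<close> forms already suffice to reach all large degrees.\<close>

lemma section_1:
  assumes n: "1 \<le> n" and t: "t \<in> leads gI" and f: "f \<in> PR n" "homogeneous r f" "int (pdeg t) \<le> r"
  shows "f \<in> section_ideal 1"
proof -
  let ?x = "single 1 (nat r) :: pprod"
  have "single 1 (pdeg t) \<in> leads gI" by (rule power_of_first_var[OF leads_facts stable n t])
  moreover have "single 1 (nat r - pdeg t) \<in> pprods n" using n by (simp add: pprods_single)
  ultimately have "single 1 (nat r - pdeg t) + single 1 (pdeg t) \<in> leads gI"
    by (intro leads_facts(2))
  then have x: "?x \<in> leads gI" using f(3) by (simp add: single_add[symmetric])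
  obtain h where h: "h \<in> gI" "is_lead ?x h" "homogeneous r h"
    using leads_homogeneous[OF graded_gI x] f(3) by auto
  have only_x: "s = ?x" if "pdeg s = nat r" "s \<in> pprods n" "\<not> high 1 s" for s
  proof -
    have "s \<in> pprods 1" using that n pprods_high_iff by blast
    then have "keys s \<subseteq> {1}" by (simp add: pprods_def)
    then have "s = single 1 (lookup s 1)"
      using poly_mapping_sum_single[of "{1}" s] by simp
    moreover from this have "pdeg s = lookup s 1" by (metis pdeg_single)
    ultimately show ?thesis using that(1) by simp
  qed
  define F where "F = GL_act n g f"
  have F: "F \<in> PR n" "homogeneous r F" unfolding F_def by (rule PR_GL_act, rule homogeneous_GL_act[OF f(2)])
  define c where "c = lookup F ?x / lookup h ?x"
  have hx: "lookup h ?x \<noteq> 0" using h(2) by (simp add: is_lead_def in_keys_iff)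
  have ch: "single 0 c * h \<in> gI" by (intro graded_idealD(4)[OF graded_gI h(1)] PR_single) simp
  have "high 1 s" if s: "s \<in> keys (F - single 0 c * h)" for s
  proof (rule ccontr)
    assume "\<not> high 1 s"
    have "homogeneous r (F - single 0 c * h)"
      using F(2) homogeneous_mult[of 0 "single 0 c" r h] h(3)
      by (intro homogeneous_diff) (auto simp: homogeneous_single)
    then have "pdeg s = nat r" using s by (auto simp: homogeneous_def)
    moreover have "s \<in> pprods n"
      using PR_diff[OF F(1) graded_idealD(1)[OF graded_gI ch]] s by (auto simp: PR_iff)
    ultimately have "s = ?x" using only_x \<open>\<not> high 1 s\<close> by blast
    then have "lookup (F - single 0 c * h) s = 0"
      using hx by (simp add: lookup_minus c_def)
    then show False using s by (simp add: in_keys_iff)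
  qed
  then have "F \<in> cut n gI 1" unfolding cut_def using F(1) ch by blast
  then show ?thesis using f(1) by (simp add: section_ideal_def F_def)
qed

end

section \<open>Generators and vanishing\<close>

lemma vanish_beyond:
  fixes A :: "'k::field_char_0 mpoly set"
  assumes A: "graded_ideal n A" and p: "n < p"
  shows "vanish n A B p r"
proof -
  have "cech_idx n p = {}"
  proof (rule equals0I)
    fix S assume "S \<in> cech_idx n p"
    from cech_idxD[OF this] have "S \<subseteq> {1..n}" "card S = p" by auto
    then show False using card_mono[OF finite_atLeastAtMost, of S 1 n] p by simp
  qed
  then have "cochains n B p r = UNIV" by (simp add: cochains_def)
  then show ?thesis unfolding vanish_def using cobounds_zero[OF A] by blast
qed

context generic_coordinates
begin

lemma ex_leads: "f \<in> gI \<Longrightarrow> f \<noteq> 0 \<Longrightarrow> leads gI \<noteq> {}"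
  using ex_lead[of f] unfolding leads_def by blast

text \<open>For the zero ideal the last quotient is not zero in degree 0, which makes the bound for
  \<open>R\<close> sharp.\<close>

lemma one_not_in_section_0:
  assumes "leads gI = {}"
  shows "1 \<notin> section_ideal 0"
proof
  assume "1 \<in> section_ideal 0"
  then have "GL_act n g 1 \<in> cut n gI 0" by (simp add: section_ideal_def)
  then obtain h where h: "h \<in> gI" "\<forall>t\<in>keys (1 - h). high 0 t"
    by (auto simp: cut_def GL_act_const[of _ _ 1, simplified])
  then have "h = 0" using ex_leads assms by blast
  then show False using h(2) by (simp add: high_def)
qed

lemma leads_empty_imp_zero:
  assumes "leads gI = {}"
  shows "I = {0}"
proof (rule equalityI)
  show "I \<subseteq> {0}"
  proof
    fix f assume f: "f \<in> I"
    then have "GL_act n g f = 0" using ex_leads assms by blast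
    then have "GL_act n g' (GL_act n g f) = 0" by (simp add: GL_act_const[of _ _ 0, simplified])
    then show "f \<in> {0}" using act_inverse(2)[OF graded_idealD(1)[OF I f]] by simp
  qed
qed (use graded_idealD(2)[OF I] in blast)

lemma leads_zero_imp_PR:
  assumes "0 \<in> leads gI"
  shows "I = PR n"
proof (rule equalityI)
  obtain f where f: "f \<in> gI" "is_lead 0 f" "homogeneous 0 f" using leads_homogeneous[OF graded_gI assms] by auto
  define c where "c = lookup f 0"
  have "keys f \<subseteq> {0}" using f(3) pdeg_eq_0_iff by (auto simp: homogeneous_def)
  then have fc: "f = single 0 c" using poly_mapping_sum_single[of "{0}" f] by (simp add: c_def)
  have c: "c \<noteq> 0" using f(2) by (simp add: is_lead_def in_keys_iff c_def)
  obtain a where a: "a \<in> I" "GL_act n g a = f" using f(1) by auto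
  have "a = GL_act n g' f" using act_inverse(2)[OF graded_idealD(1)[OF I a(1)]] a(2) by simp
  then have "single 0 (1 / c) * a = 1" using c by (simp add: fc GL_act_const mult_single)
  then have one: "1 \<in> I" using graded_idealD(4)[OF I a(1) PR_single, of 0 "1 / c"] by simp
  show "PR n \<subseteq> I"
  proof
    fix h :: "'k mpoly" assume "h \<in> PR n"
    then show "h \<in> I" using graded_idealD(4)[OF I one, of h] by simp
  qed
qed (use graded_idealD(1)[OF I] in blast)

text \<open>The second condition is the bound for the last section, which contains all forms of
  positive degree.\<close>

lemma vanish_above_of_gens:
  assumes bound: "\<And>m. m \<in> gens \<Longrightarrow> m \<noteq> 0 \<Longrightarrow> int (pdeg m) \<le> \<rho> + 1 + int (n - max_var m) * (1 - e)"
    and "0 \<le> \<rho> + int n * (1 - e)"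
  shows "vanish_above n I e \<rho>"
proof (rule vanish_above_of_sections[of 0])
  show "vanish_above n (section_ideal 0) e (\<rho> + int (n - 0) * (1 - e))"
    unfolding vanish_above_section_0_iff
  proof (intro allI impI ballI)
    fix r and f :: "'k mpoly" assume "\<rho> + int (n - 0) * (1 - e) < r" "f \<in> PR n" "homogeneous r f"
    then show "f \<in> section_ideal 0" using assms(2) by (intro section_0) auto
  qed
  fix m assume "m \<in> gens" "m \<noteq> 0"
  then show "int (pdeg m) \<le> \<rho> + 1 + int (n - max_var m) * (1 - e)" by (rule bound)
qed simp

lemma gens_bound:
  assumes "vanish_above n I e \<rho>" "e \<le> 1" "m \<in> gens" "m \<noteq> 0"
  shows "int (pdeg m) \<le> \<rho> + 1 + int (n - max_var m) * (1 - e)"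
proof -
  have "max_var m \<in> {1..n}" using assms(3,4) by (intro max_var_pos(1)[OF leads_facts stable]) (auto simp: min_pprods_def)
  then have "0 < max_var m" by simp
  then show ?thesis using vanish_above_sections[OF assms(1,2), of 0] assms(3,4) by blast
qed

text \<open>A nonzero ideal leaves dimension below \<open>n\<close>. Starting from the section by
  \<open>n - 1\<close> forms, the weight \<open>e = E + 1\<close> is so large that the given pair
  with \<open>p \<ge> n\<close> exceeds the bound.\<close>

lemma vanish_dimension:
  assumes n: "1 \<le> n" and t: "t \<in> leads gI" and p: "n \<le> p"
  shows "vanish n (PR n) I p r"
proof -
  define S where "S = (\<Sum>m\<in>gens. pdeg m)"
  \<comment> \<open>\<open>D\<close> dominates the degrees of the generators and of the power of
    \<open>x_1\<close>; \<open>E > D - r\<close> places the pair \<open>(p, r)\<close> above the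
    bound.\<close>
  define D where "D = int S + int (pdeg t)"
  define E where "E = D + \<bar>r\<bar> + 1"
  have D0: "0 \<le> D" unfolding D_def by (intro add_nonneg_nonneg of_nat_0_le_iff)
  then have DE: "0 \<le> D" "0 \<le> E" "D - r < E" by (simp_all add: E_def)
  have "vanish_above n I (E + 1) ((int n - 1) * E + D)"
  proof (rule vanish_above_of_sections[OF n])
    have *: "(int n - 1) * E + D + int (n - 1) * (1 - (E + 1)) = D" using n by (simp add: of_nat_diff algebra_simps)
    have s1: "f \<in> section_ideal 1" if "f \<in> PR n" "homogeneous r f" "D \<le> r" for f r
    proof -
      have "int (pdeg t) \<le> D" by (simp add: D_def)
      also note that(3)
      finally show ?thesis by (rule section_1[OF n t that(1,2)])
    qed
    show "vanish_above n (section_ideal 1) (E + 1) ((int n - 1) * E + D + int (n - 1) * (1 - (E + 1)))"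
      unfolding *
      by (subst vanish_above_primary_iff[OF graded_section]) (use s1 less_imp_le in blast)+
    fix m assume m: "m \<in> gens" "m \<noteq> 0" "1 < max_var m"
    have mv: "max_var m \<in> {1..n}" using m(1,2) by (intro max_var_pos(1)[OF leads_facts stable]) (auto simp: min_pprods_def)
    have "pdeg m \<le> S" unfolding S_def using m(1) by (intro member_le_sum finite_gens) auto
    then have "int (pdeg m) \<le> D" by (simp add: D_def)
    moreover have "(int n - 1) * E + D + 1 + int (n - max_var m) * (1 - (E + 1)) = (int (max_var m) - 1) * E + D + 1"
      using mv by (simp add: of_nat_diff algebra_simps)
    moreover have "0 \<le> (int (max_var m) - 1) * E" using mv DE(2) by (intro mult_nonneg_nonneg) auto
    ultimately show "int (pdeg m) \<le> (int n - 1) * E + D + 1 + int (n - max_var m) * (1 - (E + 1))" by linarith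
  qed
  moreover have "(int n - 1) * E + D < r + (E + 1) * int p"
  proof -
    have "int n * E \<le> int p * E" using p DE(2) by (intro mult_right_mono) auto
    then show ?thesis using DE(3) by (simp add: algebra_simps)
  qed
  ultimately show ?thesis by (simp add: vanish_above_def)
qed

end

section \<open>Local cohomology of the polynomial ring\<close>

lemma generic_coordinates_zero: "generic_coordinates n {0 :: 'k::field_char_0 mpoly} (1\<^sub>m n) (1\<^sub>m n)"
  by unfold_locales (auto simp: graded_ideal_zero leads_def is_lead_def GL_act_one)

text \<open>The zero ideal has no generators, and its chain ends in the residue field, concentrated
  in degree 0. The \<open>n\<close> steps shift the bound by \<open>n (1 - e)\<close>.\<close>

lemma vanish_above_PR_iff:
  assumes "e \<le> 1"
  shows "vanish_above n {0 :: 'k::field_char_0 mpoly} e \<rho> \<longleftrightarrow> 0 \<le> \<rho> + int n * (1 - e)"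
proof -
  interpret generic_coordinates n "{0 :: 'k mpoly}" "1\<^sub>m n" "1\<^sub>m n" by (rule generic_coordinates_zero)
  have zero: "GL_act n (1\<^sub>m n) ` {0 :: 'k mpoly} = {0}" by (simp add: GL_act_one)
  have L: "leads {0 :: 'k mpoly} = {}" by (simp add: leads_def is_lead_def)
  show ?thesis
  proof
    assume "0 \<le> \<rho> + int n * (1 - e)"
    then show "vanish_above n {0 :: 'k mpoly} e \<rho>" by (intro vanish_above_of_gens) (auto simp only: zero L min_pprods_def)
  next
    assume "vanish_above n {0 :: 'k mpoly} e \<rho>"
    then have "vanish_above n (section_ideal 0) e (\<rho> + int n * (1 - e))"
      using vanish_above_sections[OF _ assms, of \<rho> 0] by (simp only: le0 diff_zero)
    moreover have "(1 :: 'k mpoly) \<notin> section_ideal 0" by (rule one_not_in_section_0) (simp only: zero L)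
    moreover have "(1 :: 'k mpoly) \<in> PR n" "homogeneous 0 (1 :: 'k mpoly)" by (simp_all add: PR_one homogeneous_def)
    ultimately show "0 \<le> \<rho> + int n * (1 - e)" unfolding vanish_above_section_0_iff by (meson not_le)
  qed
qed

lemma vanish_PR:
  assumes "p \<noteq> n \<or> - int n < r"
  shows "vanish n (PR n) {0 :: 'k::field_char_0 mpoly} p r"
proof (cases "n < p")
  case False
  show ?thesis
  proof (cases "- int n < r")
    case True
    have "vanish_above n {0 :: 'k mpoly} 0 (- int n)" by (simp add: vanish_above_PR_iff)
    then show ?thesis using True by (simp add: vanish_above_def)
  next
    case r: False
    then have p: "p < n" using assms False by auto
    \<comment> \<open>With \<open>- e\<close> larger than \<open>- (r + n)\<close>, the pair
      \<open>(p, r)\<close> is above the bound already when \<open>n - p = 1\<close>.\<close>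
    define e where "e = - \<bar>r + int n\<bar> - 1"
    have "vanish_above n {0 :: 'k mpoly} e (- int n * (1 - e))" unfolding e_def by (subst vanish_above_PR_iff) auto
    moreover have "- int n * (1 - e) < r + e * int p"
    proof -
      have "- e * 1 \<le> - e * (int n - int p)" using p by (intro mult_left_mono) (auto simp: e_def)
      moreover have "- (r + int n) < - e" by (simp add: e_def)
      ultimately show ?thesis by (simp add: algebra_simps)
    qed
    ultimately show ?thesis by (simp add: vanish_above_def)
  qed
qed (rule vanish_beyond[OF graded_ideal_PR])

text \<open>The bound in \<open>vanish_above_PR_iff\<close> is sharp, so lowering it by 1 must fail
  at some pair.\<close>

lemma not_vanish_PR:
  assumes "e \<le> 1"
  shows "\<exists>p r. \<not> vanish n (PR n) {0 :: 'k::field_char_0 mpoly} p r \<and> - int n * (1 - e) \<le> r + e * int p"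
proof (rule ccontr)
  assume "\<not> ?thesis"
  then have "vanish_above n {0 :: 'k mpoly} e (- int n * (1 - e) - 1)" unfolding vanish_above_def by force
  then show False by (simp add: vanish_above_PR_iff[OF assms])
qed

text \<open>For \<open>e = 1\<close> this is the contribution of \<open>m\<close> to the regularity, for \<open>e = 0\<close> to the
  largest degree.\<close>

definition gen_degree :: "nat \<Rightarrow> int \<Rightarrow> pprod \<Rightarrow> int" where
  "gen_degree n e m = int (pdeg m) + (1 - e) * (int (max_var m) - int n - 1)"

context generic_coordinates
begin

context
  assumes proper: "0 \<notin> leads gI" and nonzero: "leads gI \<noteq> {}"
begin

lemma gens_nonzero: "m \<in> gens \<Longrightarrow> m \<noteq> 0 \<and> max_var m \<in> {1..n} \<and> 0 < pdeg m"
proof -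
  assume m: "m \<in> gens"
  then have "m \<in> leads gI" by (simp add: min_pprods_def)
  moreover from this have "m \<noteq> 0" using proper by auto
  ultimately show ?thesis using max_var_pos(1)[OF leads_facts stable, where m = m] pdeg_eq_0_iff[of m] by auto
qed

lemma gens_nonempty: "gens \<noteq> {}"
  using nonzero min_pprods_below by blast

text \<open>Through the long exact sequence the bound for \<open>R / I\<close> becomes one for
  \<open>I\<close>; above it \<open>H^p(R)\<close> must be seen to vanish as well.\<close>

lemma vanish_ideal_gt:
  assumes e: "e \<le> 1" and gt: "\<And>m. m \<in> gens \<Longrightarrow> gen_degree n e m < r + e * int p"
  shows "vanish n I {0} p r"
proof -
  define D where "D = Max (gen_degree n e ` gens)"
  have le: "gen_degree n e m \<le> D" if "m \<in> gens" for m using that finite_gens unfolding D_def by (intro Max_ge) auto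
  have "D \<in> gen_degree n e ` gens" unfolding D_def using finite_gens gens_nonempty by (intro Max_in) auto
  then obtain m0 where m0: "m0 \<in> gens" "D = gen_degree n e m0" by blast
  \<comment> \<open>A generator has degree at least 1 and its last variable is at least
    \<open>x_1\<close>. This keeps the pairs above \<open>D\<close> away from the nonzero part of
    \<open>H^n(R)\<close>.\<close>
  have D1: "1 - int n * (1 - e) \<le> D"
  proof -
    have "(1 - e) * (- int n) \<le> (1 - e) * (int (max_var m0) - int n - 1)"
      using gens_nonzero[OF m0(1)] e by (intro mult_left_mono) auto
    then show ?thesis using gens_nonzero[OF m0(1)] by (simp add: m0(2) gen_degree_def algebra_simps)
  qed
  \<comment> \<open>Shifted by \<open>e\<close> because \<open>H^p\<close> of \<open>I\<close>
    corresponds to \<open>H^(p-1)\<close> of \<open>R / I\<close>.\<close>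
  have above: "vanish_above n I e (D - e)"
  proof (rule vanish_above_of_gens)
    show "0 \<le> D - e + int n * (1 - e)" using D1 e by linarith
    fix m assume m: "m \<in> gens"
    have "int (n - max_var m) = int n - int (max_var m)" using gens_nonzero[OF m] by auto
    then show "int (pdeg m) \<le> D - e + 1 + int (n - max_var m) * (1 - e)"
      using le[OF m] by (simp add: gen_degree_def algebra_simps)
  qed
  have r: "D < r + e * int p" using gt[OF m0(1)] m0(2) by simp
  have n: "1 \<le> n" using gens_nonzero[OF m0(1)] by auto
  show ?thesis
  proof (cases p)
    case 0
    then show ?thesis using vanish_ideal_0[OF I vanish_PR, of r] n by simp
  next
    case (Suc q)
    have "vanish n (PR n) I q r" using above r by (simp add: vanish_above_def Suc algebra_simps)
    moreover have "vanish n (PR n) {0 :: 'k mpoly} (Suc q) r"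
    proof (rule vanish_PR)
      have "- int n < r" if "Suc q = n" using r D1 Suc that by (simp add: algebra_simps)
      then show "Suc q \<noteq> n \<or> - int n < r" by blast
    qed
    ultimately show ?thesis unfolding Suc by (intro vanish_ideal_Suc[OF I])
  qed
qed

text \<open>If no nonzero degree reached the value of \<open>m\<close>, the bound for
  \<open>R / I\<close> would drop by 1, and \<open>gens_bound\<close> would give
  \<open>deg m \<le> deg m - 1\<close>.\<close>

lemma not_vanish_ideal:
  assumes e: "e \<le> 1" and m: "m \<in> gens"
  shows "\<exists>p r. \<not> vanish n I {0} p r \<and> gen_degree n e m \<le> r + e * int p"
proof (rule ccontr)
  assume no: "\<not> ?thesis"
  have n: "1 \<le> n" using gens_nonzero[OF m] by auto
  have "vanish_above n I e (gen_degree n e m - 1 - e)"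
    unfolding vanish_above_def
  proof (intro allI impI)
    fix p r assume pr: "gen_degree n e m - 1 - e < r + e * int p"
    show "vanish n (PR n) I p r"
    \<comment> \<open>From \<open>p = n\<close> on the exact sequence is of no help, since
      \<open>H^n(R)\<close> can be nonzero; the dimension of \<open>R / I\<close> takes its
      place.\<close>
    proof (cases "n \<le> p")
      case True
      then show ?thesis using vanish_dimension[OF n] nonzero by blast
    next
      case False
      have "gen_degree n e m \<le> r + e * int (Suc p)" using pr by (simp add: algebra_simps)
      then have "vanish n I {0} (Suc p) r" using no by blast
      moreover have "vanish n (PR n) {0 :: 'k mpoly} p r" using False by (intro vanish_PR) auto
      ultimately show ?thesis by (intro vanish_mod_ideal[OF I])
    qed
  qed
  from gens_bound[OF this e m] gens_nonzero[OF m]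
  have "int (pdeg m) \<le> gen_degree n e m - 1 - e + 1 + int (n - max_var m) * (1 - e)" "int (n - max_var m) = int n - int (max_var m)"
    by auto
  then show False by (simp add: gen_degree_def algebra_simps)
qed

end

theorem vanish_gt:
  assumes e: "e \<le> 1" and gt: "\<And>m. m \<in> gens \<Longrightarrow> gen_degree n e m < r + e * int p"
  shows "vanish n I {0} p r"
proof -
  consider "leads gI = {}" | "0 \<in> leads gI" | "leads gI \<noteq> {}" "0 \<notin> leads gI" by blast
  then show ?thesis
  proof cases
    case 1
    have "vanish n {0 :: 'k mpoly} {0} p r"
      unfolding vanish_def by (intro ballI impI bexI[of _ "\<lambda>S. 0"]) (simp_all add: cobounds_zero[OF graded_ideal_zero])
    then show ?thesis using leads_empty_imp_zero[OF 1] by simp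
  next
    \<comment> \<open>The unit ideal: its only minimal generator is 1, and
      \<open>max_var 0 = 1\<close> makes the value of this generator equal to the bound for
      \<open>R\<close>.\<close>
    case 2
    then obtain s u where s: "s \<in> gens" "0 = s + u" using min_pprods_below by blast
    have "s = 0" using arg_cong[OF s(2), of pdeg] pdeg_eq_0_iff[of s] by simp
    then have "0 \<in> gens" using s(1) by simp
    then have "- int n * (1 - e) < r + e * int p"
      using gt[of 0] by (simp add: gen_degree_def max_var_def algebra_simps)
    moreover have "vanish_above n {0 :: 'k mpoly} e (- int n * (1 - e))" by (simp add: vanish_above_PR_iff[OF e])
    ultimately have "vanish n (PR n) {0 :: 'k mpoly} p r" by (simp add: vanish_above_def)
    then show ?thesis using leads_zero_imp_PR[OF 2] by simp
  qed (use vanish_ideal_gt assms in blast)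
qed

theorem not_vanish:
  assumes e: "e \<le> 1" and m: "m \<in> gens"
  shows "\<exists>p r. \<not> vanish n I {0} p r \<and> gen_degree n e m \<le> r + e * int p"
proof (cases "0 \<in> leads gI")
  case True
  then have "m = 0" using m by (force simp: min_pprods_def)
  then have "gen_degree n e m = - int n * (1 - e)" by (simp add: gen_degree_def max_var_def algebra_simps)
  then show ?thesis using not_vanish_PR[OF e, of n, where 'k = 'k] leads_zero_imp_PR[OF True] by simp
next
  case False
  moreover have "leads gI \<noteq> {}" using m by (auto simp: min_pprods_def)
  ultimately show ?thesis using not_vanish_ideal[OF _ _ e m] by blast
qed

end

text \<open>Holds for empty \<open>M\<close> too, where both sides are minus infinity because
  \<open>c\<close> is finite.\<close>

lemma SUP_ereal_add: "(SUP x\<in>M. ereal (f x)) + ereal c = (SUP x\<in>M. ereal (f x + c))"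
proof (rule antisym)
  have "(SUP x\<in>M. ereal (f x)) \<le> (SUP x\<in>M. ereal (f x + c)) - ereal c"
  proof (rule SUP_least)
    fix x assume "x \<in> M"
    then have "ereal (f x) + ereal c \<le> (SUP x\<in>M. ereal (f x + c))" by (auto intro: SUP_upper2)
    then show "ereal (f x) \<le> (SUP x\<in>M. ereal (f x + c)) - ereal c" by (simp add: ereal_le_minus)
  qed
  then show "(SUP x\<in>M. ereal (f x)) + ereal c \<le> (SUP x\<in>M. ereal (f x + c))" by (simp add: ereal_le_minus)
  show "(SUP x\<in>M. ereal (f x + c)) \<le> (SUP x\<in>M. ereal (f x)) + ereal c"
    by (rule SUP_least) (auto simp flip: plus_ereal.simps(1) intro!: add_right_mono SUP_upper)
qed

text \<open>Equality of the suprema needs no list of all nonzero degrees: it suffices that each of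
  the two sets is dominated by the other.\<close>

lemma SUP_degrees_eq:
  fixes M :: "'a set" and P :: "nat \<Rightarrow> int \<Rightarrow> bool" and d :: "'a \<Rightarrow> int" and e :: int
  assumes le: "\<And>p r. P p r \<Longrightarrow> \<exists>m\<in>M. r + e * int p \<le> d m"
    and ge: "\<And>m. m \<in> M \<Longrightarrow> \<exists>p r. P p r \<and> d m \<le> r + e * int p"
  shows "(SUP p. (SUP r\<in>{r. P p r}. ereal (real_of_int r)) + ereal (real_of_int e * real p)) =
    (SUP m\<in>M. ereal (real_of_int (d m)))"
  unfolding SUP_ereal_add
proof (intro antisym SUP_least)
  fix p r assume "r \<in> {r. P p r}"
  then obtain m where m: "m \<in> M" "r + e * int p \<le> d m" using le by blast
  then have "real_of_int (r + e * int p) \<le> real_of_int (d m)" by (simp only: of_int_le_iff)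
  then show "ereal (real_of_int r + real_of_int e * real p) \<le> (SUP m\<in>M. ereal (real_of_int (d m)))"
    by (intro SUP_upper2[OF m(1)]) simp
next
  fix m assume "m \<in> M"
  then obtain p r where pr: "P p r" "d m \<le> r + e * int p" using ge by blast
  then have "real_of_int (d m) \<le> real_of_int (r + e * int p)" by (simp only: of_int_le_iff)
  then have "ereal (real_of_int (d m)) \<le> ereal (real_of_int r + real_of_int e * real p)" by simp
  also have "\<dots> \<le> (SUP r\<in>{r. P p r}. ereal (real_of_int r + real_of_int e * real p))"
    using pr(1) by (intro SUP_upper) simp
  also have "\<dots> \<le> (SUP p. SUP r\<in>{r. P p r}. ereal (real_of_int r + real_of_int e * real p))"
    by (rule SUP_upper) simp
  finally show "ereal (real_of_int (d m)) \<le> (SUP p. SUP r\<in>{r. P p r}. ereal (real_of_int r + real_of_int e * real p))" .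
qed

theorem corollary6p9:
  fixes n :: nat and I :: "'k::field_char_0 mpoly set"
  assumes "homogeneous_ideal n I"
  shows "regularity n (ideal_module I) (ideal_grading I) =
           (SUP t\<in>Min_gens n (Gin n I). ereal (real (pdeg t))) \<and>
         a_star n (ideal_module I) (ideal_grading I) =
           (SUP t\<in>Min_gens n (Gin n I). ereal (real (pdeg t + max_var t))) - ereal (real n) - 1"
proof -
  have I: "graded_ideal n I" using assms by (rule homogeneous_ideal_imp_graded)
  obtain U where "U \<noteq> {}" "U \<subseteq> GL n" "\<And>g. g \<in> U \<Longrightarrow> leads (GL_act n g ` I) = gen_leads n I"
    using generic_leads[OF I] by metis
  then obtain g where gU: "g \<in> GL n" "leads (GL_act n g ` I) = gen_leads n I" by blast
  obtain g' where g': "g' \<in> GL n" "g * g' = 1\<^sub>m n" "g' * g = 1\<^sub>m n" by (rule GL_inverse[OF gU(1)])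
  \<comment> \<open>Stability is known for the generic leading terms; it passes to
    \<open>g I\<close> because \<open>g\<close> was taken where the two sets agree.\<close>
  interpret generic_coordinates n I g g'
    using gen_leads_stable[OF I] by unfold_locales (simp_all only: I gU g')
  have gens: "Min_gens n (Gin n I) = gens" using Min_gens_Gin[OF I] gU(2) by simp
  have main: "(SUP p. top_degree n (ideal_module I) (ideal_grading I) p + ereal (real_of_int e * real p)) =
    (SUP m\<in>gens. ereal (real_of_int (gen_degree n e m)))" if e: "e \<le> 1" for e
    unfolding top_degree_def local_cohomology_nonzero_iff[OF I]
  proof (rule SUP_degrees_eq)
    show "\<exists>m\<in>gens. r + e * int p \<le> gen_degree n e m" if "\<not> vanish n I {0} p r" for p r
      using vanish_gt[OF e] that by (meson not_le)
    show "\<exists>p r. \<not> vanish n I {0} p r \<and> gen_degree n e m \<le> r + e * int p" if "m \<in> gens" for m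
      using not_vanish[OF e that] .
  qed
  have "regularity n (ideal_module I) (ideal_grading I) = (SUP t\<in>gens. ereal (real (pdeg t)))"
    using main[of 1] by (simp add: regularity_def gen_degree_def)
  moreover have "a_star n (ideal_module I) (ideal_grading I) =
    (SUP t\<in>gens. ereal (real (pdeg t + max_var t) + (- real n - 1)))"
    using main[of 0] by (simp add: a_star_def gen_degree_def algebra_simps zero_ereal_def[symmetric])
  ultimately show ?thesis
    unfolding gens SUP_ereal_add[symmetric]
    by (simp add: minus_ereal_def one_ereal_def add.assoc)
qed

end
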